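(* Let $R$ be a Huber ring, $(A,\underline{\sigma})$ a twisted $R$-adic algebra of order $d$, and $\underline{x}=(x_1,\ldots,x_d)$ elements of $A$ which are classical (good) $\underline{\sigma}$-coordinates. Then there is an equivalence of categories $$\nabla_{\underline{\sigma}}\text{-}\mathrm{Mod}(A)\simeq \mathrm{T}_{A,\underline{\sigma}}\text{-}\mathrm{Mod}(A)$$ between the category of $A$-modules endowed with a twisted connection and the category of $A$-modules endowed with an action of the twisted derivations.
   Context: Huber rings. All rings are unitary. A Huber ring is a commutative topological ring $A$ having an open subring $A_0$ (a ring of definition) and a finitely generated ideal $I_0\subset A_0$ (an ideal of definition) such that $\{I_0^n\}_n$ is a fundamental system of neighbourhoods of $0$ in $A_0$; it is an adic ring if one can take $A_0=A$. A morphism of Huber rings is a continuous ring homomorphism; $u:A\to B$ is adic if there are rings of definition $A_0,B_0$ and an ideal of definition $I_0$ of $A_0$ with $u(A_0)\subset B_0$ and $u(I_0)B_0$ an ideal of definition of $B$. An $R$-adic algebra is a Huber ring $A$ with an adic morphism $R\to A$. Polynomial rings $A[\underline X]$ are Huber rings with ring of definition $A_0[\underline X]$ and ideal of definition $I_0A_0[\underline X]$. Good étale coordinates. A morphism $\varphi:A\to B$ is topologically of finite presentation if it is adic and there are rings of definition $A_0,B_0$ with $\varphi(A_0)\subset B_0$ such that $A_0/I\to B_0/\varphi(I)B_0$ is of finite presentation for every ideal of definition $I\subset A_0$ and $A\otimes_{A_0}\widehat{B_0}\to\widehat B$ is of finite presentation. A morphism of adic rings $A\to B$ is formally étale if for every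 complete adic ring $C$, nilpotent ideal $\mathfrak c\subset C$, and commutative square of adic rings formed by $A\to C$, $B\to C/\mathfrak c$, $A\to B$, $C\to C/\mathfrak c$, there is a unique morphism $B\to C$ making the diagram commute; it is topologically étale if it is formally étale and topologically of finite presentation. A morphism $\varphi:A\to B$ of Huber rings is good étale, with good model $(\varphi_0,A_0,B_0)$, if $A_0,B_0$ are rings of definition with $\varphi(A_0)\subset B_0$, the induced $\varphi_0:A_0\to B_0$ is topologically étale and $B=A\otimes_{A_0}B_0$. Elements $x_1,\dots,x_d$ of a Huber $R$-algebra $A$ are good étale coordinates, with good model $(\varphi_0,R_0,A_0)$, if $\varphi:R[X_1,\dots,X_d]\to A$, $X_i\mapsto x_i$, is good étale with a good model of the form $\varphi_0:R_0[X_1,\dots,X_d]\to A_0$. Twisted algebras and coordinates. A twisted $R$-adic algebra of order $d$ is an $R$-adic algebra $A$ with pairwise commuting continuous $R$-linear ring endomorphisms $\underline{\sigma}=(\sigma_1,\dots,\sigma_d)$. Given $\underline x=(x_1,\dots,x_d)\in A^d$, put in $A[\underline\xi]=A[\xi_1,\dots,\xi_d]$, for $\underline k\in\mathbb N^d$, $\underline\xi^{(\underline k)_{\underline\sigma}}=\prod_{i=1}^d\prod_{j=0}^{k_i-1}(\xi_i+x_i-\sigma_i^j(x_i))$, and $P_{A,(n)_{\underline\sigma}}=A[\underline\xi]/(\underline\xi^{(\underline k)_{\underline\sigma}}: |\underline k|=n+1)$ with the quotient topology. It is a free $A$-module with basis $\{\underline\xi^{(\underline k)_{\underline\sigma}}\}_{|\underline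 k|\le n}$. The $x_i$ are $\underline\sigma$-coordinates if for every $n\in\mathbb N$ there is a unique adic morphism of $R$-algebras $\Theta_{A,(n)_{\underline\sigma}}:A\to P_{A,(n)_{\underline\sigma}}$ with $x_i\mapsto x_i+\xi_i$ whose composition with the projection $P_{A,(n)_{\underline\sigma}}\to A$, $\xi_i\mapsto0$, is the identity. They are good $\underline\sigma$-coordinates if they are good étale coordinates with a good model $(\varphi_0,R_0,A_0)$ such that $\sigma_i(A_0)\subset A_0$ for all $i$ and they are $\underline\sigma$-coordinates of the twisted $R_0$-adic algebra $(A_0,\underline\sigma)$; then $\Theta_{A,(n)_{\underline\sigma}}:=\mathrm{Id}_R\otimes\Theta_{A_0,(n)_{\underline\sigma}}:A=R\otimes_{R_0}A_0\to R\otimes_{R_0}P_{A_0,(n)_{\underline\sigma}}=P_{A,(n)_{\underline\sigma}}$. "(Good) $\underline\sigma$-coordinates" means: $\underline\sigma$-coordinates or good $\underline\sigma$-coordinates. Derivations and connections. The $R$-linear maps $\partial_{\underline\sigma,i}:A\to A$ are defined by $\Theta_{A,(1)_{\underline\sigma}}(f)=f+\sum_{i=1}^d\partial_{\underline\sigma,i}(f)\xi_i$. The coordinates are classical if $\sigma_i(f)=f+(\sigma_i(x_i)-x_i)\partial_{\underline\sigma,i}(f)$ for all $f\in A$, $i=1,\dots,d$. The module of twisted differential forms is $\Omega^1_{A,\underline\sigma}=I_A^{(1)_{\underline\sigma}}/I_A^{(2)_{\underline\sigma}}$, where $I_A^{(n+1)_{\underline\sigma}}$ is the kernel of $A\otimes_RA\to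 P_{A,(n)_{\underline\sigma}}$, $a\otimes b\mapsto a\,\Theta_{A,(n)_{\underline\sigma}}(b)$; it is identified with the kernel of $P_{A,(1)_{\underline\sigma}}\to A$, which is the free $A$-module on $\xi_1,\dots,\xi_d$ (the class of $1\otimes x_i-x_i\otimes1$ corresponding to $\xi_i$). A twisted connection on an $A$-module $M$ is a map $\nabla_{\underline\sigma}:M\to M\otimes_A\Omega^1_{A,\underline\sigma}$ such that $\Theta_M:M\to M\otimes_AP_{A,(1)_{\underline\sigma}}$, $s\mapsto s\otimes1+\nabla_{\underline\sigma}(s)$, is $\Theta_{A,(1)_{\underline\sigma}}$-linear, i.e. is additive and $\Theta_M(fs)=\Theta_{A,(1)_{\underline\sigma}}(f)\Theta_M(s)$ for $f\in A$, $s\in M$. $\nabla_{\underline\sigma}\text{-}\mathrm{Mod}(A)$ is the category of $A$-modules with a twisted connection (morphisms: $A$-linear maps compatible with the connections). $\mathrm T_{A,\underline\sigma}\text{-}\mathrm{Mod}(A)$ is the category of $A$-modules $M$ endowed with $R$-linear maps $\partial_{M,\underline\sigma,i}:M\to M$ ($i=1,\dots,d$) with $\partial_{M,\underline\sigma,i}(am)=\partial_{\underline\sigma,i}(a)m+\sigma_i(a)\partial_{M,\underline\sigma,i}(m)$ for $a\in A$, $m\in M$ (morphisms: $A$-linear maps commuting with these operators). *)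

theory Defs
  imports
    "HOL-Algebra.Algebra"
    "HOL-Analysis.Analysis"
begin

section \<open>Topological rings, Huber rings\<close>

record 'a topring = "'a ring" +
  topo :: "'a topology"

definition topologize :: "('a, 'e) ring_scheme \<Rightarrow> 'a topology \<Rightarrow> 'a topring" where
  "topologize B T = \<lparr>carrier = carrier B, monoid.mult = monoid.mult B, one = \<one>\<^bsub>B\<^esub>,
     ring.zero = \<zero>\<^bsub>B\<^esub>, add = add B, topo = T\<rparr>"

definition subtop :: "'a topring \<Rightarrow> 'a set \<Rightarrow> 'a topring" where
  "subtop A S = A\<lparr>carrier := S, topo := subtopology (topo A) S\<rparr>"

definition topological_ring :: "'a topring \<Rightarrow> bool" where
  "topological_ring A \<longleftrightarrow> cring A \<and> topspace (topo A) = carrier A \<and>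
     continuous_map (prod_topology (topo A) (topo A)) (topo A) (\<lambda>(a, b). a \<oplus>\<^bsub>A\<^esub> b) \<and>
     continuous_map (prod_topology (topo A) (topo A)) (topo A) (\<lambda>(a, b). a \<otimes>\<^bsub>A\<^esub> b) \<and>
     continuous_map (topo A) (topo A) (\<lambda>a. \<ominus>\<^bsub>A\<^esub> a)"

definition ideal_of_definition :: "'a topring \<Rightarrow> 'a set \<Rightarrow> 'a set \<Rightarrow> bool" where
  "ideal_of_definition A A0 I \<longleftrightarrow>
     subring A0 A \<and> openin (topo A) A0 \<and>
     (\<exists>S. finite S \<and> S \<subseteq> A0 \<and> I = Idl\<^bsub>subtop A A0\<^esub> S) \<and>
     (\<forall>n::nat. \<exists>U. openin (topo (subtop A A0)) U \<and> \<zero>\<^bsub>A\<^esub> \<in> U \<and>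
        U \<subseteq> I [^]\<^bsub>ideals_set (subtop A A0)\<^esub> n) \<and>
     (\<forall>U. openin (topo (subtop A A0)) U \<and> \<zero>\<^bsub>A\<^esub> \<in> U \<longrightarrow>
        (\<exists>n::nat. I [^]\<^bsub>ideals_set (subtop A A0)\<^esub> n \<subseteq> U))"

definition ring_of_definition :: "'a topring \<Rightarrow> 'a set \<Rightarrow> bool" where
  "ring_of_definition A A0 \<longleftrightarrow> (\<exists>I. ideal_of_definition A A0 I)"

definition huber_ring :: "'a topring \<Rightarrow> bool" where
  "huber_ring A \<longleftrightarrow> topological_ring A \<and> (\<exists>A0. ring_of_definition A A0)"

definition adic_ring :: "'a topring \<Rightarrow> bool" where
  "adic_ring A \<longleftrightarrow> topological_ring A \<and> ring_of_definition A (carrier A)"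

definition huber_hom :: "'a topring \<Rightarrow> 'b topring \<Rightarrow> ('a \<Rightarrow> 'b) set" where
  "huber_hom A B = {u \<in> ring_hom A B. continuous_map (topo A) (topo B) u}"

definition adic_hom :: "'a topring \<Rightarrow> 'b topring \<Rightarrow> ('a \<Rightarrow> 'b) \<Rightarrow> bool" where
  "adic_hom A B u \<longleftrightarrow> u \<in> huber_hom A B \<and>
     (\<exists>A0 B0 I. ideal_of_definition A A0 I \<and> ring_of_definition B B0 \<and> u ` A0 \<subseteq> B0 \<and>
        ideal_of_definition B B0 (Idl\<^bsub>subtop B B0\<^esub> (u ` I)))"

text \<open>An algebra is given by its structure map \<open>\<rho>\<close>.\<close>

definition adic_algebra :: "'r topring \<Rightarrow> 'a topring \<Rightarrow> ('r \<Rightarrow> 'a) \<Rightarrow> bool" where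
  "adic_algebra R A \<rho> \<longleftrightarrow> huber_ring R \<and> huber_ring A \<and> adic_hom R A \<rho>"


section \<open>Quotients and completions\<close>

text \<open>The map induced on cosets by a map that is constant on each coset.\<close>

definition induced :: "('a \<Rightarrow> 'b) \<Rightarrow> 'a set \<Rightarrow> 'b" where
  "induced f V = the_elem (f ` V)"

definition top_quot :: "'a topring \<Rightarrow> 'a set \<Rightarrow> 'a set topring" where
  "top_quot A I = topologize (A Quot I)
     (topology (\<lambda>U. U \<subseteq> carrier (A Quot I) \<and>
        openin (topo A) {a \<in> carrier A. I +>\<^bsub>A\<^esub> a \<in> U}))"

text \<open>Huber rings are first countable, so sequences suffice to describe completeness and the
  (Hausdorff) completion, here as Cauchy sequences modulo null sequences.\<close>

definition cauchy_seqs :: "'a topring \<Rightarrow> (nat \<Rightarrow> 'a) set" where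
  "cauchy_seqs A = {s. (\<forall>n. s n \<in> carrier A) \<and>
     (\<forall>U. openin (topo A) U \<and> \<zero>\<^bsub>A\<^esub> \<in> U \<longrightarrow> (\<exists>N. \<forall>m\<ge>N. \<forall>n\<ge>N. s m \<ominus>\<^bsub>A\<^esub> s n \<in> U))}"

definition null_seqs :: "'a topring \<Rightarrow> (nat \<Rightarrow> 'a) set" where
  "null_seqs A = {s. (\<forall>n. s n \<in> carrier A) \<and> limitin (topo A) s \<zero>\<^bsub>A\<^esub> sequentially}"

definition cauchy_ring :: "'a topring \<Rightarrow> (nat \<Rightarrow> 'a) ring" where
  "cauchy_ring A = \<lparr>carrier = cauchy_seqs A, monoid.mult = (\<lambda>s t n. s n \<otimes>\<^bsub>A\<^esub> t n),
     one = (\<lambda>_. \<one>\<^bsub>A\<^esub>), ring.zero = (\<lambda>_. \<zero>\<^bsub>A\<^esub>), add = (\<lambda>s t n. s n \<oplus>\<^bsub>A\<^esub> t n)\<rparr>"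

definition ring_completion :: "'a topring \<Rightarrow> (nat \<Rightarrow> 'a) set ring" where
  "ring_completion A = cauchy_ring A Quot null_seqs A"

definition to_completion :: "'a topring \<Rightarrow> 'a \<Rightarrow> (nat \<Rightarrow> 'a) set" where
  "to_completion A a = null_seqs A +>\<^bsub>cauchy_ring A\<^esub> (\<lambda>_. a)"

definition complete_ring :: "'a topring \<Rightarrow> bool" where
  "complete_ring A \<longleftrightarrow> (\<forall>s \<in> cauchy_seqs A. \<exists>!l. limitin (topo A) s l sequentially)"


section \<open>Polynomial rings\<close>

text \<open>Polynomials in the variables indexed by \<open>{..<d}\<close>, as coefficient functions on monomials
  (multisets of indices) as in \<^theory>\<open>HOL-Algebra.Indexed_Polynomials\<close>.\<close>

definition mpoly :: "('a, 'e) ring_scheme \<Rightarrow> nat \<Rightarrow> (nat multiset \<Rightarrow> 'a) ring" where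
  "mpoly A d =
     \<lparr>carrier = {p. (\<forall>m. p m \<in> carrier A) \<and> finite {m. p m \<noteq> \<zero>\<^bsub>A\<^esub>} \<and>
        (\<forall>m. p m \<noteq> \<zero>\<^bsub>A\<^esub> \<longrightarrow> set_mset m \<subseteq> {..<d})},
      monoid.mult = (\<lambda>p q m. \<Oplus>\<^bsub>A\<^esub>l \<in> {l. l \<subseteq># m}. p l \<otimes>\<^bsub>A\<^esub> q (m - l)),
      one = ring.indexed_const A \<one>\<^bsub>A\<^esub>,
      ring.zero = ring.indexed_const A \<zero>\<^bsub>A\<^esub>,
      add = ring.indexed_padd A\<rparr>"

definition mpoly_eval ::
    "('a, 'e) ring_scheme \<Rightarrow> ('b, 'f) ring_scheme \<Rightarrow> ('a \<Rightarrow> 'b) \<Rightarrow> (nat \<Rightarrow> 'b) \<Rightarrow>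
      (nat multiset \<Rightarrow> 'a) \<Rightarrow> 'b" where
  "mpoly_eval A B f x p = (\<Oplus>\<^bsub>B\<^esub>m \<in> {m. p m \<noteq> \<zero>\<^bsub>A\<^esub>}.
     f (p m) \<otimes>\<^bsub>B\<^esub> (\<Otimes>\<^bsub>B\<^esub>i \<in> set_mset m. x i [^]\<^bsub>B\<^esub> count m i))"

text \<open>The topology on \<open>A[X]\<close> with ring of definition \<open>A\<^sub>0[X]\<close> and ideal of definition
  \<open>I\<^sub>0A\<^sub>0[X]\<close>. It does not depend on \<open>(A\<^sub>0, I\<^sub>0)\<close>; quantifying over all pairs avoids a choice.\<close>

definition huber_mpoly :: "'a topring \<Rightarrow> nat \<Rightarrow> (nat multiset \<Rightarrow> 'a) topring" where
  "huber_mpoly A d = topologize (mpoly A d)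
     (topology (\<lambda>U. U \<subseteq> carrier (mpoly A d) \<and>
        (\<forall>A0 I. ideal_of_definition A A0 I \<longrightarrow> (\<forall>p \<in> U. \<exists>n::nat.
           ((Idl\<^bsub>mpoly (subtop A A0) d\<^esub> (ring.indexed_const A ` I))
              [^]\<^bsub>ideals_set (mpoly (subtop A A0) d)\<^esub> n) +>\<^bsub>mpoly A d\<^esub> p \<subseteq> U))))"

definition finitely_presented ::
    "('a, 'e) ring_scheme \<Rightarrow> ('b, 'f) ring_scheme \<Rightarrow> ('a \<Rightarrow> 'b) \<Rightarrow> bool" where
  "finitely_presented A B f \<longleftrightarrow> f \<in> ring_hom A B \<and>
     (\<exists>n t. t \<in> {..<n} \<rightarrow> carrier B \<and>
        mpoly_eval A B f t ` carrier (mpoly A n) = carrier B \<and>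
        (\<exists>S. finite S \<and> S \<subseteq> carrier (mpoly A n) \<and>
           a_kernel (mpoly A n) B (mpoly_eval A B f t) = Idl\<^bsub>mpoly A n\<^esub> S))"


section \<open>Tensor products\<close>

definition alg :: "('r \<Rightarrow> 'b) \<Rightarrow> ('b, 'e) ring_scheme \<Rightarrow> ('r, 'b) module" where
  "alg f B = \<lparr>carrier = carrier B, monoid.mult = monoid.mult B, one = \<one>\<^bsub>B\<^esub>,
     ring.zero = \<zero>\<^bsub>B\<^esub>, add = add B, module.smult = (\<lambda>r b. f r \<otimes>\<^bsub>B\<^esub> b)\<rparr>"

definition tensor_rel ::
    "('r, 'e) ring_scheme \<Rightarrow> ('r, 'm, 'f) module_scheme \<Rightarrow> ('r, 'n, 'g) module_scheme \<Rightarrow>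
      ('m \<times> 'n \<Rightarrow>\<^sub>0 int) set" where
  "tensor_rel R M N = generate (free_Abelian_group (carrier M \<times> carrier N))
     ({frag_of (m \<oplus>\<^bsub>M\<^esub> m', n) - frag_of (m, n) - frag_of (m', n) | m m' n.
         m \<in> carrier M \<and> m' \<in> carrier M \<and> n \<in> carrier N} \<union>
      {frag_of (m, n \<oplus>\<^bsub>N\<^esub> n') - frag_of (m, n) - frag_of (m, n') | m n n'.
         m \<in> carrier M \<and> n \<in> carrier N \<and> n' \<in> carrier N} \<union>
      {frag_of (r \<odot>\<^bsub>M\<^esub> m, n) - frag_of (m, r \<odot>\<^bsub>N\<^esub> n) | r m n.
         r \<in> carrier R \<and> m \<in> carrier M \<and> n \<in> carrier N})"

definition tens ::
    "('r, 'e) ring_scheme \<Rightarrow> ('r, 'm, 'f) module_scheme \<Rightarrow> ('r, 'n, 'g) module_scheme \<Rightarrow>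
      'm \<Rightarrow> 'n \<Rightarrow> ('m \<times> 'n \<Rightarrow>\<^sub>0 int) set" where
  "tens R M N m n =
     tensor_rel R M N #>\<^bsub>free_Abelian_group (carrier M \<times> carrier N)\<^esub> frag_of (m, n)"

text \<open>\<open>M \<otimes>\<^sub>R N\<close>, with \<open>(m \<otimes> n)(m' \<otimes> n') = mm' \<otimes> nn'\<close> and unit \<open>1 \<otimes> 1\<close>; the latter two are
  only meaningful when \<open>M\<close> and \<open>N\<close> are \<open>R\<close>-algebras.\<close>

definition tensor ::
    "('r, 'e) ring_scheme \<Rightarrow> ('r, 'm, 'f) module_scheme \<Rightarrow> ('r, 'n, 'g) module_scheme \<Rightarrow>
      ('r, ('m \<times> 'n \<Rightarrow>\<^sub>0 int) set) module" where
  "tensor R M N = (let F = free_Abelian_group (carrier M \<times> carrier N); K = tensor_rel R M N in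
     \<lparr>carrier = rcosets\<^bsub>F\<^esub> K,
      monoid.mult = (\<lambda>V W. \<Union>u\<in>V. \<Union>v\<in>W. K #>\<^bsub>F\<^esub>
        frag_extend (\<lambda>(m, n). frag_extend
          (\<lambda>(m', n'). frag_of (m \<otimes>\<^bsub>M\<^esub> m', n \<otimes>\<^bsub>N\<^esub> n')) v) u),
      one = tens R M N \<one>\<^bsub>M\<^esub> \<one>\<^bsub>N\<^esub>,
      ring.zero = K,
      add = (\<lambda>V W. V <#>\<^bsub>F\<^esub> W),
      module.smult = (\<lambda>r V. \<Union>u\<in>V. K #>\<^bsub>F\<^esub> frag_extend (\<lambda>(m, n). frag_of (r \<odot>\<^bsub>M\<^esub> m, n)) u)\<rparr>)"

text \<open>The additive map on \<open>M \<otimes>\<^sub>R N\<close> determined by a balanced biadditive map \<open>b\<close>.\<close>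

definition tensor_lift ::
    "('r, 'e) ring_scheme \<Rightarrow> ('r, 'm, 'f) module_scheme \<Rightarrow> ('r, 'n, 'g) module_scheme \<Rightarrow>
      ('t, 'h) ring_scheme \<Rightarrow> ('m \<Rightarrow> 'n \<Rightarrow> 't) \<Rightarrow> ('m \<times> 'n \<Rightarrow>\<^sub>0 int) set \<Rightarrow> 't" where
  "tensor_lift R M N T b = (THE h. h \<in> carrier (tensor R M N) \<rightarrow>\<^sub>E carrier T \<and>
     (\<forall>V \<in> carrier (tensor R M N). \<forall>W \<in> carrier (tensor R M N).
        h (V \<oplus>\<^bsub>tensor R M N\<^esub> W) = h V \<oplus>\<^bsub>T\<^esub> h W) \<and>
     (\<forall>m \<in> carrier M. \<forall>n \<in> carrier N. h (tens R M N m n) = b m n))"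

definition tensor_map ::
    "('r, 'e) ring_scheme \<Rightarrow> ('r, 'm, 'f) module_scheme \<Rightarrow> ('r, 'n, 'g) module_scheme \<Rightarrow>
      ('r, 'm', 'f') module_scheme \<Rightarrow> ('r, 'n', 'g') module_scheme \<Rightarrow>
      ('m \<Rightarrow> 'm') \<Rightarrow> ('n \<Rightarrow> 'n') \<Rightarrow> ('m \<times> 'n \<Rightarrow>\<^sub>0 int) set \<Rightarrow> ('m' \<times> 'n' \<Rightarrow>\<^sub>0 int) set" where
  "tensor_map R M N M' N' f g =
     tensor_lift R M N (tensor R M' N') (\<lambda>m n. tens R M' N' (f m) (g n))"


section \<open>Good etale coordinates\<close>

definition top_finitely_presented :: "'a topring \<Rightarrow> 'b topring \<Rightarrow> ('a \<Rightarrow> 'b) \<Rightarrow> bool" where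
  "top_finitely_presented A B \<phi> \<longleftrightarrow> adic_hom A B \<phi> \<and>
     (\<exists>A0 B0. ring_of_definition A A0 \<and> ring_of_definition B B0 \<and> \<phi> ` A0 \<subseteq> B0 \<and>
        (\<forall>I. ideal_of_definition A A0 I \<longrightarrow>
           (let J = Idl\<^bsub>subtop B B0\<^esub> (\<phi> ` I) in
              finitely_presented (subtop A A0 Quot I) (subtop B B0 Quot J)
                (induced (\<lambda>a. J +>\<^bsub>subtop B B0\<^esub> \<phi> a)))) \<and>
        (let MA = alg (\<lambda>a. a) A;
             MB = alg (\<lambda>a. to_completion (subtop B B0) (\<phi> a)) (ring_completion (subtop B B0))
         in finitely_presented (tensor (subtop A A0) MA MB) (ring_completion B)
              (tensor_lift (subtop A A0) MA MB (ring_completion B)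
                (\<lambda>a V. to_completion B (\<phi> a) \<otimes>\<^bsub>ring_completion B\<^esub>
                   induced (\<lambda>s. null_seqs B +>\<^bsub>cauchy_ring B\<^esub> s) V))))"

text \<open>The test rings \<open>C\<close> range over all topological rings with elements in the type
  \<open>nat \<Rightarrow> 'a + 'b\<close>. Up to isomorphism this loses nothing: given a lifting problem for an arbitrary
  complete adic \<open>C\<close>, the images of \<open>A\<close>, of lifts of the image of \<open>B\<close>, and generators (with the
  coefficients witnessing continuity) of an ideal of definition lie in a subring of cardinality
  at most \<open>(|A| + |B| + \<aleph>\<^sub>0)\<close> to the power \<open>\<aleph>\<^sub>0\<close> that is complete for
  the adic topology of these generators.\<close>

definition formally_etale :: "'a topring \<Rightarrow> 'b topring \<Rightarrow> ('a \<Rightarrow> 'b) \<Rightarrow> bool" where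
  "formally_etale A B \<phi> \<longleftrightarrow> adic_ring A \<and> adic_ring B \<and> \<phi> \<in> huber_hom A B \<and>
     (\<forall>(C :: (nat \<Rightarrow> 'a + 'b) topring) c f g.
        adic_ring C \<and> complete_ring C \<and>
        ideal c C \<and> (\<exists>n::nat. c [^]\<^bsub>ideals_set C\<^esub> n = {\<zero>\<^bsub>C\<^esub>}) \<and>
        f \<in> huber_hom A C \<and> g \<in> huber_hom B (top_quot C c) \<and>
        (\<forall>a \<in> carrier A. g (\<phi> a) = c +>\<^bsub>C\<^esub> f a) \<longrightarrow>
        (\<exists>!h. h \<in> huber_hom B C \<and> h \<in> extensional (carrier B) \<and>
           (\<forall>a \<in> carrier A. h (\<phi> a) = f a) \<and>
           (\<forall>b \<in> carrier B. c +>\<^bsub>C\<^esub> h b = g b)))"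

definition top_etale :: "'a topring \<Rightarrow> 'b topring \<Rightarrow> ('a \<Rightarrow> 'b) \<Rightarrow> bool" where
  "top_etale A B \<phi> \<longleftrightarrow> formally_etale A B \<phi> \<and> top_finitely_presented A B \<phi>"

text \<open>\<open>B = A \<otimes>\<^bsub>A\<^sub>0\<^esub> B\<^sub>0\<close> means that the canonical map is bijective.\<close>

definition good_etale_with_model ::
    "'a topring \<Rightarrow> 'b topring \<Rightarrow> ('a \<Rightarrow> 'b) \<Rightarrow> 'a set \<Rightarrow> 'b set \<Rightarrow> bool" where
  "good_etale_with_model A B \<phi> A0 B0 \<longleftrightarrow>
     huber_ring A \<and> huber_ring B \<and> \<phi> \<in> huber_hom A B \<and>
     ring_of_definition A A0 \<and> ring_of_definition B B0 \<and> \<phi> ` A0 \<subseteq> B0 \<and>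
     top_etale (subtop A A0) (subtop B B0) \<phi> \<and>
     (let MA = alg (\<lambda>a. a) A; MB = alg \<phi> (subtop B B0)
      in bij_betw (tensor_lift (subtop A A0) MA MB B (\<lambda>a b. \<phi> a \<otimes>\<^bsub>B\<^esub> b))
           (carrier (tensor (subtop A A0) MA MB)) (carrier B))"

definition good_etale_coords ::
    "'r topring \<Rightarrow> 'a topring \<Rightarrow> ('r \<Rightarrow> 'a) \<Rightarrow> nat \<Rightarrow> (nat \<Rightarrow> 'a) \<Rightarrow> 'r set \<Rightarrow> 'a set \<Rightarrow> bool" where
  "good_etale_coords R A \<rho> d x R0 A0 \<longleftrightarrow>
     ring_of_definition R R0 \<and> (\<forall>i<d. x i \<in> carrier A) \<and>
     good_etale_with_model (huber_mpoly R d) A (mpoly_eval R A \<rho> x)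
       (carrier (mpoly (subtop R R0) d)) A0"


section \<open>Twisted algebras and twisted coordinates\<close>

definition twisted_adic_algebra ::
    "'r topring \<Rightarrow> 'a topring \<Rightarrow> ('r \<Rightarrow> 'a) \<Rightarrow> nat \<Rightarrow> (nat \<Rightarrow> 'a \<Rightarrow> 'a) \<Rightarrow> bool" where
  "twisted_adic_algebra R A \<rho> d \<sigma> \<longleftrightarrow> adic_algebra R A \<rho> \<and>
     (\<forall>i<d. \<sigma> i \<in> huber_hom A A \<and> (\<forall>r \<in> carrier R. \<sigma> i (\<rho> r) = \<rho> r)) \<and>
     (\<forall>i<d. \<forall>j<d. \<forall>a \<in> carrier A. \<sigma> i (\<sigma> j a) = \<sigma> j (\<sigma> i a))"

definition twisted_power ::
    "'a topring \<Rightarrow> nat \<Rightarrow> (nat \<Rightarrow> 'a \<Rightarrow> 'a) \<Rightarrow> (nat \<Rightarrow> 'a) \<Rightarrow> (nat \<Rightarrow> nat) \<Rightarrow>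
      nat multiset \<Rightarrow> 'a" where
  "twisted_power A d \<sigma> x k = (\<Otimes>\<^bsub>mpoly A d\<^esub>i \<in> {..<d}. \<Otimes>\<^bsub>mpoly A d\<^esub>j \<in> {..<k i}.
     ring.indexed_var A i \<oplus>\<^bsub>mpoly A d\<^esub> ring.indexed_const A (x i)
       \<ominus>\<^bsub>mpoly A d\<^esub> ring.indexed_const A ((\<sigma> i ^^ j) (x i)))"

definition Pideal ::
    "'a topring \<Rightarrow> nat \<Rightarrow> (nat \<Rightarrow> 'a \<Rightarrow> 'a) \<Rightarrow> (nat \<Rightarrow> 'a) \<Rightarrow> nat \<Rightarrow> (nat multiset \<Rightarrow> 'a) set" where
  "Pideal A d \<sigma> x n = Idl\<^bsub>mpoly A d\<^esub> {twisted_power A d \<sigma> x k | k. (\<Sum>i<d. k i) = n + 1}"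

definition Psig ::
    "'a topring \<Rightarrow> nat \<Rightarrow> (nat \<Rightarrow> 'a \<Rightarrow> 'a) \<Rightarrow> (nat \<Rightarrow> 'a) \<Rightarrow> nat \<Rightarrow>
      (nat multiset \<Rightarrow> 'a) set topring" where
  "Psig A d \<sigma> x n = top_quot (huber_mpoly A d) (Pideal A d \<sigma> x n)"

definition Pconst ::
    "'a topring \<Rightarrow> nat \<Rightarrow> (nat \<Rightarrow> 'a \<Rightarrow> 'a) \<Rightarrow> (nat \<Rightarrow> 'a) \<Rightarrow> nat \<Rightarrow> 'a \<Rightarrow>
      (nat multiset \<Rightarrow> 'a) set" where
  "Pconst A d \<sigma> x n a = Pideal A d \<sigma> x n +>\<^bsub>mpoly A d\<^esub> ring.indexed_const A a"

definition Pxi ::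
    "'a topring \<Rightarrow> nat \<Rightarrow> (nat \<Rightarrow> 'a \<Rightarrow> 'a) \<Rightarrow> (nat \<Rightarrow> 'a) \<Rightarrow> nat \<Rightarrow> nat \<Rightarrow>
      (nat multiset \<Rightarrow> 'a) set" where
  "Pxi A d \<sigma> x n i = Pideal A d \<sigma> x n +>\<^bsub>mpoly A d\<^esub> ring.indexed_var A i"

definition Pproj :: "'a topring \<Rightarrow> (nat multiset \<Rightarrow> 'a) set \<Rightarrow> 'a" where
  "Pproj A = induced (mpoly_eval A A (\<lambda>a. a) (\<lambda>_. \<zero>\<^bsub>A\<^esub>))"

definition is_Theta ::
    "'r topring \<Rightarrow> 'a topring \<Rightarrow> ('r \<Rightarrow> 'a) \<Rightarrow> nat \<Rightarrow> (nat \<Rightarrow> 'a \<Rightarrow> 'a) \<Rightarrow> (nat \<Rightarrow> 'a) \<Rightarrow> nat \<Rightarrow>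
      ('a \<Rightarrow> (nat multiset \<Rightarrow> 'a) set) \<Rightarrow> bool" where
  "is_Theta R A \<rho> d \<sigma> x n T \<longleftrightarrow>
     adic_hom A (Psig A d \<sigma> x n) T \<and> T \<in> extensional (carrier A) \<and>
     (\<forall>r \<in> carrier R. T (\<rho> r) = Pconst A d \<sigma> x n (\<rho> r)) \<and>
     (\<forall>i<d. T (x i) = Pconst A d \<sigma> x n (x i) \<oplus>\<^bsub>Psig A d \<sigma> x n\<^esub> Pxi A d \<sigma> x n i) \<and>
     (\<forall>a \<in> carrier A. Pproj A (T a) = a)"

definition sigma_coords ::
    "'r topring \<Rightarrow> 'a topring \<Rightarrow> ('r \<Rightarrow> 'a) \<Rightarrow> nat \<Rightarrow> (nat \<Rightarrow> 'a \<Rightarrow> 'a) \<Rightarrow> (nat \<Rightarrow> 'a) \<Rightarrow> bool" where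
  "sigma_coords R A \<rho> d \<sigma> x \<longleftrightarrow>
     twisted_adic_algebra R A \<rho> d \<sigma> \<and> (\<forall>i<d. x i \<in> carrier A) \<and>
     (\<forall>n. \<exists>!T. is_Theta R A \<rho> d \<sigma> x n T)"

definition Theta ::
    "'r topring \<Rightarrow> 'a topring \<Rightarrow> ('r \<Rightarrow> 'a) \<Rightarrow> nat \<Rightarrow> (nat \<Rightarrow> 'a \<Rightarrow> 'a) \<Rightarrow> (nat \<Rightarrow> 'a) \<Rightarrow> nat \<Rightarrow>
      'a \<Rightarrow> (nat multiset \<Rightarrow> 'a) set" where
  "Theta R A \<rho> d \<sigma> x n = (THE T. is_Theta R A \<rho> d \<sigma> x n T)"

definition good_sigma_coords ::
    "'r topring \<Rightarrow> 'a topring \<Rightarrow> ('r \<Rightarrow> 'a) \<Rightarrow> nat \<Rightarrow> (nat \<Rightarrow> 'a \<Rightarrow> 'a) \<Rightarrow> (nat \<Rightarrow> 'a) \<Rightarrow>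
      'r set \<Rightarrow> 'a set \<Rightarrow> bool" where
  "good_sigma_coords R A \<rho> d \<sigma> x R0 A0 \<longleftrightarrow>
     twisted_adic_algebra R A \<rho> d \<sigma> \<and>
     good_etale_coords R A \<rho> d x R0 A0 \<and> (\<forall>i<d. \<sigma> i ` A0 \<subseteq> A0) \<and>
     sigma_coords (subtop R R0) (subtop A A0) \<rho> d \<sigma> x"

text \<open>\<open>Id\<^sub>R \<otimes> \<theta>\<^bsub>A\<^sub>0\<^esub>\<close>, transported along the canonical maps
  \<open>R \<otimes>\<^bsub>R\<^sub>0\<^esub> A\<^sub>0 \<rightarrow> A\<close> and \<open>R \<otimes>\<^bsub>R\<^sub>0\<^esub> P\<^bsub>A\<^sub>0\<^esub> \<rightarrow> P\<^bsub>A\<^esub>\<close>.\<close>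

definition good_Theta ::
    "'r topring \<Rightarrow> 'a topring \<Rightarrow> ('r \<Rightarrow> 'a) \<Rightarrow> nat \<Rightarrow> (nat \<Rightarrow> 'a \<Rightarrow> 'a) \<Rightarrow> (nat \<Rightarrow> 'a) \<Rightarrow>
      'r set \<Rightarrow> 'a set \<Rightarrow> nat \<Rightarrow> 'a \<Rightarrow> (nat multiset \<Rightarrow> 'a) set" where
  "good_Theta R A \<rho> d \<sigma> x R0 A0 n a =
     (let R' = subtop R R0; A' = subtop A A0;
          MR = alg (\<lambda>r. r) R; MA = alg \<rho> A';
          MP = alg (\<lambda>r. Pconst A' d \<sigma> x n (\<rho> r)) (Psig A' d \<sigma> x n);
          canA = tensor_lift R' MR MA A (\<lambda>r b. \<rho> r \<otimes>\<^bsub>A\<^esub> b);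
          canP = tensor_lift R' MR MP (Psig A d \<sigma> x n)
            (\<lambda>r V. Pconst A d \<sigma> x n (\<rho> r) \<otimes>\<^bsub>Psig A d \<sigma> x n\<^esub>
               induced (\<lambda>p. Pideal A d \<sigma> x n +>\<^bsub>mpoly A d\<^esub> p) V)
      in canP (tensor_map R' MR MA MR MP (\<lambda>r. r) (Theta R' A' \<rho> d \<sigma> x n)
           (inv_into (carrier (tensor R' MR MA)) canA a)))"


section \<open>Twisted derivations and twisted differential forms\<close>

text \<open>From here on \<open>\<theta> n\<close> stands for \<open>\<theta>\<^bsub>A,(n)\<^esub>\<close> (either \<^const>\<open>Theta\<close> or \<^const>\<open>good_Theta\<close>).\<close>

definition twisted_deriv ::
    "'a topring \<Rightarrow> nat \<Rightarrow> (nat \<Rightarrow> 'a \<Rightarrow> 'a) \<Rightarrow> (nat \<Rightarrow> 'a) \<Rightarrow>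
      (nat \<Rightarrow> 'a \<Rightarrow> (nat multiset \<Rightarrow> 'a) set) \<Rightarrow> nat \<Rightarrow> 'a \<Rightarrow> 'a" where
  "twisted_deriv A d \<sigma> x \<theta> i f = (THE c. c \<in> {..<d} \<rightarrow>\<^sub>E carrier A \<and>
     \<theta> 1 f = Pconst A d \<sigma> x 1 f \<oplus>\<^bsub>Psig A d \<sigma> x 1\<^esub>
       (\<Oplus>\<^bsub>Psig A d \<sigma> x 1\<^esub>j \<in> {..<d}. Pconst A d \<sigma> x 1 (c j) \<otimes>\<^bsub>Psig A d \<sigma> x 1\<^esub> Pxi A d \<sigma> x 1 j)) i"

definition classical_coords ::
    "'a topring \<Rightarrow> nat \<Rightarrow> (nat \<Rightarrow> 'a \<Rightarrow> 'a) \<Rightarrow> (nat \<Rightarrow> 'a) \<Rightarrow>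
      (nat \<Rightarrow> 'a \<Rightarrow> (nat multiset \<Rightarrow> 'a) set) \<Rightarrow> bool" where
  "classical_coords A d \<sigma> x \<theta> \<longleftrightarrow> (\<forall>f \<in> carrier A. \<forall>i<d.
     \<sigma> i f = f \<oplus>\<^bsub>A\<^esub> (\<sigma> i (x i) \<ominus>\<^bsub>A\<^esub> x i) \<otimes>\<^bsub>A\<^esub> twisted_deriv A d \<sigma> x \<theta> i f)"

definition AA ::
    "'r topring \<Rightarrow> 'a topring \<Rightarrow> ('r \<Rightarrow> 'a) \<Rightarrow> ('r, ('a \<times> 'a \<Rightarrow>\<^sub>0 int) set) module" where
  "AA R A \<rho> = tensor R (alg \<rho> A) (alg \<rho> A)"

definition AA_to_P ::
    "'r topring \<Rightarrow> 'a topring \<Rightarrow> ('r \<Rightarrow> 'a) \<Rightarrow> nat \<Rightarrow> (nat \<Rightarrow> 'a \<Rightarrow> 'a) \<Rightarrow> (nat \<Rightarrow> 'a) \<Rightarrow>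
      (nat \<Rightarrow> 'a \<Rightarrow> (nat multiset \<Rightarrow> 'a) set) \<Rightarrow> nat \<Rightarrow>
      ('a \<times> 'a \<Rightarrow>\<^sub>0 int) set \<Rightarrow> (nat multiset \<Rightarrow> 'a) set" where
  "AA_to_P R A \<rho> d \<sigma> x \<theta> n = tensor_lift R (alg \<rho> A) (alg \<rho> A) (Psig A d \<sigma> x n)
     (\<lambda>a b. Pconst A d \<sigma> x n a \<otimes>\<^bsub>Psig A d \<sigma> x n\<^esub> \<theta> n b)"

text \<open>\<open>tw_ideal \<dots> n\<close> is the ideal \<open>I\<^sub>A\<close> with exponent \<open>(n + 1)\<close>.\<close>

definition tw_ideal ::
    "'r topring \<Rightarrow> 'a topring \<Rightarrow> ('r \<Rightarrow> 'a) \<Rightarrow> nat \<Rightarrow> (nat \<Rightarrow> 'a \<Rightarrow> 'a) \<Rightarrow> (nat \<Rightarrow> 'a) \<Rightarrow>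
      (nat \<Rightarrow> 'a \<Rightarrow> (nat multiset \<Rightarrow> 'a) set) \<Rightarrow> nat \<Rightarrow> ('a \<times> 'a \<Rightarrow>\<^sub>0 int) set set" where
  "tw_ideal R A \<rho> d \<sigma> x \<theta> n =
     a_kernel (AA R A \<rho>) (Psig A d \<sigma> x n) (AA_to_P R A \<rho> d \<sigma> x \<theta> n)"

text \<open>The \<open>A\<close>-module structure comes from \<open>a \<mapsto> a \<otimes> 1\<close>.\<close>

definition Omega ::
    "'r topring \<Rightarrow> 'a topring \<Rightarrow> ('r \<Rightarrow> 'a) \<Rightarrow> nat \<Rightarrow> (nat \<Rightarrow> 'a \<Rightarrow> 'a) \<Rightarrow> (nat \<Rightarrow> 'a) \<Rightarrow>
      (nat \<Rightarrow> 'a \<Rightarrow> (nat multiset \<Rightarrow> 'a) set) \<Rightarrow>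
      ('a, ('a \<times> 'a \<Rightarrow>\<^sub>0 int) set set) module" where
  "Omega R A \<rho> d \<sigma> x \<theta> =
     (let T = AA R A \<rho>; I1 = tw_ideal R A \<rho> d \<sigma> x \<theta> 0; I2 = tw_ideal R A \<rho> d \<sigma> x \<theta> 1
      in (alg (\<lambda>a. I2 +>\<^bsub>T\<^esub> tens R (alg \<rho> A) (alg \<rho> A) a \<one>\<^bsub>A\<^esub>) (T Quot I2))
           \<lparr>carrier := (\<lambda>t. I2 +>\<^bsub>T\<^esub> t) ` I1\<rparr>)"

definition Omega_to_P ::
    "'r topring \<Rightarrow> 'a topring \<Rightarrow> ('r \<Rightarrow> 'a) \<Rightarrow> nat \<Rightarrow> (nat \<Rightarrow> 'a \<Rightarrow> 'a) \<Rightarrow> (nat \<Rightarrow> 'a) \<Rightarrow>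
      (nat \<Rightarrow> 'a \<Rightarrow> (nat multiset \<Rightarrow> 'a) set) \<Rightarrow>
      ('a \<times> 'a \<Rightarrow>\<^sub>0 int) set set \<Rightarrow> (nat multiset \<Rightarrow> 'a) set" where
  "Omega_to_P R A \<rho> d \<sigma> x \<theta> = induced (AA_to_P R A \<rho> d \<sigma> x \<theta> 1)"


section \<open>Twisted connections\<close>

type_synonym 'a omega = "('a \<times> 'a \<Rightarrow>\<^sub>0 int) set set"
type_synonym ('a, 'm) m_omega = "('m \<times> 'a omega \<Rightarrow>\<^sub>0 int) set"

definition Pmod ::
    "'a topring \<Rightarrow> nat \<Rightarrow> (nat \<Rightarrow> 'a \<Rightarrow> 'a) \<Rightarrow> (nat \<Rightarrow> 'a) \<Rightarrow> nat \<Rightarrow>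
      ('a, (nat multiset \<Rightarrow> 'a) set) module" where
  "Pmod A d \<sigma> x n = alg (Pconst A d \<sigma> x n) (Psig A d \<sigma> x n)"

definition Theta_M ::
    "'r topring \<Rightarrow> 'a topring \<Rightarrow> ('r \<Rightarrow> 'a) \<Rightarrow> nat \<Rightarrow> (nat \<Rightarrow> 'a \<Rightarrow> 'a) \<Rightarrow> (nat \<Rightarrow> 'a) \<Rightarrow>
      (nat \<Rightarrow> 'a \<Rightarrow> (nat multiset \<Rightarrow> 'a) set) \<Rightarrow> ('a, 'm) module \<Rightarrow> ('m \<Rightarrow> ('a, 'm) m_omega) \<Rightarrow>
      'm \<Rightarrow> ('m \<times> (nat multiset \<Rightarrow> 'a) set \<Rightarrow>\<^sub>0 int) set" where
  "Theta_M R A \<rho> d \<sigma> x \<theta> M \<nu> s =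
     (let Q = Pmod A d \<sigma> x 1 in
        tens A M Q s \<one>\<^bsub>Q\<^esub> \<oplus>\<^bsub>tensor A M Q\<^esub>
          tensor_map A M (Omega R A \<rho> d \<sigma> x \<theta>) M Q (\<lambda>m. m) (Omega_to_P R A \<rho> d \<sigma> x \<theta>) (\<nu> s))"

text \<open>The action of \<open>p \<in> P\<close> on \<open>M \<otimes>\<^sub>A P\<close>.\<close>

definition P_act ::
    "'a topring \<Rightarrow> nat \<Rightarrow> (nat \<Rightarrow> 'a \<Rightarrow> 'a) \<Rightarrow> (nat \<Rightarrow> 'a) \<Rightarrow> nat \<Rightarrow> ('a, 'm) module \<Rightarrow>
      (nat multiset \<Rightarrow> 'a) set \<Rightarrow> ('m \<times> (nat multiset \<Rightarrow> 'a) set \<Rightarrow>\<^sub>0 int) set \<Rightarrow>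
      ('m \<times> (nat multiset \<Rightarrow> 'a) set \<Rightarrow>\<^sub>0 int) set" where
  "P_act A d \<sigma> x n M p =
     (let Q = Pmod A d \<sigma> x n in tensor_map A M Q M Q (\<lambda>m. m) (\<lambda>q. p \<otimes>\<^bsub>Q\<^esub> q))"

definition twisted_connection ::
    "'r topring \<Rightarrow> 'a topring \<Rightarrow> ('r \<Rightarrow> 'a) \<Rightarrow> nat \<Rightarrow> (nat \<Rightarrow> 'a \<Rightarrow> 'a) \<Rightarrow> (nat \<Rightarrow> 'a) \<Rightarrow>
      (nat \<Rightarrow> 'a \<Rightarrow> (nat multiset \<Rightarrow> 'a) set) \<Rightarrow> ('a, 'm) module \<Rightarrow>
      ('m \<Rightarrow> ('a, 'm) m_omega) \<Rightarrow> bool" where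
  "twisted_connection R A \<rho> d \<sigma> x \<theta> M \<nu> \<longleftrightarrow>
     \<nu> \<in> carrier M \<rightarrow>\<^sub>E carrier (tensor A M (Omega R A \<rho> d \<sigma> x \<theta>)) \<and>
     (\<forall>s \<in> carrier M. \<forall>t \<in> carrier M.
        Theta_M R A \<rho> d \<sigma> x \<theta> M \<nu> (s \<oplus>\<^bsub>M\<^esub> t) =
          Theta_M R A \<rho> d \<sigma> x \<theta> M \<nu> s \<oplus>\<^bsub>tensor A M (Pmod A d \<sigma> x 1)\<^esub>
          Theta_M R A \<rho> d \<sigma> x \<theta> M \<nu> t) \<and>
     (\<forall>f \<in> carrier A. \<forall>s \<in> carrier M.
        Theta_M R A \<rho> d \<sigma> x \<theta> M \<nu> (f \<odot>\<^bsub>M\<^esub> s) =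
          P_act A d \<sigma> x 1 M (\<theta> 1 f) (Theta_M R A \<rho> d \<sigma> x \<theta> M \<nu> s))"


section \<open>Categories\<close>

record ('o, 'f) category =
  Obj :: "'o set"
  Hom :: "'o \<Rightarrow> 'o \<Rightarrow> 'f set"
  Ident :: "'o \<Rightarrow> 'f"
  Cmp :: "'o \<Rightarrow> 'o \<Rightarrow> 'o \<Rightarrow> 'f \<Rightarrow> 'f \<Rightarrow> 'f"  \<comment> \<open>\<open>Cmp C U V W g f\<close> is \<open>g \<circ> f : U \<rightarrow> V \<rightarrow> W\<close>\<close>

definition is_category :: "('o, 'f) category \<Rightarrow> bool" where
  "is_category C \<longleftrightarrow>
     (\<forall>U \<in> Obj C. Ident C U \<in> Hom C U U) \<and>
     (\<forall>U \<in> Obj C. \<forall>V \<in> Obj C. \<forall>W \<in> Obj C. \<forall>f \<in> Hom C U V. \<forall>g \<in> Hom C V W.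
        Cmp C U V W g f \<in> Hom C U W) \<and>
     (\<forall>U \<in> Obj C. \<forall>V \<in> Obj C. \<forall>f \<in> Hom C U V.
        Cmp C U U V f (Ident C U) = f \<and> Cmp C U V V (Ident C V) f = f) \<and>
     (\<forall>S \<in> Obj C. \<forall>U \<in> Obj C. \<forall>V \<in> Obj C. \<forall>W \<in> Obj C.
        \<forall>f \<in> Hom C S U. \<forall>g \<in> Hom C U V. \<forall>h \<in> Hom C V W.
        Cmp C S U W (Cmp C U V W h g) f = Cmp C S V W h (Cmp C S U V g f))"

definition is_functor ::
    "('o, 'f) category \<Rightarrow> ('p, 'g) category \<Rightarrow> ('o \<Rightarrow> 'p) \<Rightarrow> ('o \<Rightarrow> 'o \<Rightarrow> 'f \<Rightarrow> 'g) \<Rightarrow> bool" where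
  "is_functor C D F F' \<longleftrightarrow>
     (\<forall>U \<in> Obj C. F U \<in> Obj D \<and> F' U U (Ident C U) = Ident D (F U)) \<and>
     (\<forall>U \<in> Obj C. \<forall>V \<in> Obj C. \<forall>f \<in> Hom C U V. F' U V f \<in> Hom D (F U) (F V)) \<and>
     (\<forall>U \<in> Obj C. \<forall>V \<in> Obj C. \<forall>W \<in> Obj C. \<forall>f \<in> Hom C U V. \<forall>g \<in> Hom C V W.
        F' U W (Cmp C U V W g f) = Cmp D (F U) (F V) (F W) (F' V W g) (F' U V f))"

definition is_iso :: "('o, 'f) category \<Rightarrow> 'o \<Rightarrow> 'o \<Rightarrow> 'f \<Rightarrow> bool" where
  "is_iso C U V f \<longleftrightarrow> f \<in> Hom C U V \<and>
     (\<exists>g \<in> Hom C V U. Cmp C U V U g f = Ident C U \<and> Cmp C V U V f g = Ident C V)"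

definition is_nat_iso ::
    "('o, 'f) category \<Rightarrow> ('p, 'g) category \<Rightarrow> ('o \<Rightarrow> 'p) \<Rightarrow> ('o \<Rightarrow> 'o \<Rightarrow> 'f \<Rightarrow> 'g) \<Rightarrow>
      ('o \<Rightarrow> 'p) \<Rightarrow> ('o \<Rightarrow> 'o \<Rightarrow> 'f \<Rightarrow> 'g) \<Rightarrow> ('o \<Rightarrow> 'g) \<Rightarrow> bool" where
  "is_nat_iso C D F F' G G' \<eta> \<longleftrightarrow>
     (\<forall>U \<in> Obj C. is_iso D (F U) (G U) (\<eta> U)) \<and>
     (\<forall>U \<in> Obj C. \<forall>V \<in> Obj C. \<forall>f \<in> Hom C U V.
        Cmp D (F U) (F V) (G V) (\<eta> V) (F' U V f) = Cmp D (F U) (G U) (G V) (G' U V f) (\<eta> U))"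

definition equivalent_categories :: "('o, 'f) category \<Rightarrow> ('p, 'g) category \<Rightarrow> bool" where
  "equivalent_categories C D \<longleftrightarrow> is_category C \<and> is_category D \<and>
     (\<exists>F F' G G' \<eta> \<epsilon>. is_functor C D F F' \<and> is_functor D C G G' \<and>
        is_nat_iso C C (\<lambda>U. U) (\<lambda>U V f. f)
          (\<lambda>U. G (F U)) (\<lambda>U V f. G' (F U) (F V) (F' U V f)) \<eta> \<and>
        is_nat_iso D D (\<lambda>U. F (G U)) (\<lambda>U V f. F' (G U) (G V) (G' U V f))
          (\<lambda>U. U) (\<lambda>U V f. f) \<epsilon>)"

definition linear_maps ::
    "('a, 'e) ring_scheme \<Rightarrow> ('a, 'm) module \<Rightarrow> ('a, 'n) module \<Rightarrow> ('m \<Rightarrow> 'n) set" where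
  "linear_maps A M N = {u \<in> carrier M \<rightarrow>\<^sub>E carrier N.
     (\<forall>s \<in> carrier M. \<forall>t \<in> carrier M. u (s \<oplus>\<^bsub>M\<^esub> t) = u s \<oplus>\<^bsub>N\<^esub> u t) \<and>
     (\<forall>a \<in> carrier A. \<forall>s \<in> carrier M. u (a \<odot>\<^bsub>M\<^esub> s) = a \<odot>\<^bsub>N\<^esub> u s)}"

text \<open>In both categories the modules are those with elements in an arbitrary type \<open>'m\<close>.\<close>

definition nabla_Mod ::
    "'r topring \<Rightarrow> 'a topring \<Rightarrow> ('r \<Rightarrow> 'a) \<Rightarrow> nat \<Rightarrow> (nat \<Rightarrow> 'a \<Rightarrow> 'a) \<Rightarrow> (nat \<Rightarrow> 'a) \<Rightarrow>
      (nat \<Rightarrow> 'a \<Rightarrow> (nat multiset \<Rightarrow> 'a) set) \<Rightarrow>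
      (('a, 'm) module \<times> ('m \<Rightarrow> ('a, 'm) m_omega), 'm \<Rightarrow> 'm) category" where
  "nabla_Mod R A \<rho> d \<sigma> x \<theta> =
     \<lparr>Obj = {(M, \<nu>). Module.module A M \<and> twisted_connection R A \<rho> d \<sigma> x \<theta> M \<nu>},
      Hom = (\<lambda>(M, \<nu>) (N, \<nu>'). {u \<in> linear_maps A M N. \<forall>s \<in> carrier M.
        \<nu>' (u s) = tensor_map A M (Omega R A \<rho> d \<sigma> x \<theta>) N (Omega R A \<rho> d \<sigma> x \<theta>)
                     u (\<lambda>\<omega>. \<omega>) (\<nu> s)}),
      Ident = (\<lambda>(M, \<nu>). restrict (\<lambda>s. s) (carrier M)),
      Cmp = (\<lambda>(M, _) _ _ v u. compose (carrier M) v u)\<rparr>"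

definition T_Mod ::
    "'r topring \<Rightarrow> 'a topring \<Rightarrow> ('r \<Rightarrow> 'a) \<Rightarrow> nat \<Rightarrow> (nat \<Rightarrow> 'a \<Rightarrow> 'a) \<Rightarrow> (nat \<Rightarrow> 'a) \<Rightarrow>
      (nat \<Rightarrow> 'a \<Rightarrow> (nat multiset \<Rightarrow> 'a) set) \<Rightarrow>
      (('a, 'm) module \<times> (nat \<Rightarrow> 'm \<Rightarrow> 'm), 'm \<Rightarrow> 'm) category" where
  "T_Mod R A \<rho> d \<sigma> x \<theta> =
     \<lparr>Obj = {(M, D). Module.module A M \<and> D \<in> {..<d} \<rightarrow>\<^sub>E (carrier M \<rightarrow>\<^sub>E carrier M) \<and>
        (\<forall>i<d.
          (\<forall>s \<in> carrier M. \<forall>t \<in> carrier M. D i (s \<oplus>\<^bsub>M\<^esub> t) = D i s \<oplus>\<^bsub>M\<^esub> D i t) \<and>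
          (\<forall>r \<in> carrier R. \<forall>s \<in> carrier M. D i (\<rho> r \<odot>\<^bsub>M\<^esub> s) = \<rho> r \<odot>\<^bsub>M\<^esub> D i s) \<and>
          (\<forall>a \<in> carrier A. \<forall>s \<in> carrier M. D i (a \<odot>\<^bsub>M\<^esub> s) =
             (twisted_deriv A d \<sigma> x \<theta> i a \<odot>\<^bsub>M\<^esub> s) \<oplus>\<^bsub>M\<^esub> (\<sigma> i a \<odot>\<^bsub>M\<^esub> D i s)))},
      Hom = (\<lambda>(M, D) (N, D'). {u \<in> linear_maps A M N.
        \<forall>i<d. \<forall>s \<in> carrier M. D' i (u s) = u (D i s)}),
      Ident = (\<lambda>(M, D). restrict (\<lambda>s. s) (carrier M)),
      Cmp = (\<lambda>(M, _) _ _ v u. compose (carrier M) v u)\<rparr>"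

end

theory Submission
  imports Defs
begin

text \<open>
  In \<open>P\<^bsub>A,(1)\<^esub>\<close> one has \<open>\<xi>\<^sub>i\<xi>\<^sub>j = 0\<close> for \<open>i \<noteq> j\<close> and \<open>\<xi>\<^sub>i\<^sup>2 = (\<sigma>\<^sub>i(x\<^sub>i) - x\<^sub>i)\<xi>\<^sub>i\<close>, and \<open>1, \<xi>\<^sub>1, \<dots>, \<xi>\<^sub>d\<close> is an
  \<open>A\<close>-basis. Hence a map \<open>\<nabla>\<close> amounts to operators \<open>D\<^sub>i\<close> on \<open>M\<close> with \<open>\<nabla>(s) = \<Sum>\<^sub>i D\<^sub>i(s) \<otimes> \<xi>\<^sub>i\<close>, and
  comparing coefficients of \<open>\<xi>\<^sub>i\<close> in \<open>\<Theta>\<^sub>M(fs) = \<Theta>(f)\<Theta>\<^sub>M(s)\<close> gives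
  \<open>D\<^sub>i(fs) = \<partial>\<^sub>i(f)s + (f + (\<sigma>\<^sub>i(x\<^sub>i) - x\<^sub>i)\<partial>\<^sub>i(f))D\<^sub>i(s)\<close>, which for classical coordinates is the twisted
  Leibniz rule; \<open>R\<close>-linearity of \<open>D\<^sub>i\<close> follows from \<open>\<partial>\<^sub>i = 0\<close> and \<open>\<sigma>\<^sub>i = id\<close> on \<open>R\<close>. This is even an
  isomorphism of categories. Only the algebraic properties of \<open>\<Theta>\<close> enter; for good coordinates they are
  obtained by writing \<open>A\<close> as \<open>R[X] \<otimes>\<^bsub>R\<^sub>0[X]\<^esub> A\<^sub>0\<close> and extending \<open>\<Theta>\<^bsub>A\<^sub>0\<^esub>\<close> by the map \<open>X\<^sub>i \<mapsto> x\<^sub>i + \<xi>\<^sub>i\<close>.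
\<close>

section \<open>Polynomial rings\<close>

text \<open>All objects come as quotients: P_(1) of a polynomial ring, Omega of one kernel in A (x)
  A by a smaller one, tensor products of free abelian groups. None of these presentations shows that
  1 and the xi_i are linearly independent over A, and without that neither the twisted derivations,
  which are defined by a description of coefficients, nor the operators D_i can be read off.
  Independence is obtained by mapping P_(1) to an explicit ring with the expected multiplication
  table and pulling the coefficient functions back from there. Omega is handled through its
  injection into P_(1), where it becomes the kernel of the augmentation. With coordinates on both
  modules, every equation in M (x) Omega or M (x) P_(1) is a family of equations in M. For good
  coordinates the obstacle is a different one: the bijectivity that is given concerns a tensor
  product over R_0[X], whereas \<open>good_Theta\<close> inverts a map from a tensor product over
  R_0.\<close>

lemma finite_submultisets: "finite {l. l \<subseteq># m}"
proof (induction m)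
  case (add x m)
  \<comment> \<open>A submultiset either avoids the new element altogether or loses one copy of it
    and becomes a submultiset of \<open>m\<close>.\<close>
  have "{l. l \<subseteq># add_mset x m} \<subseteq> {l. l \<subseteq># m} \<union> add_mset x ` {l. l \<subseteq># m}"
  proof
    fix l assume "l \<in> {l. l \<subseteq># add_mset x m}"
    then have l: "l \<subseteq># add_mset x m" by simp
    show "l \<in> {l. l \<subseteq># m} \<union> add_mset x ` {l. l \<subseteq># m}"
    proof (cases "x \<in># l")
      case True
      then obtain l' where "l = add_mset x l'" by (metis insert_DiffM)
      with l show ?thesis by auto
    next
      case False
      with l have "l \<subseteq># m"
        by (metis add_mset_remove_trivial diff_single_trivial subset_eq_diff_conv add_mset_add_single)
      then show ?thesis by simp
    qed
  qed
  with add show ?case by (simp add: finite_subset)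
qed simp

text \<open>The monomial with coefficient \<open>c\<close> and exponent \<open>m\<close>. The unit,
  the constants and the variables are all of this form, so that identities additive in each argument
  reduce to products of two monomials.\<close>

definition mpoly_monom :: "('a, 'e) ring_scheme \<Rightarrow> 'a \<Rightarrow> nat multiset \<Rightarrow> nat multiset \<Rightarrow> 'a" where
  "mpoly_monom A c m = (\<lambda>l. if l = m then c else \<zero>\<^bsub>A\<^esub>)"

context cring
begin

lemma indexed_const_mono: "indexed_const c = mpoly_monom R c {#}"
  by (auto simp: indexed_const_def mpoly_monom_def)

lemma indexed_var_mono: "indexed_var i = mpoly_monom R \<one> {#i#}"
proof
  fix m show "indexed_var i m = mpoly_monom R \<one> {#i#} m"
    unfolding indexed_var_def indexed_pmult_def indexed_const_def mpoly_monom_def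
    by (auto dest!: multi_member_split)
qed

lemma carrier_mpoly: "p \<in> carrier (mpoly R d) \<longleftrightarrow> (\<forall>m. p m \<in> carrier R) \<and>
    finite {m. p m \<noteq> \<zero>} \<and> (\<forall>m. p m \<noteq> \<zero> \<longrightarrow> set_mset m \<subseteq> {..<d})"
  by (simp add: mpoly_def)

lemma mpoly_coeff_closed: "p \<in> carrier (mpoly R d) \<Longrightarrow> p m \<in> carrier R"
  by (simp add: carrier_mpoly)

lemma mpoly_add: "p \<oplus>\<^bsub>mpoly R d\<^esub> q = (\<lambda>m. p m \<oplus> q m)"
  by (simp add: mpoly_def indexed_padd_def)

lemma mpoly_zero: "\<zero>\<^bsub>mpoly R d\<^esub> = (\<lambda>_. \<zero>)"
  by (simp add: mpoly_def indexed_zero_def)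

lemma mpoly_one: "\<one>\<^bsub>mpoly R d\<^esub> = mpoly_monom R \<one> {#}"
  by (simp add: mpoly_def indexed_const_mono)

lemma mpoly_mult: "p \<otimes>\<^bsub>mpoly R d\<^esub> q = (\<lambda>m. \<Oplus>l\<in>{l. l \<subseteq># m}. p l \<otimes> q (m - l))"
  by (simp add: mpoly_def)

lemma mpoly_monom_closed:
  assumes "c \<in> carrier R" "set_mset m \<subseteq> {..<d}"
  shows "mpoly_monom R c m \<in> carrier (mpoly R d)"
proof -
  have "{l. mpoly_monom R c m l \<noteq> \<zero>} \<subseteq> {m}" by (auto simp: mpoly_monom_def)
  then have "finite {l. mpoly_monom R c m l \<noteq> \<zero>}" by (rule finite_subset) simp
  with assms show ?thesis by (auto simp: carrier_mpoly mpoly_monom_def split: if_splits)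
qed

lemma mpoly_zero_closed: "(\<lambda>_. \<zero>) \<in> carrier (mpoly R d)"
  by (simp add: carrier_mpoly)

lemma mpoly_add_closed:
  assumes "p \<in> carrier (mpoly R d)" "q \<in> carrier (mpoly R d)"
  shows "p \<oplus>\<^bsub>mpoly R d\<^esub> q \<in> carrier (mpoly R d)"
proof -
  have "{m. p m \<oplus> q m \<noteq> \<zero>} \<subseteq> {m. p m \<noteq> \<zero>} \<union> {m. q m \<noteq> \<zero>}"
    by auto
  then have "finite {m. p m \<oplus> q m \<noteq> \<zero>}"
    using assms by (auto simp: carrier_mpoly intro: finite_subset)
  moreover have "set_mset m \<subseteq> {..<d}" if "p m \<oplus> q m \<noteq> \<zero>" for m
    using that assms unfolding carrier_mpoly by (cases "p m = \<zero>"; cases "q m = \<zero>") auto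
  ultimately show ?thesis
    using assms by (auto simp: carrier_mpoly mpoly_add)
qed

text \<open>The support of a product lies in the sum of the two supports. This yields both halves of
  closure under multiplication: finiteness of the support and the bound on the variables.\<close>

lemma mpoly_mult_nonzeroE:
  assumes "p \<in> carrier (mpoly R d)" "q \<in> carrier (mpoly R d)"
    and "(p \<otimes>\<^bsub>mpoly R d\<^esub> q) m \<noteq> \<zero>"
  obtains l k where "p l \<noteq> \<zero>" "q k \<noteq> \<zero>" "m = l + k"
proof -
  note cl = mpoly_coeff_closed[OF assms(1)] mpoly_coeff_closed[OF assms(2)]
  have "\<exists>l. l \<subseteq># m \<and> p l \<otimes> q (m - l) \<noteq> \<zero>"
    using assms(3) unfolding mpoly_mult by (metis (mono_tags, lifting) add.finprod_one_eqI mem_Collect_eq)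
  then obtain l where l: "l \<subseteq># m" "p l \<otimes> q (m - l) \<noteq> \<zero>" by blast
  moreover have "p l \<noteq> \<zero>" "q (m - l) \<noteq> \<zero>"
    using l(2) cl by auto
  ultimately show ?thesis
    using that[of l "m - l"] by simp
qed

lemma mpoly_mult_closed:
  assumes p: "p \<in> carrier (mpoly R d)" and q: "q \<in> carrier (mpoly R d)"
  shows "p \<otimes>\<^bsub>mpoly R d\<^esub> q \<in> carrier (mpoly R d)"
proof -
  note [simp] = mpoly_coeff_closed[OF p] mpoly_coeff_closed[OF q]
  let ?r = "p \<otimes>\<^bsub>mpoly R d\<^esub> q"
  have "{m. ?r m \<noteq> \<zero>} \<subseteq> (\<lambda>(l, k). l + k) ` ({m. p m \<noteq> \<zero>} \<times> {m. q m \<noteq> \<zero>})"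
    by (rule subsetI, unfold mem_Collect_eq, erule mpoly_mult_nonzeroE[OF p q]) (auto intro!: image_eqI)
  then have "finite {m. ?r m \<noteq> \<zero>}"
    by (rule finite_subset) (use p q in \<open>simp add: carrier_mpoly\<close>)
  moreover have "set_mset m \<subseteq> {..<d}" if "?r m \<noteq> \<zero>" for m
    using that p q by (elim mpoly_mult_nonzeroE[OF p q]) (auto simp: carrier_mpoly)
  moreover have "?r m \<in> carrier R" for m
    unfolding mpoly_mult using p q by (intro finsum_closed) auto
  ultimately show ?thesis by (simp add: carrier_mpoly)
qed

text \<open>The reflection taking \<open>l\<close> to \<open>m - l\<close> is an involution on the
  submultisets of \<open>m\<close> and exchanges the two factors of each summand.\<close>

lemma mpoly_mult_comm:
  assumes p: "p \<in> carrier (mpoly R d)" and q: "q \<in> carrier (mpoly R d)"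
  shows "p \<otimes>\<^bsub>mpoly R d\<^esub> q = q \<otimes>\<^bsub>mpoly R d\<^esub> p"
proof
  note [simp] = mpoly_coeff_closed[OF p] mpoly_coeff_closed[OF q]
  fix m :: "nat multiset"
  have inj: "inj_on (\<lambda>l. m - l) {l. l \<subseteq># m}"
    by (rule inj_on_inverseI[where g="\<lambda>l. m - l"]) (auto simp: multiset_eq_iff subseteq_mset_def)
  have im: "(\<lambda>l. m - l) ` {l. l \<subseteq># m} = {l. l \<subseteq># m}"
    
  proof
    show "{l. l \<subseteq># m} \<subseteq> (\<lambda>l. m - l) ` {l. l \<subseteq># m}"
    proof
      fix l assume "l \<in> {l. l \<subseteq># m}"
      then show "l \<in> (\<lambda>l. m - l) ` {l. l \<subseteq># m}"
        by (intro image_eqI[of _ _ "m - l"]) (auto simp: multiset_eq_iff subseteq_mset_def)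
    qed
  qed auto
  have "(\<Oplus>l\<in>{l. l \<subseteq># m}. p l \<otimes> q (m - l)) =
        (\<Oplus>l\<in>(\<lambda>l. m - l) ` {l. l \<subseteq># m}. p l \<otimes> q (m - l))"
    by (simp only: im)
  also have "\<dots> = (\<Oplus>l\<in>{l. l \<subseteq># m}. p (m - l) \<otimes> q (m - (m - l)))"
    by (rule finsum_reindex) (use p q inj in auto)
  also have "\<dots> = (\<Oplus>l\<in>{l. l \<subseteq># m}. q l \<otimes> p (m - l))"
    by (rule finsum_cong') (auto simp: m_comm subset_mset.diff_diff_right)
  finally show "(p \<otimes>\<^bsub>mpoly R d\<^esub> q) m = (q \<otimes>\<^bsub>mpoly R d\<^esub> p) m"
    unfolding mpoly_mult .
qed

lemma mpoly_distrib:
  assumes p: "p \<in> carrier (mpoly R d)" and q: "q \<in> carrier (mpoly R d)"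
    and r: "r \<in> carrier (mpoly R d)"
  shows "(p \<oplus>\<^bsub>mpoly R d\<^esub> q) \<otimes>\<^bsub>mpoly R d\<^esub> r =
    p \<otimes>\<^bsub>mpoly R d\<^esub> r \<oplus>\<^bsub>mpoly R d\<^esub> q \<otimes>\<^bsub>mpoly R d\<^esub> r"
proof
  note [simp] = mpoly_coeff_closed[OF p] mpoly_coeff_closed[OF q] mpoly_coeff_closed[OF r]
  fix m
  have "(\<Oplus>l\<in>{l. l \<subseteq># m}. (p l \<oplus> q l) \<otimes> r (m - l)) =
        (\<Oplus>l\<in>{l. l \<subseteq># m}. p l \<otimes> r (m - l) \<oplus> q l \<otimes> r (m - l))"
    by (rule finsum_cong') (use p q r in \<open>auto simp: l_distr\<close>)
  also have "\<dots> = (\<Oplus>l\<in>{l. l \<subseteq># m}. p l \<otimes> r (m - l)) \<oplus> (\<Oplus>l\<in>{l. l \<subseteq># m}. q l \<otimes> r (m - l))"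
    by (rule finsum_addf) (use p q r in auto)
  finally show "((p \<oplus>\<^bsub>mpoly R d\<^esub> q) \<otimes>\<^bsub>mpoly R d\<^esub> r) m =
    (p \<otimes>\<^bsub>mpoly R d\<^esub> r \<oplus>\<^bsub>mpoly R d\<^esub> q \<otimes>\<^bsub>mpoly R d\<^esub> r) m"
    unfolding mpoly_mult mpoly_add .
qed

lemma mpoly_monom_mult:
  assumes "a \<in> carrier R" "b \<in> carrier R"
  shows "mpoly_monom R a k \<otimes>\<^bsub>mpoly R d\<^esub> mpoly_monom R b l = mpoly_monom R (a \<otimes> b) (k + l)"
proof
  fix m
  have "(\<Oplus>j\<in>{j. j \<subseteq># m}. mpoly_monom R a k j \<otimes> mpoly_monom R b l (m - j)) =
        (\<Oplus>j\<in>{j. j \<subseteq># m}. if k = j then mpoly_monom R (a \<otimes> b) (k + l) m else \<zero>)"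
  proof (rule finsum_cong')
    fix j assume "j \<in> {j. j \<subseteq># m}"
    then show "mpoly_monom R a k j \<otimes> mpoly_monom R b l (m - j) = (if k = j then mpoly_monom R (a \<otimes> b) (k + l) m else \<zero>)"
      using assms by (auto simp: mpoly_monom_def)
  qed (use assms in \<open>auto simp: mpoly_monom_def\<close>)
  also have "\<dots> = mpoly_monom R (a \<otimes> b) (k + l) m"
  proof (cases "k \<subseteq># m")
    case True
    then show ?thesis
      using assms by (subst add.finprod_singleton) (auto simp: finite_submultisets mpoly_monom_def)
  next
    case False
    then have *: "mpoly_monom R (a \<otimes> b) (k + l) m = \<zero>" by (auto simp: mpoly_monom_def)
    then have "(\<Oplus>j\<in>{j. j \<subseteq># m}. if k = j then mpoly_monom R (a \<otimes> b) (k + l) m else \<zero>) = \<zero>"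
      by (intro add.finprod_one_eqI) auto
    with * show ?thesis by simp
  qed
  finally show "(mpoly_monom R a k \<otimes>\<^bsub>mpoly R d\<^esub> mpoly_monom R b l) m = mpoly_monom R (a \<otimes> b) (k + l) m"
    unfolding mpoly_mult .
qed

text \<open>Induction on the size of the support: one nonzero coefficient is split off as a
  monomial. The zero polynomial is covered as the monomial with coefficient zero.\<close>

lemma mpoly_mono_induct [consumes 1, case_names mono add]:
  assumes "p \<in> carrier (mpoly R d)"
    and mono: "\<And>c m. c \<in> carrier R \<Longrightarrow> set_mset m \<subseteq> {..<d} \<Longrightarrow> P (mpoly_monom R c m)"
    and add: "\<And>p q. p \<in> carrier (mpoly R d) \<Longrightarrow> q \<in> carrier (mpoly R d) \<Longrightarrow> P p \<Longrightarrow> P q \<Longrightarrow>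
      P (p \<oplus>\<^bsub>mpoly R d\<^esub> q)"
  shows "P p"
  using assms(1)
proof (induction "card {m. p m \<noteq> \<zero>}" arbitrary: p)
  case 0
  then have "{m. p m \<noteq> \<zero>} = {}" by (simp add: carrier_mpoly)
  then have "p = mpoly_monom R \<zero> {#}" by (auto simp: mpoly_monom_def)
  then show ?case using mono[of \<zero> "{#}"] by simp
next
  case (Suc n)
  then obtain m where m: "p m \<noteq> \<zero>"
    by (metis (mono_tags, lifting) Collect_empty_eq card.empty nat.distinct(1))
  define q where "q = p(m := \<zero>)"
  have supp: "{l. q l \<noteq> \<zero>} = {l. p l \<noteq> \<zero>} - {m}" by (auto simp: q_def)
  have q: "q \<in> carrier (mpoly R d)"
    using Suc.prems by (simp add: carrier_mpoly supp) (simp add: q_def)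
  have "card {l. q l \<noteq> \<zero>} = n"
    using Suc.hyps(2) m Suc.prems by (simp add: supp carrier_mpoly)
  then have "P q" using Suc.hyps(1) q by simp
  moreover have mm: "p m \<in> carrier R" "set_mset m \<subseteq> {..<d}"
    using Suc.prems m by (auto simp: carrier_mpoly)
  moreover have "p = mpoly_monom R (p m) m \<oplus>\<^bsub>mpoly R d\<^esub> q"
    using mpoly_coeff_closed[OF Suc.prems] by (auto simp: mpoly_add mpoly_monom_def q_def fun_eq_iff)
  ultimately show ?case
    using add[of "mpoly_monom R (p m) m" q] mono[of "p m" m] mpoly_monom_closed[of "p m" m d] q by metis
qed

lemma mpoly_abelian_group: "abelian_group (mpoly R d)"
proof (rule abelian_groupI)
  fix p assume p: "p \<in> carrier (mpoly R d)"
  have "(\<lambda>m. \<ominus> p m) \<in> carrier (mpoly R d)"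
    using p add.inv_eq_1_iff by (simp add: carrier_mpoly)
  moreover have "(\<lambda>m. \<ominus> p m) \<oplus>\<^bsub>mpoly R d\<^esub> p = \<zero>\<^bsub>mpoly R d\<^esub>"
    using mpoly_coeff_closed[OF p] by (auto simp: mpoly_add mpoly_zero l_neg)
  ultimately show "\<exists>q\<in>carrier (mpoly R d). q \<oplus>\<^bsub>mpoly R d\<^esub> p = \<zero>\<^bsub>mpoly R d\<^esub>"
    by blast
next
  fix p q assume "p \<in> carrier (mpoly R d)" "q \<in> carrier (mpoly R d)"
  then show "p \<oplus>\<^bsub>mpoly R d\<^esub> q = q \<oplus>\<^bsub>mpoly R d\<^esub> p"
    by (auto simp: mpoly_add intro!: ext a_comm mpoly_coeff_closed)
qed (simp_all add: mpoly_add_closed mpoly_zero mpoly_zero_closed,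
     simp_all add: mpoly_add mpoly_coeff_closed[of _ d] a_assoc)

text \<open>Both sides are additive in each argument, so three nested inductions leave only
  monomials, where the claim is associativity in the coefficient ring and of multiset union.\<close>

lemma mpoly_mult_assoc:
  assumes p: "p \<in> carrier (mpoly R d)" and q: "q \<in> carrier (mpoly R d)"
    and r: "r \<in> carrier (mpoly R d)"
  shows "p \<otimes>\<^bsub>mpoly R d\<^esub> q \<otimes>\<^bsub>mpoly R d\<^esub> r = p \<otimes>\<^bsub>mpoly R d\<^esub> (q \<otimes>\<^bsub>mpoly R d\<^esub> r)"
proof -
  have distrib': "r \<otimes>\<^bsub>mpoly R d\<^esub> (p \<oplus>\<^bsub>mpoly R d\<^esub> q) =
      r \<otimes>\<^bsub>mpoly R d\<^esub> p \<oplus>\<^bsub>mpoly R d\<^esub> r \<otimes>\<^bsub>mpoly R d\<^esub> q"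
    if "p \<in> carrier (mpoly R d)" "q \<in> carrier (mpoly R d)" "r \<in> carrier (mpoly R d)" for p q r
    using that by (simp add: mpoly_mult_comm[of r] mpoly_add_closed mpoly_distrib)
  note [simp] = mpoly_distrib distrib' mpoly_mult_closed mpoly_add_closed mpoly_monom_closed
  show ?thesis
    using p
  proof (induction p rule: mpoly_mono_induct)
    case (mono a k)
    show ?case
      using q
    proof (induction q rule: mpoly_mono_induct)
      case (mono b l)
      show ?case
        using r
      proof (induction r rule: mpoly_mono_induct)
        case (mono c m)
        then show ?case
          using \<open>a \<in> carrier R\<close> \<open>b \<in> carrier R\<close> by (simp add: mpoly_monom_mult m_assoc add.assoc union_assoc)
      qed (use mono \<open>a \<in> carrier R\<close> \<open>set_mset k \<subseteq> _\<close> in simp)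
    qed (use mono r in simp)
  qed (use q r in simp)
qed

lemma mpoly_cring: "cring (mpoly R d)"
proof (rule cringI)
  show "abelian_group (mpoly R d)" by (rule mpoly_abelian_group)
  show "Group.comm_monoid (mpoly R d)"
  proof (rule comm_monoidI)
    fix p assume "p \<in> carrier (mpoly R d)"
    then show "\<one>\<^bsub>mpoly R d\<^esub> \<otimes>\<^bsub>mpoly R d\<^esub> p = p"
    proof (induction p rule: mpoly_mono_induct)
      case (add p q)
      have "\<one>\<^bsub>mpoly R d\<^esub> \<in> carrier (mpoly R d)" by (simp add: mpoly_one mpoly_monom_closed)
      with add show ?case by (simp add: mpoly_mult_comm[of "\<one>\<^bsub>mpoly R d\<^esub>"] mpoly_add_closed mpoly_distrib)
    qed (simp add: mpoly_one mpoly_monom_mult)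
  qed (simp_all add: mpoly_mult_closed mpoly_one mpoly_monom_closed mpoly_mult_assoc, rule mpoly_mult_comm)
qed (simp add: mpoly_distrib)

lemma indexed_const_closed: "c \<in> carrier R \<Longrightarrow> indexed_const c \<in> carrier (mpoly R d)"
  by (simp add: indexed_const_mono mpoly_monom_closed)

lemma indexed_var_closed: "i < d \<Longrightarrow> indexed_var i \<in> carrier (mpoly R d)"
  by (simp add: indexed_var_mono mpoly_monom_closed)

lemma indexed_const_ring_hom: "indexed_const \<in> ring_hom R (mpoly R d)"
  by (rule ring_hom_memI)
    (auto simp: indexed_const_closed[unfolded indexed_const_mono] mpoly_one indexed_const_mono
      mpoly_monom_mult mpoly_add, auto simp: mpoly_monom_def)

text \<open>Monomials are broken up further into a constant times variables. In this form the
  induction passes to quotients of the polynomial ring and compares homomorphisms on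
  generators.\<close>

lemma mpoly_induct [consumes 1, case_names const add var]:
  assumes "p \<in> carrier (mpoly R d)"
    and const: "\<And>c. c \<in> carrier R \<Longrightarrow> P (indexed_const c)"
    and add: "\<And>p q. p \<in> carrier (mpoly R d) \<Longrightarrow> q \<in> carrier (mpoly R d) \<Longrightarrow> P p \<Longrightarrow> P q \<Longrightarrow>
      P (p \<oplus>\<^bsub>mpoly R d\<^esub> q)"
    and var: "\<And>i p. i < d \<Longrightarrow> p \<in> carrier (mpoly R d) \<Longrightarrow> P p \<Longrightarrow>
      P (indexed_var i \<otimes>\<^bsub>mpoly R d\<^esub> p)"
  shows "P p"
  using assms(1)
proof (induction p rule: mpoly_mono_induct)
  case (mono c m)
  then show ?case
  proof (induction m)
    case empty
    then show ?case using const[of c] by (simp add: indexed_const_mono)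
  next
    case (add i m)
    then have "P (indexed_var i \<otimes>\<^bsub>mpoly R d\<^esub> mpoly_monom R c m)"
      by (intro var) (auto simp: mpoly_monom_closed)
    then show ?case using add.prems by (simp add: indexed_var_mono mpoly_monom_mult)
  qed
qed (rule add)

end

subsection \<open>Evaluation\<close>

locale mpoly_evaluation = ring_hom_cring A B f for A (structure) and B (structure) and f +
  fixes d :: nat and x :: "nat \<Rightarrow> 'c"
  assumes x_closed: "\<And>i. i < d \<Longrightarrow> x i \<in> carrier B"
begin

abbreviation "ev \<equiv> mpoly_eval A B f x"

definition xpow :: "nat multiset \<Rightarrow> 'c" where
  "xpow m = (\<Otimes>\<^bsub>B\<^esub>i\<in>set_mset m. x i [^]\<^bsub>B\<^esub> count m i)"

text \<open>A product over the fixed index set lets exponents of different monomials be added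
  variable by variable; an index missing from \<open>m\<close> contributes a zeroth power.\<close>

lemma xpow_lessThan:
  assumes "set_mset m \<subseteq> {..<d}"
  shows "xpow m = (\<Otimes>\<^bsub>B\<^esub>i\<in>{..<d}. x i [^]\<^bsub>B\<^esub> count m i)"
  unfolding xpow_def using assms
  by (intro S.finprod_mono_neutral_cong_left) (auto simp: x_closed not_in_iff)

lemma xpow_closed: "set_mset m \<subseteq> {..<d} \<Longrightarrow> xpow m \<in> carrier B"
  unfolding xpow_def by (intro S.finprod_closed) (auto simp: x_closed)

lemma xpow_add:
  assumes "set_mset k \<subseteq> {..<d}" "set_mset l \<subseteq> {..<d}"
  shows "xpow (k + l) = xpow k \<otimes>\<^bsub>B\<^esub> xpow l"
proof -
  have "xpow (k + l) = (\<Otimes>\<^bsub>B\<^esub>i\<in>{..<d}. x i [^]\<^bsub>B\<^esub> count k i \<otimes>\<^bsub>B\<^esub> x i [^]\<^bsub>B\<^esub> count l i)"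
    using assms by (subst xpow_lessThan) (auto simp: x_closed simp flip: S.nat_pow_mult simp del: S.finprod_multf intro!: S.finprod_cong')
  also have "\<dots> = xpow k \<otimes>\<^bsub>B\<^esub> xpow l"
    unfolding xpow_lessThan[OF assms(1)] xpow_lessThan[OF assms(2)]
    by (rule S.finprod_multf) (auto simp: x_closed)
  finally show ?thesis .
qed

text \<open>\<open>mpoly_eval\<close> sums over the support, which changes under addition. Over any
  larger finite set the sum is the same, because \<open>f\<close> sends the additional zero
  coefficients to zero.\<close>

lemma ev_supset:
  assumes p: "p \<in> carrier (mpoly A d)" and "finite Y" "{m. p m \<noteq> \<zero>\<^bsub>A\<^esub>} \<subseteq> Y"
    and "\<And>m. m \<in> Y \<Longrightarrow> set_mset m \<subseteq> {..<d}"
  shows "ev p = (\<Oplus>\<^bsub>B\<^esub>m\<in>Y. f (p m) \<otimes>\<^bsub>B\<^esub> xpow m)"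
  unfolding mpoly_eval_def xpow_def[symmetric]
  by (rule S.add.finprod_mono_neutral_cong_left)
    (use assms R.mpoly_coeff_closed[OF p] in \<open>auto simp: xpow_closed\<close>)

lemma ev_mono:
  assumes "c \<in> carrier A" "set_mset m \<subseteq> {..<d}"
  shows "ev (mpoly_monom A c m) = f c \<otimes>\<^bsub>B\<^esub> xpow m"
proof -
  have "ev (mpoly_monom A c m) = (\<Oplus>\<^bsub>B\<^esub>l\<in>{m}. f (mpoly_monom A c m l) \<otimes>\<^bsub>B\<^esub> xpow l)"
    using assms R.mpoly_monom_closed[OF assms] by (intro ev_supset) (auto simp: mpoly_monom_def split: if_splits)
  also have "\<dots> = f c \<otimes>\<^bsub>B\<^esub> xpow m"
    using assms by (simp add: mpoly_monom_def xpow_closed)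
  finally show ?thesis .
qed

lemma ev_closed: "p \<in> carrier (mpoly A d) \<Longrightarrow> ev p \<in> carrier B"
  unfolding mpoly_eval_def xpow_def[symmetric]
  by (intro S.finsum_closed) (auto simp: R.carrier_mpoly xpow_closed)

lemma ev_add:
  assumes p: "p \<in> carrier (mpoly A d)" and q: "q \<in> carrier (mpoly A d)"
  shows "ev (p \<oplus>\<^bsub>mpoly A d\<^esub> q) = ev p \<oplus>\<^bsub>B\<^esub> ev q"
proof -
  note [simp] = R.mpoly_coeff_closed[OF p] R.mpoly_coeff_closed[OF q]
  let ?Y = "{m. p m \<noteq> \<zero>} \<union> {m. q m \<noteq> \<zero>}"
  have Y: "finite ?Y" "\<And>m. m \<in> ?Y \<Longrightarrow> set_mset m \<subseteq> {..<d}"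
    using p q by (auto simp: R.carrier_mpoly)
  have "ev (p \<oplus>\<^bsub>mpoly A d\<^esub> q) = (\<Oplus>\<^bsub>B\<^esub>m\<in>?Y. f (p m) \<otimes>\<^bsub>B\<^esub> xpow m \<oplus>\<^bsub>B\<^esub> f (q m) \<otimes>\<^bsub>B\<^esub> xpow m)"
  proof (subst ev_supset[OF R.mpoly_add_closed[OF p q] Y(1) _ Y(2)])
    show "{m. (p \<oplus>\<^bsub>mpoly A d\<^esub> q) m \<noteq> \<zero>} \<subseteq> ?Y"
      by (auto simp: R.mpoly_add)
    show "(\<Oplus>\<^bsub>B\<^esub>m\<in>?Y. f ((p \<oplus>\<^bsub>mpoly A d\<^esub> q) m) \<otimes>\<^bsub>B\<^esub> xpow m) =
      (\<Oplus>\<^bsub>B\<^esub>m\<in>?Y. f (p m) \<otimes>\<^bsub>B\<^esub> xpow m \<oplus>\<^bsub>B\<^esub> f (q m) \<otimes>\<^bsub>B\<^esub> xpow m)"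
      using p q Y(2) by (intro S.finsum_cong')
        (auto simp: R.mpoly_add S.l_distr xpow_closed)
  qed simp_all
  also have "\<dots> = (\<Oplus>\<^bsub>B\<^esub>m\<in>?Y. f (p m) \<otimes>\<^bsub>B\<^esub> xpow m) \<oplus>\<^bsub>B\<^esub> (\<Oplus>\<^bsub>B\<^esub>m\<in>?Y. f (q m) \<otimes>\<^bsub>B\<^esub> xpow m)"
    using p q Y(2) by (intro S.finsum_addf) (auto simp: xpow_closed)
  also have "\<dots> = ev p \<oplus>\<^bsub>B\<^esub> ev q"
    using ev_supset[OF p Y(1) _ Y(2)] ev_supset[OF q Y(1) _ Y(2)] by simp
  finally show ?thesis .
qed

text \<open>Both sides are biadditive by \<open>ev_add\<close>, hence it suffices to multiply
  monomials, and there the exponents add by \<open>xpow_add\<close>.\<close>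

lemma ev_mult:
  assumes p: "p \<in> carrier (mpoly A d)" and q: "q \<in> carrier (mpoly A d)"
  shows "ev (p \<otimes>\<^bsub>mpoly A d\<^esub> q) = ev p \<otimes>\<^bsub>B\<^esub> ev q"
proof -
  interpret P: cring "mpoly A d" by (rule R.mpoly_cring)
  note [simp] = R.mpoly_monom_closed P.l_distr P.r_distr S.l_distr S.r_distr ev_add ev_closed
  show ?thesis
    using p
  proof (induction p rule: R.mpoly_mono_induct)
    case (mono a k)
    show ?case
      using q
    proof (induction q rule: R.mpoly_mono_induct)
      case (mono b l)
      with \<open>a \<in> carrier A\<close> \<open>set_mset k \<subseteq> _\<close> show ?case
        by (simp add: R.mpoly_monom_mult ev_mono xpow_add S.m_ac xpow_closed)
    qed (use mono in simp)
  qed (use q in simp)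
qed

lemma ev_const: "c \<in> carrier A \<Longrightarrow> ev (R.indexed_const c) = f c"
  by (simp add: R.indexed_const_mono ev_mono) (simp add: xpow_def)

lemma ev_var: "i < d \<Longrightarrow> ev (R.indexed_var i) = x i"
  by (simp add: R.indexed_var_mono ev_mono) (simp add: xpow_def x_closed)

lemma ev_ring_hom: "ev \<in> ring_hom (mpoly A d) B"
  by (rule ring_hom_memI)
    (auto simp: ev_closed ev_add ev_mult R.mpoly_one ev_const[of \<one>, unfolded R.indexed_const_mono])

end

text \<open>The uniqueness half of the universal property of the polynomial ring;
  \<open>ev_ring_hom\<close> is the existence half.\<close>

lemma (in cring) mpoly_hom_eq:
  assumes "ring_hom_cring (mpoly R d) C h" "ring_hom_cring (mpoly R d) C k"
    and "\<And>c. c \<in> carrier R \<Longrightarrow> h (indexed_const c) = k (indexed_const c)"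
    and "\<And>i. i < d \<Longrightarrow> h (indexed_var i) = k (indexed_var i)"
    and "p \<in> carrier (mpoly R d)"
  shows "h p = k p"
proof -
  interpret h: ring_hom_cring "mpoly R d" C h by fact
  interpret k: ring_hom_cring "mpoly R d" C k by fact
  show ?thesis
    using assms(5) by (induction p rule: mpoly_induct) (simp_all add: assms indexed_var_closed)
qed

section \<open>Tensor products\<close>

text \<open>The rings here carry additional record fields, such as a topology or a scalar
  multiplication, and are known to agree with standard constructions only field by field. The axioms
  see just the five ring fields.\<close>

lemma cring_cong:
  assumes "cring S" "carrier T = carrier S" "monoid.mult T = monoid.mult S" "\<one>\<^bsub>T\<^esub> = \<one>\<^bsub>S\<^esub>"
    "\<zero>\<^bsub>T\<^esub> = \<zero>\<^bsub>S\<^esub>" "add T = add S"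
  shows "cring T"
proof -
  have "cring T = cring S"
    unfolding cring_def ring_def abelian_group_def abelian_monoid_def comm_monoid_def
    comm_monoid_axioms_def monoid_def ring_axioms_def abelian_group_axioms_def comm_group_def
    group_def group_axioms_def Units_def
    by (simp only: assms(2-) partial_object.simps monoid.simps)
  with assms(1) show ?thesis by simp
qed

text \<open>Bridges notations: the tensor product is written additively, while the quotient group
  that it comes from is written multiplicatively.\<close>

lemma abelian_group_cong:
  assumes "comm_group G" "carrier T = carrier G" "add T = monoid.mult G" "\<zero>\<^bsub>T\<^esub> = \<one>\<^bsub>G\<^esub>"
  shows "abelian_group T"
proof (rule comm_group_abelian_groupI)
  have "comm_group (add_monoid T) = comm_group G"
    unfolding comm_monoid_def comm_monoid_axioms_def monoid_def comm_group_def
      group_def group_axioms_def Units_def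
    by (simp only: assms(2-) partial_object.simps monoid.simps)
  with assms(1) show "comm_group (add_monoid T)" by simp
qed

text \<open>Stated for maps that are merely additive, since tensor lifts, coordinates and the
  restriction of a ring map to \<open>Omega\<close> are all used under sums. For an infinite index
  set both sides are zero by convention.\<close>

lemma additive_finsum:
  assumes "abelian_group G" "abelian_group H" "h \<in> carrier G \<rightarrow> carrier H"
    and add: "\<And>a b. a \<in> carrier G \<Longrightarrow> b \<in> carrier G \<Longrightarrow> h (a \<oplus>\<^bsub>G\<^esub> b) = h a \<oplus>\<^bsub>H\<^esub> h b"
    and "f \<in> I \<rightarrow> carrier G"
  shows "h (finsum G f I) = (\<Oplus>\<^bsub>H\<^esub>i\<in>I. h (f i))"
proof -
  interpret G: abelian_group G by fact
  interpret H: abelian_group H by fact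
  have h: "h a \<in> carrier H" if "a \<in> carrier G" for a using assms(3) that by auto
  have zero: "h \<zero>\<^bsub>G\<^esub> = \<zero>\<^bsub>H\<^esub>"
    using add[of "\<zero>\<^bsub>G\<^esub>" "\<zero>\<^bsub>G\<^esub>"] h[of "\<zero>\<^bsub>G\<^esub>"] by simp
  show ?thesis
    using assms(5)
  proof (induction I rule: infinite_finite_induct)
    case (insert i I)
    then have "f \<in> I \<rightarrow> carrier G" "f i \<in> carrier G" by auto
    with insert show ?case by (simp add: add h G.finsum_closed Pi_iff)
  qed (simp_all add: zero)
qed

lemmas frag_group_induct = free_Abelian_group_induct[consumes 1, case_names zero diff frag_of]

locale tensor_product = M?: abelian_group M + N?: abelian_group N
  for R :: "('r, 'e) ring_scheme" and M :: "('r, 'm, 'f) module_scheme" (structure)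
    and N :: "('r, 'n, 'g) module_scheme" (structure) +
  assumes smult_M: "\<And>r m. r \<in> carrier R \<Longrightarrow> m \<in> carrier M \<Longrightarrow> r \<odot>\<^bsub>M\<^esub> m \<in> carrier M"
    and smult_N: "\<And>r n. r \<in> carrier R \<Longrightarrow> n \<in> carrier N \<Longrightarrow> r \<odot>\<^bsub>N\<^esub> n \<in> carrier N"
begin

abbreviation "F \<equiv> free_Abelian_group (carrier M \<times> carrier N)"
abbreviation "K \<equiv> tensor_rel R M N"
abbreviation "T \<equiv> tensor R M N"
abbreviation "tn \<equiv> tens R M N"

definition relators :: "('m \<times> 'n \<Rightarrow>\<^sub>0 int) set" where
  "relators =
     {frag_of (m \<oplus>\<^bsub>M\<^esub> m', n) - frag_of (m, n) - frag_of (m', n) | m m' n.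
         m \<in> carrier M \<and> m' \<in> carrier M \<and> n \<in> carrier N} \<union>
      {frag_of (m, n \<oplus>\<^bsub>N\<^esub> n') - frag_of (m, n) - frag_of (m, n') | m n n'.
         m \<in> carrier M \<and> n \<in> carrier N \<and> n' \<in> carrier N} \<union>
      {frag_of (r \<odot>\<^bsub>M\<^esub> m, n) - frag_of (m, r \<odot>\<^bsub>N\<^esub> n) | r m n.
         r \<in> carrier R \<and> m \<in> carrier M \<and> n \<in> carrier N}"

lemma K_generate: "K = generate F relators"
  by (simp add: tensor_rel_def relators_def)

lemma relators_closed: "relators \<subseteq> carrier F"
proof -
  have 1: "frag_of p - frag_of q \<in> carrier F"
    if "p \<in> carrier M \<times> carrier N" "q \<in> carrier M \<times> carrier N" for p q
    using that keys_diff[of "frag_of p" "frag_of q"] by auto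
  have 2: "frag_of p - frag_of q - frag_of r \<in> carrier F"
    if "p \<in> carrier M \<times> carrier N" "q \<in> carrier M \<times> carrier N" "r \<in> carrier M \<times> carrier N" for p q r
    using 1[OF that(1,2)] that(3) keys_diff[of "frag_of p - frag_of q" "frag_of r"] by auto
  show ?thesis
    unfolding relators_def
    by (rule subsetI, elim UnE CollectE exE conjE; simp only:; (rule 2 | rule 1); simp add: smult_M smult_N)
qed

lemma K_subgroup: "subgroup K F"
  unfolding K_generate by (rule group.generate_is_subgroup) (simp_all add: relators_closed del: carrier_free_Abelian_group_iff)

lemma K_normal: "K \<lhd> F"
  using K_subgroup abelian_free_Abelian_group comm_group.subgroup_imp_normal by blast

definition cls :: "('m \<times> 'n \<Rightarrow>\<^sub>0 int) \<Rightarrow> ('m \<times> 'n \<Rightarrow>\<^sub>0 int) set" where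
  "cls u = K #>\<^bsub>F\<^esub> u"

lemma carrier_tensor: "carrier T = cls ` carrier F"
  by (auto simp: tensor_def Let_def RCOSETS_def cls_def)

lemma tens_cls: "tn m n = cls (frag_of (m, n))"
  by (simp add: tens_def cls_def)

text \<open>The additive structure of the tensor product is literally that of the quotient group
  \<open>F Mod K\<close>, from which the group axioms are inherited.\<close>

lemma tensor_Mod:
  "carrier T = carrier (F Mod K)" "add T = monoid.mult (F Mod K)" "\<zero>\<^bsub>T\<^esub> = \<one>\<^bsub>F Mod K\<^esub>"
  by (simp_all add: tensor_def Let_def FactGroup_def fun_eq_iff)

lemma tensor_abelian_group: "abelian_group T"
  using comm_group.abelian_FactGroup[OF abelian_free_Abelian_group K_subgroup] tensor_Mod
  by (rule abelian_group_cong)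

sublocale T: abelian_group T
  by (rule tensor_abelian_group)

lemma cls_closed: "u \<in> carrier F \<Longrightarrow> cls u \<in> carrier T"
  by (simp add: carrier_tensor del: carrier_free_Abelian_group_iff)

lemma cls_add:
  assumes "u \<in> carrier F" "v \<in> carrier F"
  shows "cls (u + v) = cls u \<oplus>\<^bsub>T\<^esub> cls v"
  using normal.rcos_sum[OF K_normal assms] by (simp add: cls_def tensor_def Let_def)

lemma cls_zero: "cls 0 = \<zero>\<^bsub>T\<^esub>"
  using group.coset_mult_one[of F K] K_subgroup
  by (simp add: cls_def tensor_def Let_def subgroup.subset del: carrier_free_Abelian_group_iff)

lemma cls_minus:
  assumes "u \<in> carrier F" "v \<in> carrier F"
  shows "cls (u - v) = cls u \<ominus>\<^bsub>T\<^esub> cls v"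
proof -
  have uv: "u - v \<in> carrier F" using assms by (auto dest: subsetD[OF keys_diff])
  have "cls u = cls (u - v) \<oplus>\<^bsub>T\<^esub> cls v"
    using cls_add[OF uv assms(2)] by simp
  then show ?thesis
    using cls_closed[OF uv] cls_closed[OF assms(1)] cls_closed[OF assms(2)]
    by (simp add: T.minus_eq T.add.m_assoc T.r_neg)
qed

lemma cls_eq:
  assumes "u \<in> carrier F" "v \<in> carrier F" "u - v \<in> K"
  shows "cls u = cls v"
proof -
  have uv: "u - v \<in> carrier F" by (rule subgroup.mem_carrier[OF K_subgroup assms(3)])
  have "cls (u - v) = \<zero>\<^bsub>T\<^esub>"
    using group.coset_join2[OF group_free_Abelian_group _ K_subgroup, of "u - v"] assms(3)
      uv
    by (simp add: cls_def tensor_def Let_def)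
  then show ?thesis
    using cls_add[OF uv assms(2)] cls_closed[OF assms(2)] by simp
qed

lemma tens_closed [simp, intro]:
  "m \<in> carrier M \<Longrightarrow> n \<in> carrier N \<Longrightarrow> tn m n \<in> carrier T"
  by (simp add: tens_cls cls_closed)

lemma tens_add_left:
  assumes "m \<in> carrier M" "m' \<in> carrier M" "n \<in> carrier N"
  shows "tn (m \<oplus>\<^bsub>M\<^esub> m') n = tn m n \<oplus>\<^bsub>T\<^esub> tn m' n"
proof -
  have "frag_of (m \<oplus>\<^bsub>M\<^esub> m', n) - frag_of (m, n) - frag_of (m', n) \<in> K"
    unfolding K_generate relators_def using assms by (intro generate.incl) blast
  then have "cls (frag_of (m \<oplus>\<^bsub>M\<^esub> m', n)) = cls (frag_of (m, n) + frag_of (m', n))"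
    using assms by (intro cls_eq) (auto simp: diff_diff_add dest!: subsetD[OF keys_add])
  then show ?thesis
    using assms by (simp add: tens_cls cls_add)
qed

lemma tens_add_right:
  assumes "m \<in> carrier M" "n \<in> carrier N" "n' \<in> carrier N"
  shows "tn m (n \<oplus>\<^bsub>N\<^esub> n') = tn m n \<oplus>\<^bsub>T\<^esub> tn m n'"
proof -
  have "frag_of (m, n \<oplus>\<^bsub>N\<^esub> n') - frag_of (m, n) - frag_of (m, n') \<in> K"
    unfolding K_generate relators_def using assms by (intro generate.incl) blast
  then have "cls (frag_of (m, n \<oplus>\<^bsub>N\<^esub> n')) = cls (frag_of (m, n) + frag_of (m, n'))"
    using assms by (intro cls_eq) (auto simp: diff_diff_add dest!: subsetD[OF keys_add])
  then show ?thesis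
    using assms by (simp add: tens_cls cls_add)
qed

lemma tens_smult:
  assumes "r \<in> carrier R" "m \<in> carrier M" "n \<in> carrier N"
  shows "tn (r \<odot>\<^bsub>M\<^esub> m) n = tn m (r \<odot>\<^bsub>N\<^esub> n)"
proof -
  have "frag_of (r \<odot>\<^bsub>M\<^esub> m, n) - frag_of (m, r \<odot>\<^bsub>N\<^esub> n) \<in> K"
    unfolding K_generate relators_def using assms by (intro generate.incl) blast
  then show ?thesis
    unfolding tens_cls using assms by (intro cls_eq) (auto simp: smult_M smult_N)
qed

lemma tens_zero_left: "n \<in> carrier N \<Longrightarrow> tn \<zero>\<^bsub>M\<^esub> n = \<zero>\<^bsub>T\<^esub>"
  using tens_add_left[of "\<zero>\<^bsub>M\<^esub>" "\<zero>\<^bsub>M\<^esub>" n] tens_closed[of "\<zero>\<^bsub>M\<^esub>" n]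
  by (metis M.r_zero M.zero_closed T.add.l_cancel_one')

lemma tens_neg_left: "m \<in> carrier M \<Longrightarrow> n \<in> carrier N \<Longrightarrow> tn (\<ominus>\<^bsub>M\<^esub> m) n = \<ominus>\<^bsub>T\<^esub> tn m n"
  using tens_add_left[of "\<ominus>\<^bsub>M\<^esub> m" m n] tens_zero_left[of n]
  by (metis M.a_inv_closed M.l_neg T.minus_equality tens_closed)

lemma tens_finsum_right:
  assumes "m \<in> carrier M" "f \<in> I \<rightarrow> carrier N"
  shows "tn m (\<Oplus>\<^bsub>N\<^esub>i\<in>I. f i) = (\<Oplus>\<^bsub>T\<^esub>i\<in>I. tn m (f i))"
  by (rule additive_finsum[OF N.abelian_group_axioms T.abelian_group_axioms _ _ assms(2)])
    (use assms(1) in \<open>auto simp: tens_add_right\<close>)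

lemma tensor_induct [consumes 1, case_names tens add]:
  assumes "t \<in> carrier T"
    and tens: "\<And>m n. m \<in> carrier M \<Longrightarrow> n \<in> carrier N \<Longrightarrow> P (tn m n)"
    and add: "\<And>t u. t \<in> carrier T \<Longrightarrow> u \<in> carrier T \<Longrightarrow> P t \<Longrightarrow> P u \<Longrightarrow> P (t \<oplus>\<^bsub>T\<^esub> u)"
  shows "P t"
proof -
  obtain x where x: "Poly_Mapping.keys x \<subseteq> carrier M \<times> carrier N" "t = cls x"
    using assms(1) by (auto simp: carrier_tensor)
  \<comment> \<open>The induction on the free group produces differences, while \<open>add\<close>
    treats sums. Carrying the claim for the negative as well closes the gap, because the negative of
    a pure tensor is again a pure tensor.\<close>
  have "P (cls x) \<and> P (\<ominus>\<^bsub>T\<^esub> cls x)"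
    using x(1)
  proof (induction x rule: frag_group_induct)
    case zero
    have "\<ominus>\<^bsub>T\<^esub> \<zero>\<^bsub>T\<^esub> = \<zero>\<^bsub>T\<^esub>"
      by (rule T.minus_equality) simp_all
    moreover have "P \<zero>\<^bsub>T\<^esub>"
      using tens[of "\<zero>\<^bsub>M\<^esub>" "\<zero>\<^bsub>N\<^esub>"] by (simp add: tens_zero_left)
    ultimately show ?case
      unfolding cls_zero by metis
  next
    case (diff x y)
    then have "cls x \<in> carrier T" "cls y \<in> carrier T" by (simp_all add: cls_closed)
    moreover from this have "\<ominus>\<^bsub>T\<^esub> (cls x \<ominus>\<^bsub>T\<^esub> cls y) = \<ominus>\<^bsub>T\<^esub> cls x \<oplus>\<^bsub>T\<^esub> cls y"
      by (simp add: T.minus_eq T.minus_add)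
    ultimately show ?case
      using diff by (simp add: cls_minus add T.minus_eq)
  next
    case (frag_of a)
    then show ?case
      using tens[of "fst a" "snd a"] tens[of "\<ominus>\<^bsub>M\<^esub> fst a" "snd a"] tens_neg_left[of "fst a" "snd a"]
      by (auto simp: tens_cls)
  qed
  with x show ?thesis by simp
qed

lemma additive_eq:
  assumes "abelian_group S" "h \<in> carrier T \<rightarrow> carrier S" "k \<in> carrier T \<rightarrow> carrier S"
    and "\<And>t u. t \<in> carrier T \<Longrightarrow> u \<in> carrier T \<Longrightarrow> h (t \<oplus>\<^bsub>T\<^esub> u) = h t \<oplus>\<^bsub>S\<^esub> h u"
    and "\<And>t u. t \<in> carrier T \<Longrightarrow> u \<in> carrier T \<Longrightarrow> k (t \<oplus>\<^bsub>T\<^esub> u) = k t \<oplus>\<^bsub>S\<^esub> k u"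
    and "\<And>m n. m \<in> carrier M \<Longrightarrow> n \<in> carrier N \<Longrightarrow> h (tn m n) = k (tn m n)"
    and "t \<in> carrier T"
  shows "h t = k t"
  using assms(7) by (induction t rule: tensor_induct) (simp_all add: assms)

end

subsection \<open>The universal property\<close>

locale balanced_map = tensor_product R M N + S?: abelian_group S
  for R :: "('r, 'e) ring_scheme" and M :: "('r, 'm, 'f) module_scheme" (structure)
    and N :: "('r, 'n, 'g) module_scheme" (structure)
    and S :: "('s, 'h) ring_scheme" (structure) +
  fixes b :: "'m \<Rightarrow> 'n \<Rightarrow> 's"
  assumes b_closed: "\<And>m n. m \<in> carrier M \<Longrightarrow> n \<in> carrier N \<Longrightarrow> b m n \<in> carrier S"
    and b_add_left: "\<And>m m' n. m \<in> carrier M \<Longrightarrow> m' \<in> carrier M \<Longrightarrow> n \<in> carrier N \<Longrightarrow>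
      b (m \<oplus>\<^bsub>M\<^esub> m') n = b m n \<oplus>\<^bsub>S\<^esub> b m' n"
    and b_add_right: "\<And>m n n'. m \<in> carrier M \<Longrightarrow> n \<in> carrier N \<Longrightarrow> n' \<in> carrier N \<Longrightarrow>
      b m (n \<oplus>\<^bsub>N\<^esub> n') = b m n \<oplus>\<^bsub>S\<^esub> b m n'"
    and b_smult: "\<And>r m n. r \<in> carrier R \<Longrightarrow> m \<in> carrier M \<Longrightarrow> n \<in> carrier N \<Longrightarrow>
      b (r \<odot>\<^bsub>M\<^esub> m) n = b m (r \<odot>\<^bsub>N\<^esub> n)"
begin

abbreviation "lift \<equiv> tensor_lift R M N S b"

text \<open>\<open>b\<close> extends additively to the free abelian group. Biadditivity and
  balancedness say exactly that the extension kills the three kinds of relators, so it factors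
  through the quotient by \<open>K\<close>.\<close>

lemma ex_lift: "\<exists>h. h \<in> carrier T \<rightarrow>\<^sub>E carrier S \<and>
     (\<forall>V \<in> carrier T. \<forall>W \<in> carrier T. h (V \<oplus>\<^bsub>T\<^esub> W) = h V \<oplus>\<^bsub>S\<^esub> h W) \<and>
     (\<forall>m \<in> carrier M. \<forall>n \<in> carrier N. h (tn m n) = b m n)"
proof -
  have "(\<lambda>(m, n). b m n) ` (carrier M \<times> carrier N) \<subseteq> carrier (add_monoid S)"
    by (auto simp: b_closed)
  then obtain h where h: "h \<in> hom F (add_monoid S)"
    and hb: "\<And>p. p \<in> carrier M \<times> carrier N \<Longrightarrow> h (frag_of p) = (\<lambda>(m, n). b m n) p"
    using comm_group.free_Abelian_group_universal[OF S.a_comm_group] by blast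
  interpret h: group_hom F "add_monoid S" h
    by (rule group_hom.intro) (simp_all add: S.add.group_axioms group_hom_axioms_def h)
  have h_closed: "u \<in> carrier F \<Longrightarrow> h u \<in> carrier S" for u
    using h.hom_closed by simp
  have h_diff: "h (u - v) = h u \<ominus>\<^bsub>S\<^esub> h v" if "u \<in> carrier F" "v \<in> carrier F" for u v
  proof -
    have uv: "u - v \<in> carrier F" using that by (auto dest: subsetD[OF keys_diff])
    have "h u = h (u - v) \<oplus>\<^bsub>S\<^esub> h v"
      using h.hom_mult[OF uv that(2)] by simp
    then show ?thesis
      using h_closed[OF uv] h_closed[OF that(1)] h_closed[OF that(2)]
      by (simp add: S.minus_eq S.add.m_assoc S.r_neg)
  qed
  have zero: "h u = \<zero>\<^bsub>S\<^esub>" if "u \<in> relators" for u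
  proof -
    have fr: "frag_of (m, n) - frag_of p \<in> carrier F"
      if "m \<in> carrier M" "n \<in> carrier N" "p \<in> carrier M \<times> carrier N" for m n p
      using that by (auto dest!: subsetD[OF keys_diff])
    have *: "h (frag_of (m \<oplus>\<^bsub>M\<^esub> m', n) - frag_of (m, n) - frag_of (m', n)) = \<zero>\<^bsub>S\<^esub>"
      if "m \<in> carrier M" "m' \<in> carrier M" "n \<in> carrier N" for m m' n
      using that fr[of "m \<oplus>\<^bsub>M\<^esub> m'" n "(m, n)"]
      by (simp add: h_diff hb b_add_left b_closed S.minus_eq S.add.m_ac S.r_neg S.r_neg1 S.r_neg2 del: carrier_free_Abelian_group_iff) 
    have **: "h (frag_of (m, n \<oplus>\<^bsub>N\<^esub> n') - frag_of (m, n) - frag_of (m, n')) = \<zero>\<^bsub>S\<^esub>"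
      if "m \<in> carrier M" "n \<in> carrier N" "n' \<in> carrier N" for m n n'
      using that fr[of m "n \<oplus>\<^bsub>N\<^esub> n'" "(m, n)"]
      by (simp add: h_diff hb b_add_right b_closed S.minus_eq S.add.m_ac S.r_neg S.r_neg1 S.r_neg2 del: carrier_free_Abelian_group_iff)
    show ?thesis
      using that unfolding relators_def
      by (auto simp: * **) (simp add: h_diff hb b_smult b_closed smult_M smult_N S.minus_eq S.r_neg)
  qed
  have hK: "h u = \<zero>\<^bsub>S\<^esub>" if "u \<in> K" for u
    using that unfolding K_generate
  proof (induction u rule: generate.induct)
    case one
    show ?case using h.hom_one by simp
  next
    case (inv u)
    then have "u \<in> carrier F" using relators_closed by blast
    then show ?case using inv h.hom_inv[of u] by (simp add: zero S.add.inv_one)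
  next
    case (eng u v)
    then have "u \<in> carrier F" "v \<in> carrier F"
      using subgroup.mem_carrier[OF K_subgroup] unfolding K_generate by blast+
    then show ?case using eng h.hom_mult[of u v] by simp
  qed (rule zero)
  have inv: "h u = h v" if uv: "u \<in> carrier F" "v \<in> carrier F" "K #>\<^bsub>F\<^esub> u = K #>\<^bsub>F\<^esub> v" for u v
  proof -
    have "u \<in> K #>\<^bsub>F\<^esub> v"
      using uv group.rcos_self[OF group_free_Abelian_group _ K_subgroup] by metis
    then obtain k where k: "k \<in> K" "u = k + v" by (auto simp: r_coset_def)
    then show ?thesis
      using h.hom_mult[of k v] hK[OF k(1)] subgroup.mem_carrier[OF K_subgroup k(1)] uv h_closed
      by simp
  qed
  from FactGroup_universal[OF h K_normal inv] obtain g where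
    g: "g \<in> hom (F Mod K) (add_monoid S)" and gh: "\<And>u. u \<in> carrier F \<Longrightarrow> g (K #>\<^bsub>F\<^esub> u) = h u"
    by metis
  have g': "g \<in> hom (add_monoid T) (add_monoid S)" using g by (simp add: hom_def tensor_Mod)
  \<comment> \<open>\<open>tensor_lift\<close> is a definite description, and only a fixed value
    outside the carrier makes the map unique.\<close>
  let ?g = "restrict g (carrier T)"
  show ?thesis
  proof (intro exI[of _ ?g] conjI ballI)
    show "?g \<in> carrier T \<rightarrow>\<^sub>E carrier S" using g' by (auto simp: hom_def)
    show "?g (V \<oplus>\<^bsub>T\<^esub> W) = ?g V \<oplus>\<^bsub>S\<^esub> ?g W" if "V \<in> carrier T" "W \<in> carrier T" for V W
      using that hom_mult[OF g', of V W] by simp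
    show "?g (tn m n) = b m n" if "m \<in> carrier M" "n \<in> carrier N" for m n
      using that gh[of "frag_of (m, n)"] by (simp add: hb) (simp add: tens_def)
  qed
qed

text \<open>Justifies the description in \<open>tensor_lift\<close>: existence is
  \<open>ex_lift\<close>, and uniqueness holds because pure tensors generate additively.\<close>

lemma lift_props: "lift \<in> carrier T \<rightarrow>\<^sub>E carrier S \<and>
     (\<forall>V \<in> carrier T. \<forall>W \<in> carrier T. lift (V \<oplus>\<^bsub>T\<^esub> W) = lift V \<oplus>\<^bsub>S\<^esub> lift W) \<and>
     (\<forall>m \<in> carrier M. \<forall>n \<in> carrier N. lift (tn m n) = b m n)"
  unfolding tensor_lift_def
proof (rule theI'[of "\<lambda>h. h \<in> carrier T \<rightarrow>\<^sub>E carrier S \<and>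
     (\<forall>V \<in> carrier T. \<forall>W \<in> carrier T. h (V \<oplus>\<^bsub>T\<^esub> W) = h V \<oplus>\<^bsub>S\<^esub> h W) \<and>
     (\<forall>m \<in> carrier M. \<forall>n \<in> carrier N. h (tn m n) = b m n)"], rule ex_ex1I[OF ex_lift])
  fix h k
  assume h: "h \<in> carrier T \<rightarrow>\<^sub>E carrier S \<and>
     (\<forall>V \<in> carrier T. \<forall>W \<in> carrier T. h (V \<oplus>\<^bsub>T\<^esub> W) = h V \<oplus>\<^bsub>S\<^esub> h W) \<and>
     (\<forall>m \<in> carrier M. \<forall>n \<in> carrier N. h (tn m n) = b m n)"
    and k: "k \<in> carrier T \<rightarrow>\<^sub>E carrier S \<and>
     (\<forall>V \<in> carrier T. \<forall>W \<in> carrier T. k (V \<oplus>\<^bsub>T\<^esub> W) = k V \<oplus>\<^bsub>S\<^esub> k W) \<and>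
     (\<forall>m \<in> carrier M. \<forall>n \<in> carrier N. k (tn m n) = b m n)"
  show "h = k"
  proof (rule PiE_ext)
    fix t assume "t \<in> carrier T"
    then show "h t = k t"
    proof (rule additive_eq[OF S.abelian_group_axioms, of h k, rotated -1])
      show "h \<in> carrier T \<rightarrow> carrier S" "k \<in> carrier T \<rightarrow> carrier S"
        using conjunct1[OF h] conjunct1[OF k] by auto
      show "h (V \<oplus>\<^bsub>T\<^esub> W) = h V \<oplus>\<^bsub>S\<^esub> h W" if "V \<in> carrier T" "W \<in> carrier T" for V W
        using conjunct2[OF h] that by blast
      show "k (V \<oplus>\<^bsub>T\<^esub> W) = k V \<oplus>\<^bsub>S\<^esub> k W" if "V \<in> carrier T" "W \<in> carrier T" for V W
        using conjunct2[OF k] that by blast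
      show "h (tn m n) = k (tn m n)" if "m \<in> carrier M" "n \<in> carrier N" for m n
        using conjunct2[OF conjunct2[OF h]] conjunct2[OF conjunct2[OF k]] that by metis
    qed
  qed (rule conjunct1[OF h], rule conjunct1[OF k])
qed

lemma lift_closed: "t \<in> carrier T \<Longrightarrow> lift t \<in> carrier S"
  using lift_props by auto

lemma lift_add: "t \<in> carrier T \<Longrightarrow> u \<in> carrier T \<Longrightarrow> lift (t \<oplus>\<^bsub>T\<^esub> u) = lift t \<oplus>\<^bsub>S\<^esub> lift u"
  using lift_props by blast

lemma lift_tens: "m \<in> carrier M \<Longrightarrow> n \<in> carrier N \<Longrightarrow> lift (tn m n) = b m n"
  using lift_props by blast

end

subsection \<open>Tensor products of algebras\<close>

locale tensor_algebra = M?: cring M + N?: cring N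
  for R :: "('r, 'e) ring_scheme" and M :: "('r, 'm, 'f) module_scheme" (structure)
    and N :: "('r, 'n, 'g) module_scheme" (structure) +
  assumes alg_smult_M: "\<And>r m. r \<in> carrier R \<Longrightarrow> m \<in> carrier M \<Longrightarrow> r \<odot>\<^bsub>M\<^esub> m \<in> carrier M"
    and alg_smult_N: "\<And>r n. r \<in> carrier R \<Longrightarrow> n \<in> carrier N \<Longrightarrow> r \<odot>\<^bsub>N\<^esub> n \<in> carrier N"
    and smult_mult_M: "\<And>r m m'. r \<in> carrier R \<Longrightarrow> m \<in> carrier M \<Longrightarrow> m' \<in> carrier M \<Longrightarrow>
      m' \<otimes>\<^bsub>M\<^esub> (r \<odot>\<^bsub>M\<^esub> m) = r \<odot>\<^bsub>M\<^esub> (m' \<otimes>\<^bsub>M\<^esub> m)"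
    and smult_mult_N: "\<And>r n n'. r \<in> carrier R \<Longrightarrow> n \<in> carrier N \<Longrightarrow> n' \<in> carrier N \<Longrightarrow>
      n' \<otimes>\<^bsub>N\<^esub> (r \<odot>\<^bsub>N\<^esub> n) = r \<odot>\<^bsub>N\<^esub> (n' \<otimes>\<^bsub>N\<^esub> n)"
begin

sublocale tensor_product R M N
  by unfold_locales (simp_all add: alg_smult_M alg_smult_N)

definition fmult :: "('m \<times> 'n \<Rightarrow>\<^sub>0 int) \<Rightarrow> ('m \<times> 'n \<Rightarrow>\<^sub>0 int) \<Rightarrow> 'm \<times> 'n \<Rightarrow>\<^sub>0 int" where
  "fmult u v = frag_extend (\<lambda>(m, n). frag_extend
          (\<lambda>(m', n'). frag_of (m \<otimes>\<^bsub>M\<^esub> m', n \<otimes>\<^bsub>N\<^esub> n')) v) u"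

text \<open>The monoid ring \<open>\<int>[M \<times> N]\<close>, of which the tensor product of algebras is the quotient by \<open>K\<close>.\<close>

definition FR :: "('m \<times> 'n \<Rightarrow>\<^sub>0 int) ring" where
  "FR = \<lparr>carrier = {u. Poly_Mapping.keys u \<subseteq> carrier M \<times> carrier N}, monoid.mult = fmult,
     one = frag_of (\<one>\<^bsub>M\<^esub>, \<one>\<^bsub>N\<^esub>), ring.zero = 0, add = (+)\<rparr>"

lemma fmult_diff_left: "fmult (u - v) w = fmult u w - fmult v w"
  by (simp add: fmult_def frag_extend_diff)

lemma fmult_add_left: "fmult (u + v) w = fmult u w + fmult v w"
  by (simp add: fmult_def frag_extend_add)

lemma fmult_diff_right: "fmult w (u - v) = fmult w u - fmult w v"
proof -
  have *: "frag_cmul k (a - b) = frag_cmul k a - frag_cmul k b" for k and a b :: "'m \<times> 'n \<Rightarrow>\<^sub>0 int"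
    by (simp add: right_diff_distrib lookup_minus poly_mapping_eqI)
  show ?thesis
    by (simp add: fmult_def frag_extend_diff)
      (simp add: frag_extend_def case_prod_beta * sum_subtractf)
qed

lemma fmult_0_left [simp]: "fmult 0 u = 0"
  by (simp add: fmult_def)

lemma fmult_0_right [simp]: "fmult u 0 = 0"
  using fmult_diff_right[of u 0 0] by simp

lemma fmult_of: "fmult (frag_of p) (frag_of q) =
    frag_of (fst p \<otimes>\<^bsub>M\<^esub> fst q, snd p \<otimes>\<^bsub>N\<^esub> snd q)"
  by (simp add: fmult_def case_prod_beta)

lemma fmult_closed:
  assumes "Poly_Mapping.keys u \<subseteq> carrier M \<times> carrier N" "Poly_Mapping.keys v \<subseteq> carrier M \<times> carrier N"
  shows "Poly_Mapping.keys (fmult u v) \<subseteq> carrier M \<times> carrier N"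
proof -
  have "Poly_Mapping.keys (fmult u v) \<subseteq> (\<Union>p\<in>Poly_Mapping.keys u. \<Union>q\<in>Poly_Mapping.keys v.
    {(fst p \<otimes>\<^bsub>M\<^esub> fst q, snd p \<otimes>\<^bsub>N\<^esub> snd q)})"
    unfolding fmult_def
    by (rule order_trans[OF keys_frag_extend], rule UN_mono[OF order_refl],
        unfold case_prod_beta, rule order_trans[OF keys_frag_extend]) auto
  also have "\<dots> \<subseteq> carrier M \<times> carrier N"
  proof (intro UN_least)
    fix p q assume "p \<in> Poly_Mapping.keys u" "q \<in> Poly_Mapping.keys v"
    with assms have "p \<in> carrier M \<times> carrier N" "q \<in> carrier M \<times> carrier N" by blast+
    then show "{(fst p \<otimes>\<^bsub>M\<^esub> fst q, snd p \<otimes>\<^bsub>N\<^esub> snd q)} \<subseteq> carrier M \<times> carrier N" by auto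
  qed
  finally show ?thesis .
qed

lemma fmult_comm:
  assumes u: "Poly_Mapping.keys u \<subseteq> carrier M \<times> carrier N"
    and v: "Poly_Mapping.keys v \<subseteq> carrier M \<times> carrier N"
  shows "fmult u v = fmult v u"
  using u
proof (induction u rule: frag_group_induct)
  case (frag_of p)
  show ?case
    using v by (induction v rule: frag_group_induct)
      (use frag_of in \<open>auto simp: fmult_of fmult_diff_left fmult_diff_right M.m_comm N.m_comm\<close>)
qed (simp_all add: fmult_diff_left fmult_diff_right)

lemma fmult_assoc:
  assumes u: "Poly_Mapping.keys u \<subseteq> carrier M \<times> carrier N"
    and v: "Poly_Mapping.keys v \<subseteq> carrier M \<times> carrier N"
    and w: "Poly_Mapping.keys w \<subseteq> carrier M \<times> carrier N"
  shows "fmult (fmult u v) w = fmult u (fmult v w)"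
  using u
proof (induction u rule: frag_group_induct)
  case (frag_of p)
  show ?case
    using v
  proof (induction v rule: frag_group_induct)
    case (frag_of q)
    show ?case
      using w by (induction w rule: frag_group_induct)
        (use frag_of \<open>p \<in> _\<close> in \<open>auto simp: fmult_of fmult_diff_left fmult_diff_right M.m_assoc N.m_assoc\<close>)
  qed (simp_all add: fmult_diff_left fmult_diff_right)
qed (simp_all add: fmult_diff_left fmult_diff_right)

lemma FR_cring: "cring FR"
proof (rule cringI)
  have "add_monoid FR = F" by (simp add: FR_def free_Abelian_group_def)
  then show "abelian_group FR"
    by (intro comm_group_abelian_groupI) (simp add: abelian_free_Abelian_group)
  show "Group.comm_monoid FR"
  proof (rule comm_monoidI)
    fix u assume "u \<in> carrier FR"
    then have "Poly_Mapping.keys u \<subseteq> carrier M \<times> carrier N" by (simp add: FR_def)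
    then have "fmult (frag_of (\<one>\<^bsub>M\<^esub>, \<one>\<^bsub>N\<^esub>)) u = u"
      by (induction u rule: frag_group_induct)
        (auto simp: fmult_of fmult_diff_left fmult_diff_right)
    then show "\<one>\<^bsub>FR\<^esub> \<otimes>\<^bsub>FR\<^esub> u = u" by (simp add: FR_def)
  qed (simp_all add: FR_def fmult_assoc fmult_closed, rule fmult_comm)
qed (simp add: FR_def fmult_add_left)

text \<open>A generator of the monoid ring times a relator is a relator of the same kind, by
  distributivity or by the compatibility of scalars with products. The rest follows since
  \<open>K\<close> is closed under sums and inverses.\<close>

lemma K_absorb:
  assumes k: "k \<in> K" and u: "Poly_Mapping.keys u \<subseteq> carrier M \<times> carrier N"
  shows "fmult u k \<in> K"
  using u
proof (induction u rule: frag_group_induct)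
  case zero
  then show ?case using subgroup.one_closed[OF K_subgroup] by simp
next
  case (diff u v)
  have "x - y \<in> K" if "x \<in> K" "y \<in> K" for x y
    using subgroup.m_closed[OF K_subgroup that(1) subgroup.m_inv_closed[OF K_subgroup that(2)]]
      subgroup.mem_carrier[OF K_subgroup that(2)]
    by simp
  with diff show ?case by (simp add: fmult_diff_left)
next
  case (frag_of p)
  obtain m n where p: "p = (m, n)" by force
  with frag_of have mn: "m \<in> carrier M" "n \<in> carrier N" by auto
  have rel: "fmult (frag_of (m, n)) h \<in> relators" if "h \<in> relators" for h
    using that unfolding relators_def
  proof (elim UnE, goal_cases)
    case 1
    then obtain a b c where "h = frag_of (a \<oplus>\<^bsub>M\<^esub> b, c) - frag_of (a, c) - frag_of (b, c)"
      "a \<in> carrier M" "b \<in> carrier M" "c \<in> carrier N" by blast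
    moreover from this mn have "fmult (frag_of (m, n)) h =
        frag_of (m \<otimes>\<^bsub>M\<^esub> a \<oplus>\<^bsub>M\<^esub> m \<otimes>\<^bsub>M\<^esub> b, n \<otimes>\<^bsub>N\<^esub> c) - frag_of (m \<otimes>\<^bsub>M\<^esub> a, n \<otimes>\<^bsub>N\<^esub> c)
          - frag_of (m \<otimes>\<^bsub>M\<^esub> b, n \<otimes>\<^bsub>N\<^esub> c)"
      by (simp add: fmult_diff_right fmult_of M.r_distr)
    ultimately show ?case using mn by blast
  next
    case 2
    then obtain a b c where "h = frag_of (a, b \<oplus>\<^bsub>N\<^esub> c) - frag_of (a, b) - frag_of (a, c)"
      "a \<in> carrier M" "b \<in> carrier N" "c \<in> carrier N" by blast
    moreover from this mn have "fmult (frag_of (m, n)) h =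
        frag_of (m \<otimes>\<^bsub>M\<^esub> a, n \<otimes>\<^bsub>N\<^esub> b \<oplus>\<^bsub>N\<^esub> n \<otimes>\<^bsub>N\<^esub> c) - frag_of (m \<otimes>\<^bsub>M\<^esub> a, n \<otimes>\<^bsub>N\<^esub> b)
          - frag_of (m \<otimes>\<^bsub>M\<^esub> a, n \<otimes>\<^bsub>N\<^esub> c)"
      by (simp add: fmult_diff_right fmult_of N.r_distr)
    ultimately show ?case using mn by blast
  next
    case 3
    then obtain r a b where h: "h = frag_of (r \<odot>\<^bsub>M\<^esub> a, b) - frag_of (a, r \<odot>\<^bsub>N\<^esub> b)"
      "r \<in> carrier R" "a \<in> carrier M" "b \<in> carrier N" by blast
    with mn have "fmult (frag_of (m, n)) h =
        frag_of (r \<odot>\<^bsub>M\<^esub> (m \<otimes>\<^bsub>M\<^esub> a), n \<otimes>\<^bsub>N\<^esub> b) - frag_of (m \<otimes>\<^bsub>M\<^esub> a, r \<odot>\<^bsub>N\<^esub> (n \<otimes>\<^bsub>N\<^esub> b))"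
      by (simp add: fmult_diff_right fmult_of smult_mult_M smult_mult_N)
    with h(2-) mn show ?case by blast
  qed
  show ?case
    using k unfolding K_generate p
  proof (induction k rule: generate.induct)
    case one
    show ?case using generate.one[of F] by simp
  next
    case (incl h)
    then show ?case by (intro generate.incl rel)
  next
    case (inv h)
    then have "h \<in> carrier F" "fmult (frag_of (m, n)) h \<in> carrier F"
      using relators_closed rel by blast+
    then have "fmult (frag_of (m, n)) (inv\<^bsub>F\<^esub> h) = inv\<^bsub>F\<^esub> (fmult (frag_of (m, n)) h)"
      using fmult_diff_right[of "frag_of (m, n)" 0 h] by simp
    then show ?case using generate.inv[OF rel[OF inv]] by simp
  next
    case (eng h1 h2)
    then show ?case
      using generate.eng[OF eng.IH] fmult_diff_right[of "frag_of (m, n)" h1 "- h2"]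
        fmult_diff_right[of "frag_of (m, n)" 0 h2] by simp
  qed
qed

lemma K_ideal: "ideal K FR"
proof (rule idealI)
  show "ring FR" using FR_cring by (rule cring.axioms)
  have "add_monoid FR = F" by (simp add: FR_def free_Abelian_group_def)
  then show "subgroup K (add_monoid FR)" using K_subgroup by simp
  fix k u assume ku: "k \<in> K" "u \<in> carrier FR"
  then have u: "Poly_Mapping.keys u \<subseteq> carrier M \<times> carrier N" by (simp add: FR_def)
  have k: "Poly_Mapping.keys k \<subseteq> carrier M \<times> carrier N"
    using subgroup.mem_carrier[OF K_subgroup ku(1)] by simp
  show "u \<otimes>\<^bsub>FR\<^esub> k \<in> K" "k \<otimes>\<^bsub>FR\<^esub> u \<in> K"
    using K_absorb[OF ku(1) u] fmult_comm[OF k u] by (simp_all add: FR_def)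
qed

text \<open>The product in \<open>tensor\<close>, a union of cosets over all representatives, is
  word for word the product of a quotient ring. Hence the ring axioms need no separate choice of
  representatives.\<close>

lemma tensor_Quot:
  "carrier T = carrier (FR Quot K)" "monoid.mult T = monoid.mult (FR Quot K)"
  "\<one>\<^bsub>T\<^esub> = \<one>\<^bsub>FR Quot K\<^esub>" "\<zero>\<^bsub>T\<^esub> = \<zero>\<^bsub>FR Quot K\<^esub>" "add T = add (FR Quot K)"
proof -
  have F: "\<lparr>carrier = carrier FR, monoid.mult = add FR, one = \<zero>\<^bsub>FR\<^esub>\<rparr> = F"
    by (simp add: FR_def free_Abelian_group_def)
  have mult: "monoid.mult FR = fmult" and one: "\<one>\<^bsub>FR\<^esub> = frag_of (\<one>\<^bsub>M\<^esub>, \<one>\<^bsub>N\<^esub>)"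
    by (simp_all add: FR_def)
  show "carrier T = carrier (FR Quot K)" "\<zero>\<^bsub>T\<^esub> = \<zero>\<^bsub>FR Quot K\<^esub>"
    by (simp_all add: tensor_def Let_def FactRing_def A_RCOSETS_def F)
  show "add T = add (FR Quot K)"
    by (simp add: tensor_def Let_def FactRing_def set_add_def F fun_eq_iff)
  show "\<one>\<^bsub>T\<^esub> = \<one>\<^bsub>FR Quot K\<^esub>"
    by (simp add: tensor_def Let_def FactRing_def a_r_coset_def F one tens_def)
  show "monoid.mult T = monoid.mult (FR Quot K)"
    by (simp add: tensor_def Let_def FactRing_def rcoset_mult_def a_r_coset_def F mult fmult_def fun_eq_iff)
qed

lemma tensor_cring: "cring T"
  using ideal.quotient_is_cring[OF K_ideal FR_cring] tensor_Quot by (rule cring_cong)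

lemma tens_mult:
  assumes "m \<in> carrier M" "n \<in> carrier N" "m' \<in> carrier M" "n' \<in> carrier N"
  shows "tn m n \<otimes>\<^bsub>T\<^esub> tn m' n' = tn (m \<otimes>\<^bsub>M\<^esub> m') (n \<otimes>\<^bsub>N\<^esub> n')"
proof -
  have F: "\<lparr>carrier = carrier FR, monoid.mult = add FR, one = \<zero>\<^bsub>FR\<^esub>\<rparr> = F"
    by (simp add: FR_def free_Abelian_group_def)
  have "(K +>\<^bsub>FR\<^esub> frag_of (m, n)) \<otimes>\<^bsub>FR Quot K\<^esub> (K +>\<^bsub>FR\<^esub> frag_of (m', n')) =
    K +>\<^bsub>FR\<^esub> fmult (frag_of (m, n)) (frag_of (m', n'))"
    using ideal.rcoset_mult_add[OF K_ideal, of "frag_of (m, n)" "frag_of (m', n')"] assms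
    by (simp add: FactRing_def FR_def)
  then show ?thesis
    by (simp add: tensor_Quot(2) tens_def fmult_of a_r_coset_def F)
qed

lemma tens_one: "\<one>\<^bsub>T\<^esub> = tn \<one>\<^bsub>M\<^esub> \<one>\<^bsub>N\<^esub>"
  by (simp add: tensor_def Let_def)

end

subsection \<open>Modules with a finite basis\<close>

text \<open>A finite basis of \<open>N\<close> together with its coordinate functionals
  \<open>c\<close>: independence is encoded by \<open>c_e\<close> and linearity, generation by
  \<open>expand\<close>. The bases of \<open>Omega\<close> and P_(1) arise in this form, with
  coordinates read off in an explicit ring.\<close>

locale tensor_basis = M?: module A M + N?: module A N
  for A :: "('a, 'e) ring_scheme" (structure) and M :: "('a, 'm, 'f) module_scheme" (structure)
    and N :: "('a, 'n, 'g) module_scheme" (structure) +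
  fixes I :: "'i set" and e :: "'i \<Rightarrow> 'n" and c :: "'i \<Rightarrow> 'n \<Rightarrow> 'a"
  assumes finite_I: "finite I"
    and e_closed: "\<And>i. i \<in> I \<Longrightarrow> e i \<in> carrier N"
    and c_closed: "\<And>i n. i \<in> I \<Longrightarrow> n \<in> carrier N \<Longrightarrow> c i n \<in> carrier A"
    and c_add: "\<And>i n n'. i \<in> I \<Longrightarrow> n \<in> carrier N \<Longrightarrow> n' \<in> carrier N \<Longrightarrow>
      c i (n \<oplus>\<^bsub>N\<^esub> n') = c i n \<oplus>\<^bsub>A\<^esub> c i n'"
    and c_smult: "\<And>i a n. i \<in> I \<Longrightarrow> a \<in> carrier A \<Longrightarrow> n \<in> carrier N \<Longrightarrow>
      c i (a \<odot>\<^bsub>N\<^esub> n) = a \<otimes>\<^bsub>A\<^esub> c i n"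
    and c_e: "\<And>i j. i \<in> I \<Longrightarrow> j \<in> I \<Longrightarrow> c i (e j) = (if i = j then \<one>\<^bsub>A\<^esub> else \<zero>\<^bsub>A\<^esub>)"
    and expand: "\<And>n. n \<in> carrier N \<Longrightarrow> n = (\<Oplus>\<^bsub>N\<^esub>i\<in>I. c i n \<odot>\<^bsub>N\<^esub> e i)"
begin

sublocale tensor_product A M N
  by unfold_locales (simp_all add: M.smult_closed N.smult_closed)

text \<open>The component with index \<open>i\<close> of the isomorphism between M (x) N and the
  families in M indexed by \<open>I\<close>.\<close>

definition coord :: "'i \<Rightarrow> ('m \<times> 'n \<Rightarrow>\<^sub>0 int) set \<Rightarrow> 'm" where
  "coord i = tensor_lift A M N M (\<lambda>m n. c i n \<odot>\<^bsub>M\<^esub> m)"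

lemma coord_balanced: "i \<in> I \<Longrightarrow> balanced_map A M N M (\<lambda>m n. c i n \<odot>\<^bsub>M\<^esub> m)"
  by unfold_locales
    (simp_all add: c_closed c_add c_smult M.smult_l_distr M.smult_r_distr R.m_comm flip: M.smult_assoc1)

lemma coord_closed: "i \<in> I \<Longrightarrow> t \<in> carrier T \<Longrightarrow> coord i t \<in> carrier M"
  unfolding coord_def by (rule balanced_map.lift_closed[OF coord_balanced])

lemma coord_add: "i \<in> I \<Longrightarrow> t \<in> carrier T \<Longrightarrow> u \<in> carrier T \<Longrightarrow>
    coord i (t \<oplus>\<^bsub>T\<^esub> u) = coord i t \<oplus>\<^bsub>M\<^esub> coord i u"
  unfolding coord_def by (rule balanced_map.lift_add[OF coord_balanced])

lemma coord_tens: "i \<in> I \<Longrightarrow> m \<in> carrier M \<Longrightarrow> n \<in> carrier N \<Longrightarrow> coord i (tn m n) = c i n \<odot>\<^bsub>M\<^esub> m"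
  unfolding coord_def by (rule balanced_map.lift_tens[OF coord_balanced])

text \<open>On a pure tensor, expand the second factor in the basis and move each coefficient across
  the tensor sign; both sides are additive.\<close>

lemma tensor_expand:
  assumes "t \<in> carrier T"
  shows "t = (\<Oplus>\<^bsub>T\<^esub>i\<in>I. tn (coord i t) (e i))"
  using assms
proof (induction t rule: tensor_induct)
  case (tens m n)
  have "tn m n = tn m (\<Oplus>\<^bsub>N\<^esub>i\<in>I. c i n \<odot>\<^bsub>N\<^esub> e i)"
    using expand[OF tens(2)] by simp
  also have "\<dots> = (\<Oplus>\<^bsub>T\<^esub>i\<in>I. tn m (c i n \<odot>\<^bsub>N\<^esub> e i))"
    using tens by (intro tens_finsum_right) (auto simp: e_closed c_closed)
  also have "\<dots> = (\<Oplus>\<^bsub>T\<^esub>i\<in>I. tn (coord i (tn m n)) (e i))"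
    using tens by (intro T.finsum_cong')
      (auto simp: e_closed c_closed coord_tens simp flip: tens_smult)
  finally show ?case .
next
  case (add t u)
  have "(\<Oplus>\<^bsub>T\<^esub>i\<in>I. tn (coord i (t \<oplus>\<^bsub>T\<^esub> u)) (e i)) =
      (\<Oplus>\<^bsub>T\<^esub>i\<in>I. tn (coord i t) (e i) \<oplus>\<^bsub>T\<^esub> tn (coord i u) (e i))"
    using add(1,2) by (intro T.finsum_cong')
      (auto simp: e_closed coord_add coord_closed tens_add_left)
  also have "\<dots> = (\<Oplus>\<^bsub>T\<^esub>i\<in>I. tn (coord i t) (e i)) \<oplus>\<^bsub>T\<^esub> (\<Oplus>\<^bsub>T\<^esub>i\<in>I. tn (coord i u) (e i))"
    using add(1,2) by (intro T.finsum_addf) (auto simp: e_closed coord_closed)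
  also have "\<dots> = t \<oplus>\<^bsub>T\<^esub> u" using add by simp
  finally show ?case by simp
qed

lemma tensor_eqI:
  assumes "t \<in> carrier T" "u \<in> carrier T" "\<And>i. i \<in> I \<Longrightarrow> coord i t = coord i u"
  shows "t = u"
proof -
  have "(\<Oplus>\<^bsub>T\<^esub>i\<in>I. tn (coord i t) (e i)) = (\<Oplus>\<^bsub>T\<^esub>i\<in>I. tn (coord i u) (e i))"
    using assms by (intro T.finsum_cong') (auto simp: e_closed coord_closed)
  with tensor_expand[OF assms(1)] tensor_expand[OF assms(2)] show ?thesis by simp
qed

lemma coord_finsum:
  assumes "i \<in> I" "f \<in> J \<rightarrow> carrier T"
  shows "coord i (\<Oplus>\<^bsub>T\<^esub>j\<in>J. f j) = (\<Oplus>\<^bsub>M\<^esub>j\<in>J. coord i (f j))"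
  by (rule additive_finsum[OF T.abelian_group_axioms M.M.abelian_group_axioms _ _ assms(2)])
    (use assms(1) in \<open>auto simp: coord_add coord_closed\<close>)

text \<open>Every family in M occurs as a family of coordinates. This is what allows arbitrary
  operators to define a map into M (x) Omega; injectivity is \<open>tensor_eqI\<close>.\<close>

lemma coord_expand:
  assumes "i \<in> I" "\<And>j. j \<in> I \<Longrightarrow> m j \<in> carrier M"
  shows "coord i (\<Oplus>\<^bsub>T\<^esub>j\<in>I. tn (m j) (e j)) = m i"
proof -
  have "coord i (\<Oplus>\<^bsub>T\<^esub>j\<in>I. tn (m j) (e j)) = (\<Oplus>\<^bsub>M\<^esub>j\<in>I. coord i (tn (m j) (e j)))"
    using assms by (intro coord_finsum) (auto simp: e_closed)
  also have "\<dots> = (\<Oplus>\<^bsub>M\<^esub>j\<in>I. if i = j then m j else \<zero>\<^bsub>M\<^esub>)"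
    using assms by (intro M.M.finsum_cong') (auto simp: coord_tens e_closed c_e)
  also have "\<dots> = m i"
    using assms finite_I by (intro M.M.add.finprod_singleton) auto
  finally show ?thesis .
qed

end

section \<open>Truncated twisted polynomial rings\<close>

lemma topologize_simps [simp]:
  "carrier (topologize B \<tau>) = carrier B" "monoid.mult (topologize B \<tau>) = monoid.mult B"
  "\<one>\<^bsub>topologize B \<tau>\<^esub> = \<one>\<^bsub>B\<^esub>" "\<zero>\<^bsub>topologize B \<tau>\<^esub> = \<zero>\<^bsub>B\<^esub>" "add (topologize B \<tau>) = add B"
  by (simp_all add: topologize_def)

lemma a_r_coset_topologize: "I +>\<^bsub>topologize B \<tau>\<^esub> a = I +>\<^bsub>B\<^esub> a"
  by (simp add: a_r_coset_def r_coset_def)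

lemma Quot_topologize: "topologize B \<tau> Quot I = B Quot I"
  by (simp add: FactRing_def A_RCOSETS_def RCOSETS_def r_coset_def set_add_def set_mult_def
    rcoset_mult_def a_r_coset_topologize fun_eq_iff)

lemma ring_hom_cong:
  assumes "carrier S = carrier S'" "monoid.mult S = monoid.mult S'" "\<one>\<^bsub>S\<^esub> = \<one>\<^bsub>S'\<^esub>" "add S = add S'"
  shows "ring_hom R S = ring_hom R S'"
  using assms by (simp add: ring_hom_def)

lemma ring_hom_cong_dom:
  assumes "carrier S = carrier S'" "monoid.mult S = monoid.mult S'" "\<one>\<^bsub>S\<^esub> = \<one>\<^bsub>S'\<^esub>" "add S = add S'"
  shows "ring_hom S R = ring_hom S' R"
  using assms by (simp add: ring_hom_def)

lemma ring_hom_cringI': "cring R \<Longrightarrow> cring S \<Longrightarrow> h \<in> ring_hom R S \<Longrightarrow> ring_hom_cring R S h"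
  by (simp add: ring_hom_cring_def ring_hom_cring_axioms_def)

lemma (in comm_monoid) finprod_pair:
  assumes "a \<noteq> b" "f a \<in> carrier G" "f b \<in> carrier G"
  shows "(\<Otimes>i\<in>{a, b}. f i) = f a \<otimes> f b"
  using assms finprod_insert[of "{b}" a f] finprod_insert[of "{}" b f] by simp

lemma (in cring) finprod_zeroI:
  assumes "finite I" "f \<in> I \<rightarrow> carrier R" "i \<in> I" "f i = \<zero>"
  shows "(\<Otimes>i\<in>I. f i) = \<zero>"
proof -
  have "(\<Otimes>i\<in>insert i (I - {i}). f i) = f i \<otimes> (\<Otimes>i\<in>I - {i}. f i)"
    using assms by (intro finprod_insert) auto
  moreover have "(\<Otimes>i\<in>I - {i}. f i) \<in> carrier R"
    using assms by (intro finprod_closed) auto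
  ultimately show ?thesis using assms by (simp add: insert_absorb)
qed

text \<open>\<open>induced\<close> extracts the element of the image of a coset, and that image is a
  singleton because \<open>h\<close> vanishes on the ideal.\<close>

lemma induced_coset:
  assumes I: "ideal I S" and h: "ring_hom_ring S B h" and z: "\<And>u. u \<in> I \<Longrightarrow> h u = \<zero>\<^bsub>B\<^esub>"
    and p: "p \<in> carrier S"
  shows "induced h (I +>\<^bsub>S\<^esub> p) = h p"
proof -
  interpret I: ideal I S by fact
  interpret h: ring_hom_ring S B h by fact
  have "h ` (I +>\<^bsub>S\<^esub> p) = {h p}"
  proof (intro equalityI subsetI)
    fix y assume "y \<in> h ` (I +>\<^bsub>S\<^esub> p)"
    then obtain u where "u \<in> I" "y = h (u \<oplus>\<^bsub>S\<^esub> p)"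
      by (auto simp: a_r_coset_def r_coset_def)
    then show "y \<in> {h p}" using p z I.a_Hcarr by simp
  next
    fix y assume "y \<in> {h p}"
    then show "y \<in> h ` (I +>\<^bsub>S\<^esub> p)" using I.a_rcos_self[OF p] by auto
  qed
  then show ?thesis by (simp add: induced_def)
qed

lemma induced_ring_hom:
  assumes I: "ideal I S" and h: "ring_hom_ring S B h" and z: "\<And>u. u \<in> I \<Longrightarrow> h u = \<zero>\<^bsub>B\<^esub>"
  shows "induced h \<in> ring_hom (S Quot I) B"
proof -
  interpret I: ideal I S by fact
  interpret h: ring_hom_ring S B h by fact
  interpret q: ring_hom_ring S "S Quot I" "(+>\<^bsub>S\<^esub>) I" by (rule I.rcos_ring_hom_ring)
  note ind = induced_coset[OF I h z]
  have carr: "\<exists>p\<in>carrier S. V = I +>\<^bsub>S\<^esub> p" if "V \<in> carrier (S Quot I)" for V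
    using that by (auto simp: FactRing_def A_RCOSETS_def RCOSETS_def a_r_coset_def)
  show ?thesis
  proof (rule ring_hom_memI)
    fix V assume "V \<in> carrier (S Quot I)"
    then show "induced h V \<in> carrier B" using ind by (auto dest!: carr)
  next
    fix V W assume "V \<in> carrier (S Quot I)" "W \<in> carrier (S Quot I)"
    then obtain v w where vw: "v \<in> carrier S" "V = I +>\<^bsub>S\<^esub> v" "w \<in> carrier S" "W = I +>\<^bsub>S\<^esub> w"
      using carr by meson
    then show "induced h (V \<otimes>\<^bsub>S Quot I\<^esub> W) = induced h V \<otimes>\<^bsub>B\<^esub> induced h W"
      "induced h (V \<oplus>\<^bsub>S Quot I\<^esub> W) = induced h V \<oplus>\<^bsub>B\<^esub> induced h W"
      by (simp_all add: ind flip: q.hom_mult q.hom_add)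
  next
    show "induced h \<one>\<^bsub>S Quot I\<^esub> = \<one>\<^bsub>B\<^esub>"
      by (simp add: ind flip: q.hom_one)
  qed
qed

text \<open>Keeps the index in \<open>P 1\<close> from being rewritten to \<open>Suc 0\<close>,
  where facts stated with \<open>1\<close> would no longer match.\<close>

declare One_nat_def [simp del]

lemma lessThan_1: "{..<1::nat} = {0}"
  by auto

lemma funpow_one: "((f :: 'b \<Rightarrow> 'b) ^^ 1) a = f a"
  by (simp add: One_nat_def)

lemma lessThan_2: "{..<2::nat} = {0, 1}"
  by auto

locale twisted_ring = cring A for A :: "'a topring" (structure) +
  fixes d :: nat and \<sigma> :: "nat \<Rightarrow> 'a \<Rightarrow> 'a" and x :: "nat \<Rightarrow> 'a"
  assumes x_closed: "\<And>i. i < d \<Longrightarrow> x i \<in> carrier A"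
    and sigma_closed: "\<And>i a. i < d \<Longrightarrow> a \<in> carrier A \<Longrightarrow> \<sigma> i a \<in> carrier A"
begin

abbreviation "MP \<equiv> mpoly A d"
abbreviation "P n \<equiv> Psig A d \<sigma> x n"
abbreviation "pc n \<equiv> Pconst A d \<sigma> x n"
abbreviation "xi n \<equiv> Pxi A d \<sigma> x n"
abbreviation "J n \<equiv> Pideal A d \<sigma> x n"

sublocale MP: cring MP by (rule mpoly_cring)

lemma iter_closed: "i < d \<Longrightarrow> (\<sigma> i ^^ j) (x i) \<in> carrier A"
  by (induction j) (simp_all add: x_closed sigma_closed)

lemma twisted_factor_closed:
  "i < d \<Longrightarrow> indexed_var i \<oplus>\<^bsub>MP\<^esub> indexed_const (x i) \<ominus>\<^bsub>MP\<^esub> indexed_const ((\<sigma> i ^^ j) (x i)) \<in> carrier MP"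
  by (simp add: indexed_var_closed indexed_const_closed x_closed iter_closed)

lemma twisted_power_closed: "twisted_power A d \<sigma> x k \<in> carrier MP"
  unfolding twisted_power_def by (intro MP.finprod_closed funcsetI twisted_factor_closed) simp

text \<open>The defining relations are evaluated through this formula wherever they occur: in P_(n),
  where they hold, and under maps to A, to the explicit model and from A_0 to A, where their
  vanishing has to be shown.\<close>

lemma hom_twisted_power:
  assumes "ring_hom_cring MP B h"
  shows "h (twisted_power A d \<sigma> x k) = (\<Otimes>\<^bsub>B\<^esub>i\<in>{..<d}. \<Otimes>\<^bsub>B\<^esub>j\<in>{..<k i}.
    h (indexed_var i) \<oplus>\<^bsub>B\<^esub> h (indexed_const (x i)) \<ominus>\<^bsub>B\<^esub> h (indexed_const ((\<sigma> i ^^ j) (x i))))"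
proof -
  interpret h: ring_hom_cring MP B h by fact
  have *: "h (indexed_var i \<oplus>\<^bsub>MP\<^esub> indexed_const (x i) \<ominus>\<^bsub>MP\<^esub> indexed_const ((\<sigma> i ^^ j) (x i))) =
    h (indexed_var i) \<oplus>\<^bsub>B\<^esub> h (indexed_const (x i)) \<ominus>\<^bsub>B\<^esub> h (indexed_const ((\<sigma> i ^^ j) (x i)))" if "i < d" for i j
    using that by (simp add: MP.minus_eq h.S.minus_eq indexed_var_closed indexed_const_closed x_closed iter_closed)
  have cl: "h (indexed_var i) \<oplus>\<^bsub>B\<^esub> h (indexed_const (x i)) \<ominus>\<^bsub>B\<^esub> h (indexed_const ((\<sigma> i ^^ j) (x i))) \<in> carrier B"
    if "i < d" for i j
    using that by (simp add: indexed_var_closed indexed_const_closed x_closed iter_closed)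
  have "h (twisted_power A d \<sigma> x k) = (\<Otimes>\<^bsub>B\<^esub>i\<in>{..<d}. h (\<Otimes>\<^bsub>MP\<^esub>j\<in>{..<k i}.
     indexed_var i \<oplus>\<^bsub>MP\<^esub> indexed_const (x i) \<ominus>\<^bsub>MP\<^esub> indexed_const ((\<sigma> i ^^ j) (x i))))"
    unfolding twisted_power_def
    by (subst h.hom_finprod) (auto intro!: MP.finprod_closed twisted_factor_closed simp: o_def)
  also have "\<dots> = (\<Otimes>\<^bsub>B\<^esub>i\<in>{..<d}. \<Otimes>\<^bsub>B\<^esub>j\<in>{..<k i}.
    h (indexed_var i) \<oplus>\<^bsub>B\<^esub> h (indexed_const (x i)) \<ominus>\<^bsub>B\<^esub> h (indexed_const ((\<sigma> i ^^ j) (x i))))"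
  proof (rule h.S.finprod_cong')
    fix i assume i: "i \<in> {..<d}"
    then have "h (\<Otimes>\<^bsub>MP\<^esub>j\<in>{..<k i}. indexed_var i \<oplus>\<^bsub>MP\<^esub> indexed_const (x i) \<ominus>\<^bsub>MP\<^esub> indexed_const ((\<sigma> i ^^ j) (x i)))
      = (\<Otimes>\<^bsub>B\<^esub>j\<in>{..<k i}. h (indexed_var i \<oplus>\<^bsub>MP\<^esub> indexed_const (x i) \<ominus>\<^bsub>MP\<^esub> indexed_const ((\<sigma> i ^^ j) (x i))))"
      by (subst h.hom_finprod) (auto intro!: twisted_factor_closed simp: o_def)
    also have "\<dots> = (\<Otimes>\<^bsub>B\<^esub>j\<in>{..<k i}.
        h (indexed_var i) \<oplus>\<^bsub>B\<^esub> h (indexed_const (x i)) \<ominus>\<^bsub>B\<^esub> h (indexed_const ((\<sigma> i ^^ j) (x i))))"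
      using i by (intro h.S.finprod_cong') (auto simp: * cl)
    finally show "h (\<Otimes>\<^bsub>MP\<^esub>j\<in>{..<k i}. indexed_var i \<oplus>\<^bsub>MP\<^esub> indexed_const (x i) \<ominus>\<^bsub>MP\<^esub> indexed_const ((\<sigma> i ^^ j) (x i)))
      = (\<Otimes>\<^bsub>B\<^esub>j\<in>{..<k i}.
        h (indexed_var i) \<oplus>\<^bsub>B\<^esub> h (indexed_const (x i)) \<ominus>\<^bsub>B\<^esub> h (indexed_const ((\<sigma> i ^^ j) (x i))))" .
  qed (auto intro!: h.S.finprod_closed cl)
  finally show ?thesis .
qed

lemma Pideal_ideal: "ideal (J n) MP"
  unfolding Pideal_def by (rule MP.genideal_ideal) (auto simp: twisted_power_closed)

lemma Psig_simps:
  "carrier (P n) = carrier (MP Quot J n)" "monoid.mult (P n) = monoid.mult (MP Quot J n)"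
  "\<one>\<^bsub>P n\<^esub> = \<one>\<^bsub>MP Quot J n\<^esub>" "\<zero>\<^bsub>P n\<^esub> = \<zero>\<^bsub>MP Quot J n\<^esub>" "add (P n) = add (MP Quot J n)"
  by (simp_all add: Psig_def top_quot_def huber_mpoly_def Quot_topologize)

lemma Psig_cring: "cring (P n)"
  using ideal.quotient_is_cring[OF Pideal_ideal MP.cring_axioms] Psig_simps by (rule cring_cong)

sublocale P: cring "P n" for n by (rule Psig_cring)

definition proj :: "nat \<Rightarrow> (nat multiset \<Rightarrow> 'a) \<Rightarrow> (nat multiset \<Rightarrow> 'a) set" where
  "proj n p = J n +>\<^bsub>MP\<^esub> p"

lemma proj_ring_hom: "proj n \<in> ring_hom MP (P n)"
  using ideal.rcos_ring_hom[OF Pideal_ideal, of n]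
  by (simp add: proj_def[abs_def] ring_hom_cong[OF Psig_simps(1,2,3,5)])

sublocale proj: ring_hom_cring MP "P n" "proj n" for n
  by (rule ring_hom_cringI'[OF mpoly_cring Psig_cring proj_ring_hom])

lemma Pconst_proj: "pc n a = proj n (indexed_const a)"
  by (simp add: Pconst_def proj_def)

lemma Pxi_proj: "xi n i = proj n (indexed_var i)"
  by (simp add: Pxi_def proj_def)

lemma Pconst_ring_hom: "pc n \<in> ring_hom A (P n)"
  using ring_hom_trans[OF indexed_const_ring_hom proj_ring_hom] by (simp add: Pconst_proj[abs_def] o_def)

sublocale pc: ring_hom_cring A "P n" "pc n" for n
  by (rule ring_hom_cringI'[OF cring_axioms Psig_cring Pconst_ring_hom])

lemma Pxi_closed [simp, intro]: "i < d \<Longrightarrow> xi n i \<in> carrier (P n)"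
  by (simp add: Pxi_proj indexed_var_closed)

lemma carrier_Psig: "carrier (P n) = proj n ` carrier MP"
  by (auto simp: Psig_simps FactRing_def A_RCOSETS_def RCOSETS_def a_r_coset_def proj_def)

lemma proj_twisted_power:
  assumes "(\<Sum>i<d. k i) = n + 1"
  shows "proj n (twisted_power A d \<sigma> x k) = \<zero>\<^bsub>P n\<^esub>"
proof -
  interpret I: ideal "J n" MP by (rule Pideal_ideal)
  have "twisted_power A d \<sigma> x k \<in> J n"
    unfolding Pideal_def by (rule subsetD[OF MP.genideal_self]) (use assms twisted_power_closed in auto)
  then show ?thesis
    by (simp add: proj_def Psig_simps FactRing_def I.a_rcos_const)
qed

text \<open>Inherited from \<open>mpoly_induct\<close> along the surjection \<open>proj\<close>;
  identities in P_(n) can then be proved without representatives.\<close>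

lemma Psig_induct [consumes 1, case_names const add var]:
  assumes "p \<in> carrier (P n)"
    and "\<And>c. c \<in> carrier A \<Longrightarrow> Q (pc n c)"
    and "\<And>p q. p \<in> carrier (P n) \<Longrightarrow> q \<in> carrier (P n) \<Longrightarrow> Q p \<Longrightarrow> Q q \<Longrightarrow> Q (p \<oplus>\<^bsub>P n\<^esub> q)"
    and "\<And>i p. i < d \<Longrightarrow> p \<in> carrier (P n) \<Longrightarrow> Q p \<Longrightarrow> Q (xi n i \<otimes>\<^bsub>P n\<^esub> p)"
  shows "Q p"
proof -
  obtain p' where p': "p' \<in> carrier MP" "p = proj n p'" using assms(1) by (auto simp: carrier_Psig)
  have "Q (proj n p')"
    using p'(1)
  proof (induction p' rule: mpoly_induct)
    case (const c)
    then show ?case using assms(2)[of c] by (simp add: Pconst_proj)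
  next
    case (add p q)
    then show ?case using assms(3)[of "proj n p" "proj n q"] by simp
  next
    case (var i p)
    then show ?case using assms(4)[of i "proj n p"] by (simp add: Pxi_proj indexed_var_closed)
  qed
  with p' show ?thesis by simp
qed

text \<open>The universal property of P_(n): a map killing the twisted powers of degree n + 1 has a
  kernel containing the ideal that they generate.\<close>

lemma Psig_induced:
  assumes B: "cring B" and h: "h \<in> ring_hom MP B"
    and z: "\<And>k. (\<Sum>i<d. k i) = n + 1 \<Longrightarrow> h (twisted_power A d \<sigma> x k) = \<zero>\<^bsub>B\<^esub>"
  shows "induced h \<in> ring_hom (P n) B"
    and "\<And>p. p \<in> carrier MP \<Longrightarrow> induced h (proj n p) = h p"
proof -
  interpret h: ring_hom_cring MP B h by (rule ring_hom_cringI'[OF mpoly_cring B h])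
  have "J n \<subseteq> a_kernel MP B h"
    unfolding Pideal_def
  proof (rule MP.genideal_minimal[OF h.ring.kernel_is_ideal], rule subsetI)
    fix p assume "p \<in> {twisted_power A d \<sigma> x k |k. (\<Sum>i<d. k i) = n + 1}"
    then obtain k where k: "p = twisted_power A d \<sigma> x k" "(\<Sum>i<d. k i) = n + 1" by blast
    show "p \<in> a_kernel MP B h"
      unfolding a_kernel_def' k(1) using z[OF k(2)] twisted_power_closed by blast
  qed
  then have zero: "h u = \<zero>\<^bsub>B\<^esub>" if "u \<in> J n" for u
    using that unfolding a_kernel_def' by blast
  show "induced h \<in> ring_hom (P n) B"
    using induced_ring_hom[OF Pideal_ideal[of n] h.ring.ring_hom_ring_axioms zero]
    by (simp add: ring_hom_cong_dom[OF Psig_simps(1,2,3,5)])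
  show "induced h (proj n p) = h p" if "p \<in> carrier MP" for p
    unfolding proj_def by (rule induced_coset[OF Pideal_ideal h.ring.ring_hom_ring_axioms zero that])
qed

lemma ex_pos: "(\<Sum>i<d. k i) = n + 1 \<Longrightarrow> \<exists>i<d. k i > (0::nat)"
  by (rule ccontr) simp

subsection \<open>The augmentation\<close>

lemma id_cring_hom: "ring_hom_cring A A id"
  by (rule ring_hom_cringI') (simp_all add: cring_axioms)

sublocale ev0: mpoly_evaluation A A id d "\<lambda>_. \<zero>"
  by (simp add: mpoly_evaluation_def mpoly_evaluation_axioms_def id_cring_hom)

text \<open>At xi = 0 the factor with \<open>j = 0\<close> becomes x_i - x_i. The positive degree n
  + 1 guarantees that such a factor occurs.\<close>

lemma ev0_twisted_power:
  assumes "(\<Sum>i<d. k i) = n + 1"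
  shows "ev0.ev (twisted_power A d \<sigma> x k) = \<zero>"
proof -
  have h: "ring_hom_cring MP A ev0.ev"
    by (rule ring_hom_cringI'[OF mpoly_cring cring_axioms ev0.ev_ring_hom])
  obtain i where i: "i < d" "k i > 0" using ex_pos[OF assms] by blast
  let ?g = "\<lambda>i j. ev0.ev (indexed_var i) \<oplus> ev0.ev (indexed_const (x i)) \<ominus>
        ev0.ev (indexed_const ((\<sigma> i ^^ j) (x i)))"
  have g: "?g i j = x i \<ominus> (\<sigma> i ^^ j) (x i)" if "i < d" for i j
    using that by (simp add: ev0.ev_var ev0.ev_const x_closed iter_closed)
  have g_closed: "?g i j \<in> carrier A" if "i < d" for i j
    unfolding g[OF that] using that by (simp add: x_closed iter_closed)
  have "?g i 0 = \<zero>"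
    unfolding g[OF i(1)] using i by (simp add: x_closed)
  then have "(\<Otimes>j\<in>{..<k i}. ?g i j) = \<zero>"
    using i g_closed[OF i(1)] by (intro finprod_zeroI[of _ _ 0]) auto
  moreover have "(\<Otimes>j\<in>{..<k i}. ?g i j) \<in> carrier A" if "i < d" for i
    using g_closed[OF that] by (intro finprod_closed) auto
  ultimately show ?thesis
    unfolding hom_twisted_power[OF h]
    using i by (intro finprod_zeroI[where i = i and f = "\<lambda>i. \<Otimes>j\<in>{..<k i}. ?g i j"]) auto
qed

lemma Pproj_ring_hom: "Pproj A \<in> ring_hom (P n) A"
  and Pproj_proj: "p \<in> carrier MP \<Longrightarrow> Pproj A (proj n p) = ev0.ev p"
  unfolding Pproj_def id_def[symmetric]
  by (rule Psig_induced[OF cring_axioms ev0.ev_ring_hom ev0_twisted_power], assumption)+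

sublocale Pproj: ring_hom_cring "P n" A "Pproj A" for n
  by (rule ring_hom_cringI'[OF Psig_cring cring_axioms Pproj_ring_hom])

lemma Pproj_const [simp]: "a \<in> carrier A \<Longrightarrow> Pproj A (pc n a) = a"
  by (simp add: Pconst_proj Pproj_proj ev0.ev_const indexed_const_closed)

lemma Pproj_xi [simp]: "i < d \<Longrightarrow> Pproj A (xi n i) = \<zero>"
  by (simp add: Pxi_proj Pproj_proj ev0.ev_var indexed_var_closed)

subsection \<open>Truncation in degree zero\<close>

lemma P_finprod_single:
  assumes "i < d" "f \<in> {..<d} \<rightarrow> carrier (P n)" "\<And>j. j < d \<Longrightarrow> j \<noteq> i \<Longrightarrow> f j = \<one>\<^bsub>P n\<^esub>"
  shows "(\<Otimes>\<^bsub>P n\<^esub>j\<in>{..<d}. f j) = f i"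
proof -
  have "(\<Otimes>\<^bsub>P n\<^esub>j\<in>{..<d}. f j) = (\<Otimes>\<^bsub>P n\<^esub>j\<in>{i}. f j)"
    using assms by (intro P.finprod_mono_neutral_cong_right) auto
  then show ?thesis using assms by (simp add: Pi_iff)
qed

lemma factor_closed: "i < d \<Longrightarrow> xi n i \<oplus>\<^bsub>P n\<^esub> pc n (x i) \<ominus>\<^bsub>P n\<^esub> pc n ((\<sigma> i ^^ j) (x i)) \<in> carrier (P n)"
  by (simp add: x_closed iter_closed)

lemma factor_0: "i < d \<Longrightarrow> xi n i \<oplus>\<^bsub>P n\<^esub> pc n (x i) \<ominus>\<^bsub>P n\<^esub> pc n (x i) = xi n i"
  by (simp add: x_closed P.minus_eq P.a_assoc P.r_neg)

lemma twisted_relation: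
  assumes "(\<Sum>i<d. k i) = n + 1"
  shows "(\<Otimes>\<^bsub>P n\<^esub>i\<in>{..<d}. \<Otimes>\<^bsub>P n\<^esub>j\<in>{..<k i}.
    xi n i \<oplus>\<^bsub>P n\<^esub> pc n (x i) \<ominus>\<^bsub>P n\<^esub> pc n ((\<sigma> i ^^ j) (x i))) = \<zero>\<^bsub>P n\<^esub>"
  using proj_twisted_power[OF assms] hom_twisted_power[OF proj.ring_hom_cring_axioms]
  by (simp add: Pconst_proj Pxi_proj)

text \<open>The relation whose exponent is the unit vector at \<open>i\<close> consists of the
  single factor with \<open>j = 0\<close>, which is xi_i itself.\<close>

lemma xi_0:
  assumes "i < d"
  shows "xi 0 i = \<zero>\<^bsub>P 0\<^esub>"
proof -
  let ?k = "\<lambda>l. if l = i then 1 else 0 :: nat"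
  have "(\<Sum>l<d. ?k l) = 0 + 1" using assms by simp
  from twisted_relation[OF this] have "(\<Otimes>\<^bsub>P 0\<^esub>j\<in>{..<?k i}.
    xi 0 i \<oplus>\<^bsub>P 0\<^esub> pc 0 (x i) \<ominus>\<^bsub>P 0\<^esub> pc 0 ((\<sigma> i ^^ j) (x i))) = \<zero>\<^bsub>P 0\<^esub>"
    using assms by (subst (asm) P_finprod_single[of i]) (auto intro!: P.finprod_closed factor_closed)
  then show ?thesis
    using assms by (simp add: factor_0 lessThan_1)
qed

text \<open>P_(0) is A via the augmentation. This will turn the first of the two kernels defining
  \<open>Omega\<close> into a condition on augmentations.\<close>

lemma P0_const:
  assumes "p \<in> carrier (P 0)"
  shows "p = pc 0 (Pproj A p)"
  using assms by (induction p rule: Psig_induct) (simp_all add: xi_0)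

end

subsection \<open>Truncation in degree one\<close>

locale twisted_ring_1 = twisted_ring
begin

abbreviation "P1 \<equiv> P 1"

text \<open>The relation with exponent one at both \<open>i\<close> and \<open>j\<close> has degree
  2, and each of its two factors has \<open>j = 0\<close>, hence no correction term.\<close>

lemma xi_xi:
  assumes "i < d" "j < d" "i \<noteq> j"
  shows "xi 1 i \<otimes>\<^bsub>P1\<^esub> xi 1 j = \<zero>\<^bsub>P1\<^esub>"
proof -
  let ?k = "\<lambda>l. if l = i \<or> l = j then 1 else 0 :: nat"
  let ?f = "\<lambda>l. \<Otimes>\<^bsub>P1\<^esub>m\<in>{..<?k l}. xi 1 l \<oplus>\<^bsub>P1\<^esub> pc 1 (x l) \<ominus>\<^bsub>P1\<^esub> pc 1 ((\<sigma> l ^^ m) (x l))"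
  have "(\<Sum>l<d. ?k l) = (\<Sum>l\<in>{i, j}. ?k l)"
    using assms by (intro sum.mono_neutral_right) auto
  then have "(\<Sum>l<d. ?k l) = 1 + 1" using assms by simp
  from twisted_relation[OF this] have "(\<Otimes>\<^bsub>P1\<^esub>l\<in>{..<d}. ?f l) = \<zero>\<^bsub>P1\<^esub>" .
  also have "(\<Otimes>\<^bsub>P1\<^esub>l\<in>{..<d}. ?f l) = (\<Otimes>\<^bsub>P1\<^esub>l\<in>{i, j}. ?f l)"
    using assms by (intro P.finprod_mono_neutral_cong_right) (auto intro!: P.finprod_closed factor_closed)
  also have "\<dots> = ?f i \<otimes>\<^bsub>P1\<^esub> ?f j"
    using assms by (intro P.finprod_pair P.finprod_closed funcsetI factor_closed) auto
  also have "\<dots> = xi 1 i \<otimes>\<^bsub>P1\<^esub> xi 1 j"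
    using assms by (simp add: factor_0 lessThan_1)
  finally show ?thesis .
qed

text \<open>Extended by zero beyond \<open>d\<close>, so that the model can use sequences indexed by
  all natural numbers.\<close>

definition qq :: "nat \<Rightarrow> 'a" where
  "qq i = (if i < d then \<sigma> i (x i) \<ominus> x i else \<zero>)"

lemma qq_closed [simp]: "qq i \<in> carrier A"
  by (simp add: qq_def x_closed sigma_closed)

text \<open>The relation with exponent two at \<open>i\<close> reads xi_i (xi_i + x_i -
  sigma_i(x_i)) = 0, the factors being those for \<open>j = 0\<close> and
  \<open>j = 1\<close>.\<close>

lemma xi_square:
  assumes "i < d"
  shows "xi 1 i \<otimes>\<^bsub>P1\<^esub> xi 1 i = pc 1 (qq i) \<otimes>\<^bsub>P1\<^esub> xi 1 i"
proof -
  let ?k = "\<lambda>l. if l = i then 2 else 0 :: nat"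
  have "(\<Sum>l<d. ?k l) = 1 + 1" using assms by simp
  from twisted_relation[OF this] have "(\<Otimes>\<^bsub>P1\<^esub>j\<in>{..<?k i}.
    xi 1 i \<oplus>\<^bsub>P1\<^esub> pc 1 (x i) \<ominus>\<^bsub>P1\<^esub> pc 1 ((\<sigma> i ^^ j) (x i))) = \<zero>\<^bsub>P1\<^esub>"
    using assms by (subst (asm) P_finprod_single[of i]) (auto intro!: P.finprod_closed factor_closed)
  then have "xi 1 i \<otimes>\<^bsub>P1\<^esub> (xi 1 i \<oplus>\<^bsub>P1\<^esub> pc 1 (x i) \<ominus>\<^bsub>P1\<^esub> pc 1 (\<sigma> i (x i))) = \<zero>\<^bsub>P1\<^esub>"
    using assms P.finprod_pair[of 0 1 "\<lambda>j. xi 1 i \<oplus>\<^bsub>P1\<^esub> pc 1 (x i) \<ominus>\<^bsub>P1\<^esub> pc 1 ((\<sigma> i ^^ j) (x i))" 1]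
    by (simp add: factor_0 lessThan_2 funpow_one x_closed sigma_closed)
  also have "xi 1 i \<oplus>\<^bsub>P1\<^esub> pc 1 (x i) \<ominus>\<^bsub>P1\<^esub> pc 1 (\<sigma> i (x i)) = xi 1 i \<ominus>\<^bsub>P1\<^esub> pc 1 (qq i)"
    using assms by (simp add: qq_def minus_eq P.minus_eq x_closed sigma_closed P.minus_add P.a_ac)
  finally have "xi 1 i \<otimes>\<^bsub>P1\<^esub> xi 1 i \<ominus>\<^bsub>P1\<^esub> xi 1 i \<otimes>\<^bsub>P1\<^esub> pc 1 (qq i) = \<zero>\<^bsub>P1\<^esub>"
    using assms by (simp add: P.minus_eq P.r_distr P.r_minus)
  then show ?thesis using assms by (simp add: P.m_comm)
qed

text \<open>\<open>P\<^sub>1\<close> is compared with the explicit ring structure on \<open>A \<times> A\<^sup>\<nat>\<close> in which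
  \<open>\<xi>\<^sub>i\<xi>\<^sub>j = \<delta>\<^sub>i\<^sub>j q\<^sub>i\<xi>\<^sub>i\<close>; this shows that \<open>1, \<xi>\<^sub>0, \<dots>, \<xi>\<^sub>d\<^sub>-\<^sub>1\<close> are linearly independent.\<close>

definition model :: "('a \<times> (nat \<Rightarrow> 'a)) ring" where
  "model = \<lparr>carrier = {(a, u). a \<in> carrier A \<and> (\<forall>i. u i \<in> carrier A)},
     monoid.mult = (\<lambda>(a, u) (b, v). (a \<otimes> b, \<lambda>i. a \<otimes> v i \<oplus> b \<otimes> u i \<oplus> qq i \<otimes> (u i \<otimes> v i))),
     one = (\<one>, \<lambda>_. \<zero>), ring.zero = (\<zero>, \<lambda>_. \<zero>), add = (\<lambda>(a, u) (b, v). (a \<oplus> b, \<lambda>i. u i \<oplus> v i))\<rparr>"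

text \<open>In each coordinate the product is that of A[t]/(t^2 - q_i t) on elements a + u t. The
  model is the product of these rings over their common quotient A, and the axioms can be checked
  coordinatewise.\<close>

lemma model_cring: "cring model"
proof (rule cringI)
  show "abelian_group model"
  proof (rule abelian_groupI)
    fix u assume "u \<in> carrier model"
    then show "\<exists>v\<in>carrier model. v \<oplus>\<^bsub>model\<^esub> u = \<zero>\<^bsub>model\<^esub>"
      by (intro bexI[of _ "(\<ominus> fst u, \<lambda>i. \<ominus> snd u i)"]) (auto simp: model_def l_neg)
  qed (auto simp: model_def a_assoc intro: a_comm)
  show "Group.comm_monoid model"
  proof (rule comm_monoidI)
    fix u v w assume "u \<in> carrier model" "v \<in> carrier model" "w \<in> carrier model"
    then show "u \<otimes>\<^bsub>model\<^esub> v \<otimes>\<^bsub>model\<^esub> w = u \<otimes>\<^bsub>model\<^esub> (v \<otimes>\<^bsub>model\<^esub> w)"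
      by (auto simp: model_def l_distr r_distr m_ac a_ac)
  next
    fix u v assume "u \<in> carrier model" "v \<in> carrier model"
    then show "u \<otimes>\<^bsub>model\<^esub> v = v \<otimes>\<^bsub>model\<^esub> u"
      by (auto simp: model_def m_ac a_ac)
  qed (auto simp: model_def)
  fix u v w assume "u \<in> carrier model" "v \<in> carrier model" "w \<in> carrier model"
  then show "(u \<oplus>\<^bsub>model\<^esub> v) \<otimes>\<^bsub>model\<^esub> w = u \<otimes>\<^bsub>model\<^esub> w \<oplus>\<^bsub>model\<^esub> v \<otimes>\<^bsub>model\<^esub> w"
    by (auto simp: model_def l_distr r_distr m_ac a_ac)
qed

sublocale model: cring model by (rule model_cring)

definition mc :: "'a \<Rightarrow> 'a \<times> (nat \<Rightarrow> 'a)" where "mc a = (a, \<lambda>_. \<zero>)"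
definition mx :: "nat \<Rightarrow> 'a \<times> (nat \<Rightarrow> 'a)" where "mx i = (\<zero>, \<lambda>j. if j = i then \<one> else \<zero>)"

lemma mx_closed [simp]: "mx i \<in> carrier model"
  by (simp add: mx_def model_def)

lemma mc_ring_hom: "mc \<in> ring_hom A model"
  by (rule ring_hom_memI) (auto simp: mc_def model_def)

sublocale mc: ring_hom_cring A model mc
  by (rule ring_hom_cringI'[OF cring_axioms model_cring mc_ring_hom])

sublocale evm: mpoly_evaluation A model mc d mx
  by (simp add: mpoly_evaluation_def mpoly_evaluation_axioms_def mc.ring_hom_cring_axioms)

lemma mx_mx: "i \<noteq> j \<Longrightarrow> mx i \<otimes>\<^bsub>model\<^esub> mx j = \<zero>\<^bsub>model\<^esub>"
  by (auto simp: mx_def model_def)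

lemma mx_factor: "i < d \<Longrightarrow> (mx i \<oplus>\<^bsub>model\<^esub> mc (x i) \<ominus>\<^bsub>model\<^esub> mc (\<sigma> i (x i))) \<otimes>\<^bsub>model\<^esub> mx i = \<zero>\<^bsub>model\<^esub>"
proof -
  assume i: "i < d"
  then have "mx i \<oplus>\<^bsub>model\<^esub> mc (x i) \<ominus>\<^bsub>model\<^esub> mc (\<sigma> i (x i)) =
    mx i \<oplus>\<^bsub>model\<^esub> mc (x i \<ominus> \<sigma> i (x i))"
    by (simp add: minus_eq model.minus_eq model.a_assoc x_closed sigma_closed)
  also have "\<dots> \<otimes>\<^bsub>model\<^esub> mx i = \<zero>\<^bsub>model\<^esub>"
  proof -
    \<comment> \<open>This is coordinate \<open>i\<close> of the product: the constant part of the
      first factor contributes x_i - sigma_i(x_i), the square of xi_i contributes q_i.\<close>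
    have "x i \<ominus> \<sigma> i (x i) \<oplus> (\<sigma> i (x i) \<ominus> x i) = \<zero>"
      using i x_closed[OF i] sigma_closed[OF i x_closed[OF i]] by algebra
    then show ?thesis
      using i by (auto simp: mx_def mc_def model_def qq_def x_closed sigma_closed)
  qed
  finally show ?thesis .
qed

text \<open>Every positive exponent contributes the factor \<open>mx i\<close> through
  \<open>j = 0\<close>. In degree 2 either two different indices occur, whose factors annihilate
  each other, or one index has exponent 2 and \<open>mx_factor\<close> applies.\<close>

lemma evm_twisted_power:
  assumes "(\<Sum>i<d. k i) = 1 + 1"
  shows "evm.ev (twisted_power A d \<sigma> x k) = \<zero>\<^bsub>model\<^esub>"
proof -
  have h: "ring_hom_cring MP model evm.ev"
    by (rule ring_hom_cringI'[OF mpoly_cring model_cring evm.ev_ring_hom])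
  let ?g = "\<lambda>i j. mx i \<oplus>\<^bsub>model\<^esub> mc (x i) \<ominus>\<^bsub>model\<^esub> mc ((\<sigma> i ^^ j) (x i))"
  let ?f = "\<lambda>i. \<Otimes>\<^bsub>model\<^esub>j\<in>{..<k i}. ?g i j"
  have g0: "?g i 0 = mx i" if "i < d" for i
    using that by (simp add: model.minus_eq model.a_assoc model.r_neg x_closed)
  have g_closed: "?g i j \<in> carrier model" if "i < d" for i j
    using that by (simp add: x_closed iter_closed)
  have f_closed: "?f i \<in> carrier model" if "i < d" for i
    using that g_closed by (intro model.finprod_closed) auto
  have f1: "?f i = mx i \<otimes>\<^bsub>model\<^esub> (\<Otimes>\<^bsub>model\<^esub>j\<in>{..<k i} - {0}. ?g i j)" if i: "i < d" "k i > 0" for i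
  proof -
    have s: "{..<k i} = insert 0 ({..<k i} - {0})" using i by auto
    have "?f i = (\<Otimes>\<^bsub>model\<^esub>j\<in>insert 0 ({..<k i} - {0}). ?g i j)"
      by (rule arg_cong[OF s])
    also have "\<dots> = ?g i 0 \<otimes>\<^bsub>model\<^esub> (\<Otimes>\<^bsub>model\<^esub>j\<in>{..<k i} - {0}. ?g i j)"
      using g_closed[OF i(1)] g_closed[OF i(1), of 0] by (intro model.finprod_insert) auto
    finally show ?thesis unfolding g0[OF i(1)] .
  qed
  obtain i where i: "i < d" "k i > 0" using ex_pos[of k 1] assms by auto
  have "(\<Otimes>\<^bsub>model\<^esub>i\<in>{..<d}. ?f i) = \<zero>\<^bsub>model\<^esub>"
  proof (cases "k i = 1")
    case True
    have "(\<Sum>l<d. k l) = k i + (\<Sum>l\<in>{..<d} - {i}. k l)"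
      using i by (simp add: sum.remove)
    \<comment> \<open>One unit of the total degree 2 remains after index \<open>i\<close>, so some
      other index has positive exponent.\<close>
    with assms True have "(\<Sum>l\<in>{..<d} - {i}. k l) \<noteq> 0" by simp
    then obtain j where j: "j < d" "j \<noteq> i" "k j > 0" by auto
    let ?r = "\<Otimes>\<^bsub>model\<^esub>l\<in>{..<d} - {i} - {j}. ?f l"
    have r: "?r \<in> carrier model" using f_closed by (intro model.finprod_closed) auto
    have s: "{..<d} = insert i (insert j ({..<d} - {i} - {j}))" using i j by auto
    have "(\<Otimes>\<^bsub>model\<^esub>i\<in>{..<d}. ?f i) = ?f i \<otimes>\<^bsub>model\<^esub> (?f j \<otimes>\<^bsub>model\<^esub> ?r)"
    proof -
      have "(\<Otimes>\<^bsub>model\<^esub>l\<in>insert j ({..<d} - {i} - {j}). ?f l) = ?f j \<otimes>\<^bsub>model\<^esub> ?r"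
        by (intro model.finprod_insert funcsetI f_closed) (use j in auto)
      moreover have "(\<Otimes>\<^bsub>model\<^esub>l\<in>insert i (insert j ({..<d} - {i} - {j})). ?f l) =
          ?f i \<otimes>\<^bsub>model\<^esub> (\<Otimes>\<^bsub>model\<^esub>l\<in>insert j ({..<d} - {i} - {j}). ?f l)"
        by (intro model.finprod_insert funcsetI f_closed) (use i j in auto)
      ultimately show ?thesis using arg_cong[OF s, of "finprod model ?f"] by argo
    qed
    also have "\<dots> = (mx i \<otimes>\<^bsub>model\<^esub> mx j) \<otimes>\<^bsub>model\<^esub> ((\<Otimes>\<^bsub>model\<^esub>l\<in>{..<k i} - {0}. ?g i l) \<otimes>\<^bsub>model\<^esub>
        ((\<Otimes>\<^bsub>model\<^esub>l\<in>{..<k j} - {0}. ?g j l) \<otimes>\<^bsub>model\<^esub> ?r))"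
      unfolding f1[OF i] f1[OF j(1,3)]
      using g_closed[OF i(1)] g_closed[OF j(1)] r
      by (simp add: model.m_ac model.finprod_closed Pi_iff)
    also have "\<dots> = \<zero>\<^bsub>model\<^esub>"
      using g_closed[OF i(1)] g_closed[OF j(1)] r j(2)
      by (simp add: mx_mx model.finprod_closed Pi_iff)
    finally show ?thesis .
  next
    case False
    have "k i \<le> (\<Sum>l<d. k l)" using i by (intro member_le_sum) auto
    with assms False i have k: "k i = 2" by simp
    have "?f i = ?g i 0 \<otimes>\<^bsub>model\<^esub> ?g i 1"
      unfolding k lessThan_2 by (intro model.finprod_pair g_closed i) simp
    also have "\<dots> = \<zero>\<^bsub>model\<^esub>"
      unfolding g0[OF i(1)] using mx_factor[OF i(1)] g_closed[OF i(1), of 1]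
      by (simp add: model.m_comm funpow_one)
    finally show ?thesis
      using i f_closed by (intro model.finprod_zeroI[where i = i and f = ?f]) auto
  qed
  moreover have "evm.ev (twisted_power A d \<sigma> x k) = (\<Otimes>\<^bsub>model\<^esub>i\<in>{..<d}. ?f i)"
    unfolding hom_twisted_power[OF h]
    using g_closed by (intro model.finprod_cong')
      (auto intro!: model.finprod_cong' model.finprod_closed simp: evm.ev_var evm.ev_const x_closed iter_closed)
  ultimately show ?thesis by simp
qed

definition to_model :: "(nat multiset \<Rightarrow> 'a) set \<Rightarrow> 'a \<times> (nat \<Rightarrow> 'a)" where
  "to_model = induced evm.ev"

lemma to_model_ring_hom: "to_model \<in> ring_hom P1 model"
  and to_model_proj: "p \<in> carrier MP \<Longrightarrow> to_model (proj 1 p) = evm.ev p"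
  unfolding to_model_def
  using Psig_induced[OF model_cring evm.ev_ring_hom, of 1] evm_twisted_power by auto

sublocale tm: ring_hom_cring P1 model to_model
  by (rule ring_hom_cringI'[OF Psig_cring model_cring to_model_ring_hom])

lemma to_model_const: "a \<in> carrier A \<Longrightarrow> to_model (pc 1 a) = mc a"
  by (simp add: Pconst_proj to_model_proj evm.ev_const indexed_const_closed)

lemma to_model_xi: "i < d \<Longrightarrow> to_model (xi 1 i) = mx i"
  by (simp add: Pxi_proj to_model_proj evm.ev_var indexed_var_closed)

text \<open>The coefficient of xi_i, read off in the model, where it is visibly well defined and
  additive. That it deserves the name is \<open>P1_expand\<close>.\<close>

definition coef :: "nat \<Rightarrow> (nat multiset \<Rightarrow> 'a) set \<Rightarrow> 'a" where
  "coef i p = snd (to_model p) i"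

lemma model_closedD: "u \<in> carrier model \<Longrightarrow> fst u \<in> carrier A" "u \<in> carrier model \<Longrightarrow> snd u i \<in> carrier A"
  by (auto simp: model_def)

lemma coef_closed [simp]: "p \<in> carrier P1 \<Longrightarrow> coef i p \<in> carrier A"
  by (simp add: coef_def model_closedD)

lemma model_add: "u \<oplus>\<^bsub>model\<^esub> v = (fst u \<oplus> fst v, \<lambda>i. snd u i \<oplus> snd v i)"
  by (simp add: model_def case_prod_beta)

lemma model_mult: "u \<otimes>\<^bsub>model\<^esub> v = (fst u \<otimes> fst v,
    \<lambda>i. fst u \<otimes> snd v i \<oplus> fst v \<otimes> snd u i \<oplus> qq i \<otimes> (snd u i \<otimes> snd v i))"
  by (simp add: model_def case_prod_beta)

lemma coef_add: "p \<in> carrier P1 \<Longrightarrow> p' \<in> carrier P1 \<Longrightarrow> coef i (p \<oplus>\<^bsub>P1\<^esub> p') = coef i p \<oplus> coef i p'"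
  by (simp add: coef_def model_add)

lemma coef_const [simp]: "a \<in> carrier A \<Longrightarrow> coef i (pc 1 a) = \<zero>"
  by (simp add: coef_def to_model_const mc_def)

lemma coef_xi [simp]: "j < d \<Longrightarrow> coef i (xi 1 j) = (if i = j then \<one> else \<zero>)"
  by (simp add: coef_def to_model_xi mx_def)

lemma fst_to_model: "p \<in> carrier P1 \<Longrightarrow> fst (to_model p) = Pproj A p"
  by (induction p rule: Psig_induct)
    (simp_all add: to_model_const to_model_xi mc_def mx_def model_add model_mult)

text \<open>The source of the twisted Leibniz rule: the last summand is the contribution of xi_i^2 =
  q_i xi_i.\<close>

lemma coef_mult:
  assumes "p \<in> carrier P1" "p' \<in> carrier P1"
  shows "coef i (p \<otimes>\<^bsub>P1\<^esub> p') =
    Pproj A p \<otimes> coef i p' \<oplus> Pproj A p' \<otimes> coef i p \<oplus> qq i \<otimes> (coef i p \<otimes> coef i p')"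
  using assms by (simp add: coef_def model_mult fst_to_model)

lemma coef_const_mult: "a \<in> carrier A \<Longrightarrow> p \<in> carrier P1 \<Longrightarrow> coef i (pc 1 a \<otimes>\<^bsub>P1\<^esub> p) = a \<otimes> coef i p"
  by (simp add: coef_mult)

text \<open>Elements with such an expansion include the constants and are closed under sums and, by
  the two multiplication rules for the xi_i, under multiplication by a xi_i.\<close>

lemma P1_expand:
  assumes "p \<in> carrier P1"
  shows "p = pc 1 (Pproj A p) \<oplus>\<^bsub>P1\<^esub> (\<Oplus>\<^bsub>P1\<^esub>i\<in>{..<d}. pc 1 (coef i p) \<otimes>\<^bsub>P1\<^esub> xi 1 i)"
  using assms
proof (induction p rule: Psig_induct)
  case (const c)
  then have "(\<Oplus>\<^bsub>P1\<^esub>i\<in>{..<d}. pc 1 (coef i (pc 1 c)) \<otimes>\<^bsub>P1\<^esub> xi 1 i) = \<zero>\<^bsub>P1\<^esub>"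
    by (intro P.add.finprod_one_eqI) auto
  with const show ?case by simp
next
  case (add p p')
  let ?S = "\<lambda>p. \<Oplus>\<^bsub>P1\<^esub>i\<in>{..<d}. pc 1 (coef i p) \<otimes>\<^bsub>P1\<^esub> xi 1 i"
  have S: "?S p \<in> carrier P1" "?S p' \<in> carrier P1"
    using add(1,2) by (auto intro!: P.finsum_closed)
  have "?S (p \<oplus>\<^bsub>P1\<^esub> p') = (\<Oplus>\<^bsub>P1\<^esub>i\<in>{..<d}. pc 1 (coef i p) \<otimes>\<^bsub>P1\<^esub> xi 1 i \<oplus>\<^bsub>P1\<^esub> pc 1 (coef i p') \<otimes>\<^bsub>P1\<^esub> xi 1 i)"
    using add(1,2) by (intro P.finsum_cong') (auto simp: coef_add P.l_distr)
  also have "\<dots> = ?S p \<oplus>\<^bsub>P1\<^esub> ?S p'"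
    using add(1,2) by (intro P.finsum_addf) auto
  finally have "pc 1 (Pproj A (p \<oplus>\<^bsub>P1\<^esub> p')) \<oplus>\<^bsub>P1\<^esub> ?S (p \<oplus>\<^bsub>P1\<^esub> p') =
      (pc 1 (Pproj A p) \<oplus>\<^bsub>P1\<^esub> ?S p) \<oplus>\<^bsub>P1\<^esub> (pc 1 (Pproj A p') \<oplus>\<^bsub>P1\<^esub> ?S p')"
    using add(1,2) S by (simp add: P.a_ac)
  with add show ?case by simp
next
  case (var i p)
  let ?S = "\<Oplus>\<^bsub>P1\<^esub>j\<in>{..<d}. pc 1 (coef j p) \<otimes>\<^bsub>P1\<^esub> xi 1 j"
  have S: "?S \<in> carrier P1" using var(2) by (auto intro!: P.finsum_closed)
  \<comment> \<open>Only the coefficient at \<open>i\<close> survives: the augmentation of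
    \<open>p\<close> multiplies xi_i, and the xi_i-part of \<open>p\<close> is multiplied by
    q_i.\<close>
  have c: "coef j (xi 1 i \<otimes>\<^bsub>P1\<^esub> p) = (if i = j then Pproj A p \<oplus> qq i \<otimes> coef i p else \<zero>)" for j
    using var(1,2) by (simp add: coef_mult)
  have "xi 1 i \<otimes>\<^bsub>P1\<^esub> ?S = (\<Oplus>\<^bsub>P1\<^esub>j\<in>{..<d}. xi 1 i \<otimes>\<^bsub>P1\<^esub> (pc 1 (coef j p) \<otimes>\<^bsub>P1\<^esub> xi 1 j))"
    using var(1,2) by (intro P.finsum_rdistr) auto
  also have "\<dots> = (\<Oplus>\<^bsub>P1\<^esub>j\<in>{..<d}. if i = j then pc 1 (qq i \<otimes> coef i p) \<otimes>\<^bsub>P1\<^esub> xi 1 i else \<zero>\<^bsub>P1\<^esub>)"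
  proof (intro P.finsum_cong')
    fix j assume "j \<in> {..<d}"
    then have "xi 1 i \<otimes>\<^bsub>P1\<^esub> (pc 1 (coef j p) \<otimes>\<^bsub>P1\<^esub> xi 1 j) = pc 1 (coef j p) \<otimes>\<^bsub>P1\<^esub> (xi 1 i \<otimes>\<^bsub>P1\<^esub> xi 1 j)"
      using var(1,2) by (simp add: P.m_lcomm)
    with \<open>j \<in> _\<close> var(1,2) show "xi 1 i \<otimes>\<^bsub>P1\<^esub> (pc 1 (coef j p) \<otimes>\<^bsub>P1\<^esub> xi 1 j) =
        (if i = j then pc 1 (qq i \<otimes> coef i p) \<otimes>\<^bsub>P1\<^esub> xi 1 i else \<zero>\<^bsub>P1\<^esub>)"
      by (cases "i = j") (simp_all add: xi_xi xi_square P.m_ac)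
  qed (use var(1,2) in auto)
  also have "\<dots> = pc 1 (qq i \<otimes> coef i p) \<otimes>\<^bsub>P1\<^esub> xi 1 i"
    using var(1,2) by (subst P.add.finprod_singleton) auto
  finally have 1: "xi 1 i \<otimes>\<^bsub>P1\<^esub> ?S = pc 1 (qq i \<otimes> coef i p) \<otimes>\<^bsub>P1\<^esub> xi 1 i" .
  have "(\<Oplus>\<^bsub>P1\<^esub>j\<in>{..<d}. pc 1 (coef j (xi 1 i \<otimes>\<^bsub>P1\<^esub> p)) \<otimes>\<^bsub>P1\<^esub> xi 1 j) =
    (\<Oplus>\<^bsub>P1\<^esub>j\<in>{..<d}. if i = j then pc 1 (Pproj A p \<oplus> qq i \<otimes> coef i p) \<otimes>\<^bsub>P1\<^esub> xi 1 i else \<zero>\<^bsub>P1\<^esub>)"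
    using var(1,2) by (intro P.finsum_cong') (auto simp: c)
  also have "\<dots> = pc 1 (Pproj A p \<oplus> qq i \<otimes> coef i p) \<otimes>\<^bsub>P1\<^esub> xi 1 i"
    using var(1,2) by (subst P.add.finprod_singleton) auto
  also have "\<dots> = xi 1 i \<otimes>\<^bsub>P1\<^esub> pc 1 (Pproj A p) \<oplus>\<^bsub>P1\<^esub> xi 1 i \<otimes>\<^bsub>P1\<^esub> ?S"
    unfolding 1 using var(1,2) by (simp add: P.l_distr P.r_distr P.m_comm)
  also have "\<dots> = xi 1 i \<otimes>\<^bsub>P1\<^esub> (pc 1 (Pproj A p) \<oplus>\<^bsub>P1\<^esub> ?S)"
    using var(1,2) S by (simp add: P.r_distr)
  also have "\<dots> = xi 1 i \<otimes>\<^bsub>P1\<^esub> p" using var(3) by simp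
  finally show ?case using var(1,2) by simp
qed

lemma coef_finsum:
  assumes "f \<in> I \<rightarrow> carrier P1"
  shows "coef i (\<Oplus>\<^bsub>P1\<^esub>j\<in>I. f j) = (\<Oplus>j\<in>I. coef i (f j))"
  by (rule additive_finsum[OF P.abelian_group_axioms abelian_group_axioms _ _ assms])
    (auto simp: coef_add)

text \<open>Linear independence, in the form needed below: the coefficients in an expansion are
  determined by the element.\<close>

lemma coef_linear:
  assumes "i < d" "a \<in> carrier A" "c \<in> {..<d} \<rightarrow> carrier A"
  shows "coef i (pc 1 a \<oplus>\<^bsub>P1\<^esub> (\<Oplus>\<^bsub>P1\<^esub>j\<in>{..<d}. pc 1 (c j) \<otimes>\<^bsub>P1\<^esub> xi 1 j)) = c i"
proof -
  have "coef i (\<Oplus>\<^bsub>P1\<^esub>j\<in>{..<d}. pc 1 (c j) \<otimes>\<^bsub>P1\<^esub> xi 1 j) = (\<Oplus>j\<in>{..<d}. coef i (pc 1 (c j) \<otimes>\<^bsub>P1\<^esub> xi 1 j))"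
    using assms by (intro coef_finsum) auto
  also have "\<dots> = (\<Oplus>j\<in>{..<d}. if i = j then c j else \<zero>)"
    using assms by (intro finsum_cong') (auto simp: coef_const_mult Pi_iff)
  also have "\<dots> = c i"
    using assms by (subst add.finprod_singleton) auto
  moreover have "(\<Oplus>\<^bsub>P1\<^esub>j\<in>{..<d}. pc 1 (c j) \<otimes>\<^bsub>P1\<^esub> xi 1 j) \<in> carrier P1" 
    using assms by (intro P.finsum_closed) auto
  ultimately show ?thesis
    using assms by (simp add: coef_add Pi_iff)
qed

text \<open>\<open>twisted_deriv\<close> is a definite description of a coefficient family;
  \<open>P1_expand\<close> provides existence and \<open>coef_linear\<close> uniqueness.\<close>

lemma twisted_deriv_coef:
  assumes T: "\<theta> 1 f \<in> carrier P1" "Pproj A (\<theta> 1 f) = f" and f: "f \<in> carrier A" and i: "i < d"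
  shows "twisted_deriv A d \<sigma> x \<theta> i f = coef i (\<theta> 1 f)"
proof -
  let ?c = "\<lambda>i\<in>{..<d}. coef i (\<theta> 1 f)"
  let ?L = "\<lambda>c. pc 1 f \<oplus>\<^bsub>P1\<^esub> (\<Oplus>\<^bsub>P1\<^esub>j\<in>{..<d}. pc 1 (c j) \<otimes>\<^bsub>P1\<^esub> xi 1 j)"
  have "(THE c. c \<in> {..<d} \<rightarrow>\<^sub>E carrier A \<and> \<theta> 1 f = ?L c) = ?c"
  proof (rule the_equality)
    have "(\<Oplus>\<^bsub>P1\<^esub>j\<in>{..<d}. pc 1 (?c j) \<otimes>\<^bsub>P1\<^esub> xi 1 j) = (\<Oplus>\<^bsub>P1\<^esub>j\<in>{..<d}. pc 1 (coef j (\<theta> 1 f)) \<otimes>\<^bsub>P1\<^esub> xi 1 j)"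
      using T by (intro P.finsum_cong') auto
    with P1_expand[OF T(1)] T show "?c \<in> {..<d} \<rightarrow>\<^sub>E carrier A \<and> \<theta> 1 f = ?L ?c" by auto
  next
    fix c assume c: "c \<in> {..<d} \<rightarrow>\<^sub>E carrier A \<and> \<theta> 1 f = ?L c"
    show "c = ?c"
    proof (rule PiE_ext[of c "{..<d}" "\<lambda>_. carrier A"])
      show "c \<in> {..<d} \<rightarrow>\<^sub>E carrier A" using c by (rule conjunct1)
      show "?c \<in> {..<d} \<rightarrow>\<^sub>E carrier A" using T by simp
    next
      fix j assume j: "j \<in> {..<d}"
      have "coef j (?L c) = c j"
        by (rule coef_linear) (use c f j in auto)
      with c j show "c j = ?c j" by simp
    qed
  qed
  with i show ?thesis by (simp add: twisted_deriv_def)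
qed

end

section \<open>Taylor morphisms\<close>

lemma alg_simps [simp]:
  "carrier (alg f B) = carrier B" "monoid.mult (alg f B) = monoid.mult B" "\<one>\<^bsub>alg f B\<^esub> = \<one>\<^bsub>B\<^esub>"
  "\<zero>\<^bsub>alg f B\<^esub> = \<zero>\<^bsub>B\<^esub>" "add (alg f B) = add B" "r \<odot>\<^bsub>alg f B\<^esub> b = f r \<otimes>\<^bsub>B\<^esub> b"
  by (simp_all add: alg_def)

lemma alg_cring: "cring B \<Longrightarrow> cring (alg f B)"
  by (erule cring_cong) simp_all

lemma alg_module:
  assumes "ring_hom_cring A B f"
  shows "Module.module A (alg f B)"
proof -
  interpret f: ring_hom_cring A B f by fact
  interpret C: cring "alg f B" by (rule alg_cring) (rule f.S.cring_axioms)
  show ?thesis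
    by (rule moduleI) (auto simp: f.R.cring_axioms C.abelian_group_axioms f.S.l_distr f.S.r_distr f.S.m_assoc)
qed

lemma subtop_simps [simp]:
  "carrier (subtop A S) = S" "monoid.mult (subtop A S) = monoid.mult A" "\<one>\<^bsub>subtop A S\<^esub> = \<one>\<^bsub>A\<^esub>"
  "\<zero>\<^bsub>subtop A S\<^esub> = \<zero>\<^bsub>A\<^esub>" "add (subtop A S) = add A"
  by (simp_all add: subtop_def)

lemma subtop_cring:
  assumes "cring A" "subring S A"
  shows "cring (subtop A S)"
proof -
  interpret cring A by fact
  have "cring (A\<lparr>carrier := S\<rparr>)"
    using subcringI'[OF assms(2)] subcring_iff[OF subringE(1)[OF assms(2)]] by simp
  then show ?thesis by (rule cring_cong) simp_all
qed

lemma subtop_incl: "subring S A \<Longrightarrow> cring A \<Longrightarrow> ring_hom_cring (subtop A S) A id"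
  by (rule ring_hom_cringI'[OF subtop_cring]) (auto simp: ring_hom_def dest: subsetD[OF subringE(1)])

text \<open>\<open>h\<close> and \<open>k\<close> agree on \<open>R\<close>, so the product h(m)
  k(n) is balanced and defines a ring map on the coproduct of the algebras M and N over R.\<close>

locale alg_pair =
  f: ring_hom_cring R M f + g: ring_hom_cring R N g + h: ring_hom_cring M S h + k: ring_hom_cring N S k
  for R :: "('r, 'e) ring_scheme" and M :: "('m, 'f) ring_scheme" and N :: "('n, 'g) ring_scheme"
    and S :: "('s, 'h) ring_scheme" and f g h k +
  assumes compat: "\<And>r. r \<in> carrier R \<Longrightarrow> h (f r) = k (g r)"
begin

sublocale tensor_algebra R "alg f M" "alg g N"
  by (simp add: tensor_algebra_def tensor_algebra_axioms_def alg_cring f.S.cring_axioms g.S.cring_axioms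
    f.S.m_lcomm g.S.m_lcomm)

sublocale balanced_map R "alg f M" "alg g N" S "\<lambda>m n. h m \<otimes>\<^bsub>S\<^esub> k n"
  by unfold_locales (simp_all add: h.S.l_distr h.S.r_distr h.S.m_ac compat)


lemmas is_tensor_product = tensor_product_axioms
lemmas is_tensor_algebra = tensor_algebra_axioms
lemmas is_balanced_map = balanced_map_axioms
lemmas tensor_is_cring = tensor_cring

lemma lift_mult:
  assumes t: "t \<in> carrier T" and u: "u \<in> carrier T"
  shows "lift (t \<otimes>\<^bsub>T\<^esub> u) = lift t \<otimes>\<^bsub>S\<^esub> lift u"
proof -
  interpret T: cring T by (rule tensor_cring)
  note [simp] = T.l_distr T.r_distr lift_add lift_closed h.S.l_distr h.S.r_distr
  show ?thesis
    using t
  proof (induction t rule: tensor_induct)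
    case (tens m n)
    then have [simp]: "m \<in> carrier M" "n \<in> carrier N" by simp_all
    show ?case
      using u
    proof (induction u rule: tensor_induct)
      case (tens m' n')
      then show ?case
        by (simp add: tens_mult lift_tens h.S.m_ac)
    qed simp
  qed (use u in simp)
qed

lemma lift_ring_hom: "ring_hom_cring T S lift"
  by (rule ring_hom_cringI'[OF tensor_cring h.S.cring_axioms])
    (rule ring_hom_memI, simp_all add: lift_closed lift_mult lift_add tens_one lift_tens)

end

text \<open>The algebraic content of \<open>is_Theta\<close>, and the common ground on which
  \<open>Theta\<close> and \<open>good_Theta\<close> can be treated alike.\<close>

definition taylor_hom ::
    "'r topring \<Rightarrow> 'a topring \<Rightarrow> ('r \<Rightarrow> 'a) \<Rightarrow> nat \<Rightarrow> (nat \<Rightarrow> 'a \<Rightarrow> 'a) \<Rightarrow> (nat \<Rightarrow> 'a) \<Rightarrow> nat \<Rightarrow>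
      ('a \<Rightarrow> (nat multiset \<Rightarrow> 'a) set) \<Rightarrow> bool" where
  "taylor_hom R A \<rho> d \<sigma> x n T \<longleftrightarrow> T \<in> ring_hom A (Psig A d \<sigma> x n) \<and>
     (\<forall>r \<in> carrier R. T (\<rho> r) = Pconst A d \<sigma> x n (\<rho> r)) \<and>
     (\<forall>i<d. T (x i) = Pconst A d \<sigma> x n (x i) \<oplus>\<^bsub>Psig A d \<sigma> x n\<^esub> Pxi A d \<sigma> x n i) \<and>
     (\<forall>a \<in> carrier A. Pproj A (T a) = a)"

lemma is_Theta_taylor_hom: "is_Theta R A \<rho> d \<sigma> x n T \<Longrightarrow> taylor_hom R A \<rho> d \<sigma> x n T"
  by (simp add: is_Theta_def taylor_hom_def adic_hom_def huber_hom_def)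

lemma Theta_taylor_hom: "sigma_coords R A \<rho> d \<sigma> x \<Longrightarrow> taylor_hom R A \<rho> d \<sigma> x n (Theta R A \<rho> d \<sigma> x n)"
  unfolding Theta_def using theI'[of "is_Theta R A \<rho> d \<sigma> x n"]
  by (intro is_Theta_taylor_hom) (simp add: sigma_coords_def)

lemma huber_ring_cring: "huber_ring A \<Longrightarrow> cring A"
  by (simp add: huber_ring_def topological_ring_def)

lemma ring_of_definition_subring: "ring_of_definition A A0 \<Longrightarrow> subring A0 A"
  by (auto simp: ring_of_definition_def ideal_of_definition_def)

lemma twisted_adic_algebraD:
  assumes "twisted_adic_algebra R A \<rho> d \<sigma>"
  shows "ring_hom_cring R A \<rho>" "\<And>i. i < d \<Longrightarrow> \<sigma> i \<in> ring_hom A A"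
    "\<And>i r. i < d \<Longrightarrow> r \<in> carrier R \<Longrightarrow> \<sigma> i (\<rho> r) = \<rho> r"
  using assms
  by (auto simp: twisted_adic_algebra_def adic_algebra_def adic_hom_def huber_hom_def
    intro: ring_hom_cringI' huber_ring_cring)

lemma twisted_ringI:
  assumes "twisted_adic_algebra R A \<rho> d \<sigma>" "\<forall>i<d. x i \<in> carrier A"
  shows "twisted_ring A d \<sigma> x"
  using twisted_adic_algebraD[OF assms(1)] assms(2)
  by (auto simp: twisted_ring_def twisted_ring_axioms_def ring_hom_cring_def dest: ring_hom_closed)

text \<open>A polynomial over a subring is literally a polynomial over A with coefficients in it, so
  the inclusion is \<open>id\<close>. The point needing proof is that the finite sums in a product
  agree when formed in either ring.\<close>

lemma mpoly_subtop:
  assumes A: "cring A" and S: "subring S A"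
  shows "ring_hom_cring (mpoly (subtop A S) d) (mpoly A d) id"
    and "ring.indexed_const (subtop A S) c = ring.indexed_const A c"
    and "ring.indexed_var (subtop A S) (i :: nat) = ring.indexed_var A i"
proof -
  interpret A: cring A by fact
  interpret B: cring "subtop A S" by (rule subtop_cring[OF A S])
  interpret i: ring_hom_cring "subtop A S" A id by (rule subtop_incl[OF S A])
  show const: "B.indexed_const c = A.indexed_const c" for c
    by (auto simp: A.indexed_const_def B.indexed_const_def)
  show "B.indexed_var i = A.indexed_var i"
    by (auto simp: A.indexed_var_mono B.indexed_var_mono mpoly_monom_def)
  show "ring_hom_cring (mpoly (subtop A S) d) (mpoly A d) id"
  proof (rule ring_hom_cringI'[OF B.mpoly_cring A.mpoly_cring], rule ring_hom_memI)
    show "id p \<in> carrier (mpoly A d)" if "p \<in> carrier (mpoly (subtop A S) d)" for p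
      using that subringE(1)[OF S] by (auto simp: A.carrier_mpoly B.carrier_mpoly)
    show "id (p \<oplus>\<^bsub>mpoly (subtop A S) d\<^esub> q) = id p \<oplus>\<^bsub>mpoly A d\<^esub> id q" for p q
      by (simp add: A.mpoly_add B.mpoly_add)
    show "id \<one>\<^bsub>mpoly (subtop A S) d\<^esub> = \<one>\<^bsub>mpoly A d\<^esub>"
      by (auto simp: A.mpoly_one B.mpoly_one mpoly_monom_def)
    show "id (p \<otimes>\<^bsub>mpoly (subtop A S) d\<^esub> q) = id p \<otimes>\<^bsub>mpoly A d\<^esub> id q"
      if "p \<in> carrier (mpoly (subtop A S) d)" "q \<in> carrier (mpoly (subtop A S) d)" for p q
    proof
      fix m
      have "(\<lambda>l. p l \<otimes>\<^bsub>A\<^esub> q (m - l)) \<in> {l. l \<subseteq># m} \<rightarrow> carrier (subtop A S)"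
        using B.mpoly_coeff_closed[OF that(1)] B.mpoly_coeff_closed[OF that(2)] subringE(6)[OF S]
        by simp
      from i.hom_finsum[OF this] show "id (p \<otimes>\<^bsub>mpoly (subtop A S) d\<^esub> q) m = (id p \<otimes>\<^bsub>mpoly A d\<^esub> id q) m"
        by (simp add: A.mpoly_mult B.mpoly_mult o_def)
    qed
  qed
qed

section \<open>Good coordinates: extending the Taylor morphism from A_0 to A\<close>

locale good_theta =
  fixes R :: "'r topring" and A :: "'a topring" and \<rho> :: "'r \<Rightarrow> 'a" and d :: nat
    and \<sigma> :: "nat \<Rightarrow> 'a \<Rightarrow> 'a" and x :: "nat \<Rightarrow> 'a" and R0 :: "'r set" and A0 :: "'a set" and n :: nat
  assumes good: "good_sigma_coords R A \<rho> d \<sigma> x R0 A0"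
begin

abbreviation "R' \<equiv> subtop R R0"
abbreviation "A' \<equiv> subtop A A0"
abbreviation "HX \<equiv> huber_mpoly R d"
abbreviation "\<phi> \<equiv> mpoly_eval R A \<rho> x"
abbreviation "S0 \<equiv> carrier (mpoly R' d)"
abbreviation "HX' \<equiv> subtop HX S0"

lemma
  shows twisted_A: "twisted_adic_algebra R A \<rho> d \<sigma>"
    and coords_A': "sigma_coords R' A' \<rho> d \<sigma> x"
    and twisted_A': "twisted_adic_algebra R' A' \<rho> d \<sigma>"
    and subring_R0: "subring R0 R" and subring_A0: "subring A0 A" and subring_S0: "subring S0 HX"
    and phi_S0: "\<phi> ` S0 \<subseteq> A0"
    and x_A0: "\<forall>i<d. x i \<in> carrier A'" and x_A: "\<forall>i<d. x i \<in> carrier A"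
    and model: "bij_betw (tensor_lift HX' (alg (\<lambda>a. a) HX) (alg \<phi> A') A (\<lambda>a b. \<phi> a \<otimes>\<^bsub>A\<^esub> b))
           (carrier (tensor HX' (alg (\<lambda>a. a) HX) (alg \<phi> A'))) (carrier A)"
  using good
  by (auto simp: good_sigma_coords_def good_etale_coords_def good_etale_with_model_def
      sigma_coords_def Let_def intro: ring_of_definition_subring)

sublocale rho: ring_hom_cring R A \<rho> by (rule twisted_adic_algebraD(1)[OF twisted_A])
sublocale A1: twisted_ring A d \<sigma> x by (rule twisted_ringI[OF twisted_A x_A])
sublocale A2: twisted_ring A' d \<sigma> x by (rule twisted_ringI[OF twisted_A' x_A0])
sublocale rho': ring_hom_cring R' A' \<rho> by (rule twisted_adic_algebraD(1)[OF twisted_A'])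

sublocale phi: mpoly_evaluation R A \<rho> d x
  by (simp add: mpoly_evaluation_def mpoly_evaluation_axioms_def rho.ring_hom_cring_axioms A1.x_closed)

lemma cA: "cring A" and cA': "cring A'"
  by (rule rho.S.cring_axioms A2.cring_axioms)+

lemma HX_simps [simp]:
  "carrier HX = carrier (mpoly R d)" "monoid.mult HX = monoid.mult (mpoly R d)"
  "\<one>\<^bsub>HX\<^esub> = \<one>\<^bsub>mpoly R d\<^esub>" "\<zero>\<^bsub>HX\<^esub> = \<zero>\<^bsub>mpoly R d\<^esub>" "add HX = add (mpoly R d)"
  by (simp_all add: huber_mpoly_def)

lemma HX_cring: "cring HX"
  using rho.R.mpoly_cring by (rule cring_cong) simp_all

lemma phi_hom: "ring_hom_cring HX A \<phi>"
  by (rule ring_hom_cringI'[OF HX_cring cA])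
    (use phi.ev_ring_hom in \<open>simp add: ring_hom_def\<close>)

lemma incl_A: "ring_hom_cring A' A id"
  by (rule subtop_incl[OF subring_A0 cA])

lemma incl_R: "ring_hom_cring R' R id"
  by (rule subtop_incl[OF subring_R0 rho.R.cring_axioms])

lemma incl_HX: "ring_hom_cring HX' HX id"
  by (rule subtop_incl[OF subring_S0 HX_cring])

lemma phi_hom': "ring_hom_cring HX' A' \<phi>"
proof (rule ring_hom_cringI'[OF subtop_cring[OF HX_cring subring_S0] cA'])
  interpret phi: ring_hom_cring HX A \<phi> by (rule phi_hom)
  have "S0 \<subseteq> carrier HX" by (rule subringE(1)[OF subring_S0])
  then show "\<phi> \<in> ring_hom HX' A'"
    using phi_S0 phi.hom_mult phi.hom_add phi.hom_one by (intro ring_hom_memI) (auto simp: subset_iff)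
qed

abbreviation "P \<equiv> Psig A d \<sigma> x n"
abbreviation "P' \<equiv> Psig A' d \<sigma> x n"
abbreviation "\<Theta>' \<equiv> Theta R' A' \<rho> d \<sigma> x n"

text \<open>The comparison map from the truncated ring over A_0 to that over A, written as it occurs
  inside \<open>good_Theta\<close>.\<close>

definition \<iota> :: "(nat multiset \<Rightarrow> 'a) set \<Rightarrow> (nat multiset \<Rightarrow> 'a) set" where
  "\<iota> = induced (\<lambda>p. Pideal A d \<sigma> x n +>\<^bsub>mpoly A d\<^esub> p)"

lemma proj_hom': "A1.proj n \<in> ring_hom (mpoly A' d) P"
  using ring_hom_trans[OF ring_hom_cring.homh[OF mpoly_subtop(1)[OF cA subring_A0]]
    A1.proj_ring_hom] by simp

text \<open>Constants and variables over A_0 and over A are the same functions, so a twisted power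
  over A_0 is sent to the product that vanishes by the relation over A.\<close>

lemma proj_twisted_power':
  assumes "(\<Sum>i<d. k i) = n + 1"
  shows "A1.proj n (twisted_power A' d \<sigma> x k) = \<zero>\<^bsub>P\<^esub>"
proof -
  have "ring_hom_cring (mpoly A' d) P (A1.proj n)"
    by (rule ring_hom_cringI'[OF A2.mpoly_cring A1.Psig_cring proj_hom'])
  from A2.hom_twisted_power[OF this] A1.twisted_relation[OF assms] show ?thesis
    by (simp add: mpoly_subtop(2,3)[OF cA subring_A0] A1.Pconst_proj A1.Pxi_proj)
qed

lemma iota_hom: "ring_hom_cring P' P \<iota>"
  and iota_proj: "p \<in> carrier (mpoly A' d) \<Longrightarrow> \<iota> (A2.proj n p) = A1.proj n p"
proof -
  have \<iota>: "\<iota> = induced (A1.proj n)" by (simp add: \<iota>_def A1.proj_def[abs_def])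
  note * = A2.Psig_induced[OF A1.Psig_cring proj_hom' proj_twisted_power', folded \<iota>]
  show "ring_hom_cring P' P \<iota>"
    by (rule ring_hom_cringI'[OF A2.Psig_cring A1.Psig_cring]) (rule *(1))
  show "p \<in> carrier (mpoly A' d) \<Longrightarrow> \<iota> (A2.proj n p) = A1.proj n p"
    by (rule *(2))
qed

sublocale iota: ring_hom_cring P' P \<iota> by (rule iota_hom)

lemma iota_const: "a \<in> A0 \<Longrightarrow> \<iota> (A2.pc n a) = A1.pc n a"
  using A2.indexed_const_closed[of a d]
  by (simp add: A2.Pconst_proj A1.Pconst_proj iota_proj)
    (simp add: mpoly_subtop(2)[OF cA subring_A0])

lemma iota_xi: "i < d \<Longrightarrow> \<iota> (A2.xi n i) = A1.xi n i"
  using A2.indexed_var_closed[of i d]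
  by (simp add: A2.Pxi_proj A1.Pxi_proj iota_proj)
    (simp add: mpoly_subtop(3)[OF cA subring_A0])

lemma Pproj_iota: "V \<in> carrier P' \<Longrightarrow> Pproj A (\<iota> V) = Pproj A' V"
proof (induction V rule: A2.Psig_induct)
  case (const c)
  moreover from this have "c \<in> carrier A" using subringE(1)[OF subring_A0] by auto
  ultimately show ?case by (simp add: iota_const)
qed (simp_all add: iota_xi)

lemma taylor': "taylor_hom R' A' \<rho> d \<sigma> x n \<Theta>'"
  by (rule Theta_taylor_hom[OF coords_A'])

sublocale Th: ring_hom_cring A' P' \<Theta>'
  using taylor' by (intro ring_hom_cringI'[OF cA' A2.Psig_cring]) (simp add: taylor_hom_def)

lemma k_hom: "ring_hom_cring A' P (\<lambda>b. \<iota> (\<Theta>' b))"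
  using ring_hom_trans[OF Th.homh iota.homh]
  by (intro ring_hom_cringI'[OF cA' A1.Psig_cring]) (simp add: o_def)

sublocale ev: mpoly_evaluation R P "\<lambda>r. A1.pc n (\<rho> r)" d "\<lambda>i. A1.pc n (x i) \<oplus>\<^bsub>P\<^esub> A1.xi n i"
proof -
  have "ring_hom_cring R P (\<lambda>r. A1.pc n (\<rho> r))"
    using ring_hom_trans[OF rho.homh A1.pc.homh]
    by (intro ring_hom_cringI'[OF rho.R.cring_axioms A1.Psig_cring]) (simp add: o_def)
  then show "mpoly_evaluation R P (\<lambda>r. A1.pc n (\<rho> r)) d (\<lambda>i. A1.pc n (x i) \<oplus>\<^bsub>P\<^esub> A1.xi n i)"
    by (simp add: mpoly_evaluation_def mpoly_evaluation_axioms_def A1.x_closed)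
qed

lemma ev_hom: "ring_hom_cring HX P ev.ev"
  by (rule ring_hom_cringI'[OF HX_cring A1.Psig_cring])
    (use ev.ev_ring_hom in \<open>simp add: ring_hom_def\<close>)

text \<open>Two ring maps on R_0[X] that agree on constants and variables. This is the compatibility
  needed to glue them into a map on the tensor product of R[X] and A_0 over R_0[X].\<close>

lemma ev_S0:
  assumes "p \<in> S0"
  shows "ev.ev p = \<iota> (\<Theta>' (\<phi> p))"
proof (rule rho'.R.mpoly_hom_eq[OF _ _ _ _ assms])
  note cR = mpoly_subtop[OF rho.R.cring_axioms subring_R0]
  interpret i: ring_hom_cring "mpoly R' d" "mpoly R d" id by (rule cR(1))
  show "ring_hom_cring (mpoly R' d) P ev.ev"
    using ring_hom_trans[OF i.homh ev.ev_ring_hom]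
    by (intro ring_hom_cringI'[OF rho'.R.mpoly_cring A1.Psig_cring]) simp
  have "\<phi> \<in> ring_hom (mpoly R' d) A'"
    using ring_hom_trans[OF i.homh phi.ev_ring_hom] phi_S0 by (auto simp: ring_hom_def)
  from ring_hom_trans[OF this ring_hom_cring.homh[OF k_hom]]
  show "ring_hom_cring (mpoly R' d) P (\<lambda>p. \<iota> (\<Theta>' (\<phi> p)))"
    by (intro ring_hom_cringI'[OF rho'.R.mpoly_cring A1.Psig_cring]) (simp add: o_def)
  fix c assume c: "c \<in> carrier R'"
  then have "c \<in> carrier R" "\<rho> c \<in> A0" using subringE(1)[OF subring_R0] rho'.hom_closed[of c] by auto
  with c taylor' show "ev.ev (rho'.R.indexed_const c) = \<iota> (\<Theta>' (\<phi> (rho'.R.indexed_const c)))"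
    by (simp add: cR(2) ev.ev_const phi.ev_const taylor_hom_def iota_const)
next
  note cR = mpoly_subtop[OF rho.R.cring_axioms subring_R0]
  fix i assume i: "i < d"
  then show "ev.ev (rho'.R.indexed_var i) = \<iota> (\<Theta>' (\<phi> (rho'.R.indexed_var i)))"
    using taylor' x_A0 A2.pc.hom_closed[of "x i" n]
    by (simp add: cR(3) ev.ev_var phi.ev_var taylor_hom_def iota_const iota_xi)
qed

section \<open>Maps out of the tensor products over R_0[X] and over R_0\<close>

lemma can_phi: "alg_pair HX' HX A' A (\<lambda>p. p) \<phi> \<phi> (\<lambda>b. b)"
proof -
  show ?thesis
    using incl_HX[unfolded id_def] phi_hom incl_A[unfolded id_def] phi_hom' by (simp add: alg_pair_def alg_pair_axioms_def)
qed

lemma can_ev: "alg_pair HX' HX A' P (\<lambda>p. p) \<phi> ev.ev (\<lambda>b. \<iota> (\<Theta>' b))"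
proof -
  show ?thesis
    using incl_HX[unfolded id_def] phi_hom' ev_hom k_hom ev_S0 by (simp add: alg_pair_def alg_pair_axioms_def)
qed

lemma can_A: "alg_pair R' R A' A (\<lambda>r. r) \<rho> \<rho> (\<lambda>b. b)"
proof -
  show ?thesis
    using incl_R[unfolded id_def] rho.ring_hom_cring_axioms rho'.ring_hom_cring_axioms incl_A[unfolded id_def]
    by (simp add: alg_pair_def alg_pair_axioms_def)
qed

lemma pc_rho_hom': "ring_hom_cring R' P' (\<lambda>r. A2.pc n (\<rho> r))"
  using ring_hom_trans[OF rho'.homh A2.pc.homh]
  by (intro ring_hom_cringI'[OF rho'.R.cring_axioms A2.Psig_cring]) (simp add: o_def)

lemma can_P: "alg_pair R' R P' P (\<lambda>r. r) (\<lambda>r. A2.pc n (\<rho> r)) (\<lambda>r. A1.pc n (\<rho> r)) \<iota>"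
proof -
  have "A1.pc n (\<rho> r) = \<iota> (A2.pc n (\<rho> r))" if "r \<in> R0" for r
    using that rho'.hom_closed[of r] by (simp add: iota_const)
  then show ?thesis
    using incl_R[unfolded id_def] ev.ring_hom_cring_axioms pc_rho_hom' iota_hom
    by (simp add: alg_pair_def alg_pair_axioms_def)
qed

abbreviation "T\<phi> \<equiv> tensor HX' (alg (\<lambda>p. p) HX) (alg \<phi> A')"
abbreviation "TA \<equiv> tensor R' (alg (\<lambda>r. r) R) (alg \<rho> A')"
abbreviation "TP \<equiv> tensor R' (alg (\<lambda>r. r) R) (alg (\<lambda>r. A2.pc n (\<rho> r)) P')"
abbreviation "tn\<phi> \<equiv> tens HX' (alg (\<lambda>p. p) HX) (alg \<phi> A')"
abbreviation "tnA \<equiv> tens R' (alg (\<lambda>r. r) R) (alg \<rho> A')"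
abbreviation "tnP \<equiv> tens R' (alg (\<lambda>r. r) R) (alg (\<lambda>r. A2.pc n (\<rho> r)) P')"
abbreviation "can\<phi> \<equiv> tensor_lift HX' (alg (\<lambda>p. p) HX) (alg \<phi> A') A (\<lambda>p b. \<phi> p \<otimes>\<^bsub>A\<^esub> b)"
abbreviation "canE \<equiv> tensor_lift HX' (alg (\<lambda>p. p) HX) (alg \<phi> A') P (\<lambda>p b. ev.ev p \<otimes>\<^bsub>P\<^esub> \<iota> (\<Theta>' b))"
abbreviation "canA \<equiv> tensor_lift R' (alg (\<lambda>r. r) R) (alg \<rho> A') A (\<lambda>r b. \<rho> r \<otimes>\<^bsub>A\<^esub> b)"
abbreviation "canP \<equiv> tensor_lift R' (alg (\<lambda>r. r) R) (alg (\<lambda>r. A2.pc n (\<rho> r)) P') P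
  (\<lambda>r V. A1.pc n (\<rho> r) \<otimes>\<^bsub>P\<^esub> \<iota> V)"
abbreviation "idTh \<equiv> tensor_lift R' (alg (\<lambda>r. r) R) (alg \<rho> A') TP (\<lambda>r b. tnP r (\<Theta>' b))"

lemmas tp\<phi> = alg_pair.is_tensor_product[OF can_phi]
lemmas tpA = alg_pair.is_tensor_product[OF can_A]
lemmas tpP = alg_pair.is_tensor_product[OF can_P]

lemmas T\<phi>_induct [consumes 1, case_names tens add] = tensor_product.tensor_induct[OF tp\<phi>]
lemmas tn\<phi>_closed = tensor_product.tens_closed[OF tp\<phi>, simplified]
lemmas tnA_closed = tensor_product.tens_closed[OF tpA, simplified]

text \<open>Balanced because the Taylor morphism on A_0 sends elements coming from R_0 to constants
  and is therefore R_0-linear.\<close>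

lemma id_Th: "balanced_map R' (alg (\<lambda>r. r) R) (alg \<rho> A') TP (\<lambda>r b. tnP r (\<Theta>' b))"
proof (rule balanced_map.intro[OF tpA tensor_product.tensor_abelian_group[OF tpP]], unfold_locales)
  fix r s b assume "r \<in> carrier R'" "s \<in> carrier (alg (\<lambda>r. r) R)" "b \<in> carrier (alg \<rho> A')"
  then show "tnP (r \<odot>\<^bsub>alg (\<lambda>r. r) R\<^esub> s) (\<Theta>' b) = tnP s (\<Theta>' (r \<odot>\<^bsub>alg \<rho> A'\<^esub> b))"
    using tensor_product.tens_smult[OF tpP, of r s "\<Theta>' b"] Th.hom_mult[of "\<rho> r" b] Th.hom_closed[of b] taylor'
      rho'.hom_closed[of r]
    by (simp add: taylor_hom_def)
next
  fix r b c assume "r \<in> carrier (alg (\<lambda>r. r) R)" "b \<in> carrier (alg \<rho> A')" "c \<in> carrier (alg \<rho> A')"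
  then show "tnP r (\<Theta>' (b \<oplus>\<^bsub>alg \<rho> A'\<^esub> c)) = tnP r (\<Theta>' b) \<oplus>\<^bsub>TP\<^esub> tnP r (\<Theta>' c)"
    using Th.hom_add[of b c] tensor_product.tens_add_right[OF tpP, of r "\<Theta>' b" "\<Theta>' c"] Th.hom_closed[of b] Th.hom_closed[of c]
    by simp
next
  fix r s b assume "r \<in> carrier (alg (\<lambda>r. r) R)" "s \<in> carrier (alg (\<lambda>r. r) R)" "b \<in> carrier (alg \<rho> A')"
  then show "tnP (r \<oplus>\<^bsub>alg (\<lambda>r. r) R\<^esub> s) (\<Theta>' b) = tnP r (\<Theta>' b) \<oplus>\<^bsub>TP\<^esub> tnP s (\<Theta>' b)"
    using tensor_product.tens_add_left[OF tpP, of r s "\<Theta>' b"] Th.hom_closed[of b] by simp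
next
  fix r b assume "r \<in> carrier (alg (\<lambda>r. r) R)" "b \<in> carrier (alg \<rho> A')"
  then show "tnP r (\<Theta>' b) \<in> carrier TP"
    using tensor_product.tens_closed[OF tpP, of r "\<Theta>' b"] Th.hom_closed[of b] by simp
qed

lemmas canphi_lift_closed = balanced_map.lift_closed[OF alg_pair.is_balanced_map[OF can_phi]]
lemmas canphi_lift_add = balanced_map.lift_add[OF alg_pair.is_balanced_map[OF can_phi]]
lemmas canphi_lift_tens = balanced_map.lift_tens[OF alg_pair.is_balanced_map[OF can_phi], simplified]
lemmas canphi_lift_mult = alg_pair.lift_mult[OF can_phi]
lemmas canev_lift_closed = balanced_map.lift_closed[OF alg_pair.is_balanced_map[OF can_ev]]
lemmas canev_lift_add = balanced_map.lift_add[OF alg_pair.is_balanced_map[OF can_ev]]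
lemmas canev_lift_tens = balanced_map.lift_tens[OF alg_pair.is_balanced_map[OF can_ev], simplified]
lemmas canev_lift_mult = alg_pair.lift_mult[OF can_ev]
lemmas canA_lift_closed = balanced_map.lift_closed[OF alg_pair.is_balanced_map[OF can_A]]
lemmas canA_lift_add = balanced_map.lift_add[OF alg_pair.is_balanced_map[OF can_A]]
lemmas canA_lift_tens = balanced_map.lift_tens[OF alg_pair.is_balanced_map[OF can_A], simplified]
lemmas canP_lift_closed = balanced_map.lift_closed[OF alg_pair.is_balanced_map[OF can_P]]
lemmas canP_lift_add = balanced_map.lift_add[OF alg_pair.is_balanced_map[OF can_P]]
lemmas canP_lift_tens = balanced_map.lift_tens[OF alg_pair.is_balanced_map[OF can_P], simplified]
lemmas idTh_lift_closed = balanced_map.lift_closed[OF id_Th]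
lemmas idTh_lift_add = balanced_map.lift_add[OF id_Th]
lemmas idTh_lift_tens = balanced_map.lift_tens[OF id_Th, simplified]

lemma canphi_bij: "bij_betw can\<phi> (carrier T\<phi>) (carrier A)"
  by (rule model)

text \<open>By surjectivity of the canonical map of the good model, A is generated additively by
  products of a value of \<open>\<phi>\<close> and an element of A_0.\<close>

lemma A_induct [consumes 1, case_names mult add]:
  assumes "a \<in> carrier A"
    and "\<And>p b. p \<in> carrier (mpoly R d) \<Longrightarrow> b \<in> A0 \<Longrightarrow> Q (\<phi> p \<otimes>\<^bsub>A\<^esub> b)"
    and add: "\<And>a b. a \<in> carrier A \<Longrightarrow> b \<in> carrier A \<Longrightarrow> Q a \<Longrightarrow> Q b \<Longrightarrow> Q (a \<oplus>\<^bsub>A\<^esub> b)"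
  shows "Q a"
proof -
  obtain t where t: "t \<in> carrier T\<phi>" "a = can\<phi> t"
    using assms(1) canphi_bij by (auto simp: bij_betw_def)
  have "Q (can\<phi> t)"
    using t(1)
  proof (induction t rule: T\<phi>_induct)
    case (tens p b)
    then show ?case using assms(2)[of p b] by (simp add: canphi_lift_tens)
  next
    case (add t u)
    then show ?case
      using assms(3)[of "can\<phi> t" "can\<phi> u"] by (simp add: canphi_lift_add canphi_lift_closed)
  qed
  with t show ?thesis by simp
qed

text \<open>Since the \<open>x\<^sub>i\<close> lie in \<open>A\<^sub>0\<close>, surjectivity of \<open>R[X] \<otimes>\<^bsub>R\<^sub>0[X]\<^esub> A\<^sub>0 \<rightarrow> A\<close> passes to
  \<open>R \<otimes>\<^bsub>R\<^sub>0\<^esub> A\<^sub>0 \<rightarrow> A\<close>. Surjectivity suffices to compare \<^const>\<open>good_Theta\<close>, which picks preimages under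
  the second map, with the map \<open>\<Theta>\<close> below, which uses the bijectivity of the first.\<close>

lemma canA_surj: "canA ` carrier TA = carrier A"
proof
  interpret TA: abelian_group TA by (rule tensor_product.tensor_abelian_group[OF tpA])
  show "canA ` carrier TA \<subseteq> carrier A" by (auto simp: canA_lift_closed)
  have "\<phi> p \<otimes>\<^bsub>A\<^esub> b \<in> canA ` carrier TA" if "p \<in> carrier (mpoly R d)" "b \<in> A0" for p b
    using that
  proof (induction p arbitrary: b rule: rho.R.mpoly_induct)
    case (const c)
    have "\<rho> c \<otimes>\<^bsub>A\<^esub> b = canA (tnA c b)"
      using const by (simp add: canA_lift_tens)
    with const tnA_closed[of c b] show ?case by (auto simp: phi.ev_const)
  next
    case (add p q)
    obtain t u where "t \<in> carrier TA" "u \<in> carrier TA"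
      "\<phi> p \<otimes>\<^bsub>A\<^esub> b = canA t" "\<phi> q \<otimes>\<^bsub>A\<^esub> b = canA u"
      using add(3)[OF add(5)] add(4)[OF add(5)] by blast
    moreover have "b \<in> carrier A" using add(5) subringE(1)[OF subring_A0] by blast
    ultimately have "\<phi> (p \<oplus>\<^bsub>mpoly R d\<^esub> q) \<otimes>\<^bsub>A\<^esub> b = canA (t \<oplus>\<^bsub>TA\<^esub> u)"
      using add(1,2) by (simp add: phi.ev_add phi.ev_closed rho.S.l_distr canA_lift_add)
    with \<open>t \<in> _\<close> \<open>u \<in> _\<close> show ?case
      by (intro image_eqI[of _ _ "t \<oplus>\<^bsub>TA\<^esub> u"]) (simp_all only: TA.a_closed)
  next
    case (var i p)
    \<comment> \<open>The variable is absorbed into the factor from A_0, which remains in A_0; for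
      this reason the induction hypothesis ranges over all \<open>b\<close>.\<close>
    have b: "b \<in> carrier A" "x i \<otimes>\<^bsub>A\<^esub> b \<in> A0"
      using var(1,4) subringE(1,6)[OF subring_A0] x_A0 by auto
    have "\<phi> (rho.R.indexed_var i \<otimes>\<^bsub>mpoly R d\<^esub> p) \<otimes>\<^bsub>A\<^esub> b = \<phi> p \<otimes>\<^bsub>A\<^esub> (x i \<otimes>\<^bsub>A\<^esub> b)"
      using var(1,2) b(1) 
      by (simp add: phi.ev_mult phi.ev_var phi.ev_closed rho.R.indexed_var_closed A1.x_closed rho.S.m_ac)
    with var(3)[OF b(2)] show ?case by simp
  qed
  then show "carrier A \<subseteq> canA ` carrier TA"
  proof (intro subsetI)
    fix a assume mult: "\<And>p b. p \<in> carrier (mpoly R d) \<Longrightarrow> b \<in> A0 \<Longrightarrow>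
      \<phi> p \<otimes>\<^bsub>A\<^esub> b \<in> canA ` carrier TA" and "a \<in> carrier A"
    from this(2) show "a \<in> canA ` carrier TA"
    proof (induction a rule: A_induct)
      case (add a b)
      then obtain t u where "t \<in> carrier TA" "u \<in> carrier TA"
        "a = canA t" "b = canA u" by blast
      then show ?case by (intro image_eqI[of _ _ "t \<oplus>\<^bsub>TA\<^esub> u"]) (simp_all add: canA_lift_add)
    qed (rule mult)
  qed
qed

section \<open>The Taylor morphism on A and its agreement with \<open>good_Theta\<close>\<close>

definition \<Theta> :: "'a \<Rightarrow> (nat multiset \<Rightarrow> 'a) set" where
  "\<Theta> a = canE (inv_into (carrier T\<phi>) can\<phi> a)"

lemma Theta_lift: "t \<in> carrier T\<phi> \<Longrightarrow> \<Theta> (can\<phi> t) = canE t"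
  unfolding \<Theta>_def using canphi_bij by (simp add: bij_betw_def)

lemma Theta_tens: "p \<in> carrier (mpoly R d) \<Longrightarrow> b \<in> A0 \<Longrightarrow> \<Theta> (\<phi> p \<otimes>\<^bsub>A\<^esub> b) = ev.ev p \<otimes>\<^bsub>P\<^esub> \<iota> (\<Theta>' b)"
  using Theta_lift[of "tn\<phi> p b"] tn\<phi>_closed[of p b] by (simp add: canphi_lift_tens canev_lift_tens)

lemma Theta_hom: "ring_hom_cring A P \<Theta>"
proof (rule ring_hom_cringI'[OF cA A1.Psig_cring], rule ring_hom_memI)
  have ex: "\<exists>t\<in>carrier T\<phi>. a = can\<phi> t" if "a \<in> carrier A" for a
    using that canphi_bij by (auto simp: bij_betw_def)
  interpret T: cring T\<phi> by (rule alg_pair.tensor_is_cring[OF can_phi])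
  fix a assume a: "a \<in> carrier A"
  then obtain t where t: "t \<in> carrier T\<phi>" "a = can\<phi> t" using ex by blast
  then show "\<Theta> a \<in> carrier P" by (simp add: Theta_lift canev_lift_closed)
  fix b assume b: "b \<in> carrier A"
  then obtain u where u: "u \<in> carrier T\<phi>" "b = can\<phi> u" using ex by blast
  show "\<Theta> (a \<oplus>\<^bsub>A\<^esub> b) = \<Theta> a \<oplus>\<^bsub>P\<^esub> \<Theta> b"
    using t u Theta_lift[of "t \<oplus>\<^bsub>T\<phi>\<^esub> u"] by (simp add: Theta_lift canphi_lift_add canev_lift_add)
  show "\<Theta> (a \<otimes>\<^bsub>A\<^esub> b) = \<Theta> a \<otimes>\<^bsub>P\<^esub> \<Theta> b"
    using t u Theta_lift[of "t \<otimes>\<^bsub>T\<phi>\<^esub> u"] by (simp add: Theta_lift canphi_lift_mult canev_lift_mult)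
next
  interpret phi: ring_hom_cring HX A \<phi> by (rule phi_hom)
  interpret ev: ring_hom_cring HX P ev.ev by (rule ev_hom)
  show "\<Theta> \<one>\<^bsub>A\<^esub> = \<one>\<^bsub>P\<^esub>"
    using Theta_tens[of "\<one>\<^bsub>HX\<^esub>" "\<one>\<^bsub>A'\<^esub>"] phi.hom_one ev.hom_one Th.hom_one phi.R.one_closed A2.one_closed
    by simp
qed

lemma Theta_base: "p \<in> carrier (mpoly R d) \<Longrightarrow> \<Theta> (\<phi> p) = ev.ev p"
  using Theta_tens[of p "\<one>\<^bsub>A'\<^esub>"] Th.hom_one A2.one_closed
  by (simp add: phi.ev_closed ev.ev_closed)

lemma Pproj_ev:
  assumes "p \<in> carrier (mpoly R d)"
  shows "Pproj A (ev.ev p) = \<phi> p"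
proof (rule rho.R.mpoly_hom_eq[OF _ _ _ _ assms])
  show "ring_hom_cring (mpoly R d) A (\<lambda>p. Pproj A (ev.ev p))"
    using ring_hom_trans[OF ev.ev_ring_hom A1.Pproj.homh]
    by (intro ring_hom_cringI'[OF rho.R.mpoly_cring cA]) (simp add: o_def)
  show "ring_hom_cring (mpoly R d) A \<phi>"
    by (rule ring_hom_cringI'[OF rho.R.mpoly_cring cA phi.ev_ring_hom])
qed (simp_all add: ev.ev_const ev.ev_var phi.ev_const phi.ev_var A1.x_closed)

lemma Theta_taylor: "taylor_hom R A \<rho> d \<sigma> x n \<Theta>"
proof -
  interpret Theta: ring_hom_cring A P \<Theta> by (rule Theta_hom)
  have "\<Theta> (\<rho> r) = A1.pc n (\<rho> r)" if "r \<in> carrier R" for r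
    using Theta_base[OF rho.R.indexed_const_closed[OF that]] that
    by (simp add: phi.ev_const ev.ev_const)
  moreover have "\<Theta> (x i) = A1.pc n (x i) \<oplus>\<^bsub>P\<^esub> A1.xi n i" if "i < d" for i
    using Theta_base[OF rho.R.indexed_var_closed[OF that]] that
    by (simp add: phi.ev_var ev.ev_var)
  \<comment> \<open>On a generator the augmentation returns the polynomial value by
    \<open>Pproj_ev\<close> and the factor from A_0 by the section property of the Taylor morphism
    there.\<close>
  moreover have "Pproj A (\<Theta> a) = a" if "a \<in> carrier A" for a
    using that
  proof (induction a rule: A_induct)
    case (mult p b)
    then have "Pproj A' (\<Theta>' b) = b" using taylor' by (simp add: taylor_hom_def)
    with mult show ?case
      by (simp add: Theta_tens Pproj_ev ev.ev_closed Pproj_iota)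
  qed simp
  ultimately show ?thesis
    using Theta.homh by (simp add: taylor_hom_def)
qed

text \<open>The two ways around the square from R (x) A_0 to P_(n) are additive and agree on pure
  tensors. Hence the value does not depend on the preimage that \<open>inv_into\<close>
  selects.\<close>

lemma good_Theta_eq:
  assumes "a \<in> carrier A"
  shows "good_Theta R A \<rho> d \<sigma> x R0 A0 n a = \<Theta> a"
proof -
  interpret Theta: ring_hom_cring A P \<Theta> by (rule Theta_hom)
  let ?t = "inv_into (carrier TA) canA a"
  have t: "?t \<in> carrier TA" "canA ?t = a"
    using assms canA_surj by (auto intro: inv_into_into f_inv_into_f)
  have "canP (idTh t) = \<Theta> (canA t)" if "t \<in> carrier TA" for t
    using that
  proof (rule tensor_product.additive_eq[OF tpA A1.P.abelian_group_axioms, rotated -1])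
    fix r b assume rb: "r \<in> carrier (alg (\<lambda>r. r) R)" "b \<in> carrier (alg \<rho> A')"
    then have "canP (idTh (tnA r b)) = A1.pc n (\<rho> r) \<otimes>\<^bsub>P\<^esub> \<iota> (\<Theta>' b)"
      using Th.hom_closed[of b] by (simp add: idTh_lift_tens canP_lift_tens)
    moreover have "\<Theta> (canA (tnA r b)) = A1.pc n (\<rho> r) \<otimes>\<^bsub>P\<^esub> \<iota> (\<Theta>' b)"
      using rb Theta_tens[OF rho.R.indexed_const_closed, of r b]
      by (simp add: canA_lift_tens phi.ev_const ev.ev_const)
    ultimately show "canP (idTh (tnA r b)) = \<Theta> (canA (tnA r b))" by simp
  qed (auto simp: canP_lift_closed canA_lift_closed idTh_lift_closed
      canP_lift_add canA_lift_add idTh_lift_add)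
  from this[OF t(1)] t(2) show ?thesis
    by (simp add: good_Theta_def Let_def tensor_map_def \<iota>_def)
qed

lemma good_Theta_taylor_hom:
  "taylor_hom R A \<rho> d \<sigma> x n (good_Theta R A \<rho> d \<sigma> x R0 A0 n)"
  using Theta_taylor good_Theta_eq A1.x_closed
  by (simp add: taylor_hom_def ring_hom_def Pi_iff)

end

lemma coords_taylor_hom:
  assumes "sigma_coords R A \<rho> d \<sigma> x \<and> \<theta> = Theta R A \<rho> d \<sigma> x \<or>
         (\<exists>R0 A0. good_sigma_coords R A \<rho> d \<sigma> x R0 A0 \<and> \<theta> = good_Theta R A \<rho> d \<sigma> x R0 A0)"
  shows "taylor_hom R A \<rho> d \<sigma> x n (\<theta> n)"
  using assms Theta_taylor_hom good_theta.good_Theta_taylor_hom[OF good_theta.intro]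
  by metis

section \<open>Twisted differential forms\<close>

lemma ring_hom_ring_of_cring:
  assumes "ring_hom_cring R S h"
  shows "ring_hom_ring R S h"
proof -
  interpret ring_hom_cring R S h by fact
  show ?thesis by (rule ring.ring_hom_ring_axioms)
qed

locale twisted_calculus = twisted_ring_1 A d \<sigma> x + rho: ring_hom_cring R A \<rho>
  for R :: "'r topring" and A :: "'a topring" (structure) and \<rho> d \<sigma> x +
  fixes \<theta> :: "nat \<Rightarrow> 'a \<Rightarrow> (nat multiset \<Rightarrow> 'a) set"
  assumes taylor: "\<And>n. taylor_hom R A \<rho> d \<sigma> x n (\<theta> n)"
    and classical: "classical_coords A d \<sigma> x \<theta>"
    and sigma_rho: "\<And>i r. i < d \<Longrightarrow> r \<in> carrier R \<Longrightarrow> \<sigma> i (\<rho> r) = \<rho> r"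
begin

lemma theta_hom: "ring_hom_cring A (P n) (\<theta> n)"
  using taylor[of n]
  by (intro ring_hom_cringI'[OF cring_axioms Psig_cring]) (simp add: taylor_hom_def)

lemma theta_closed [simp]: "a \<in> carrier A \<Longrightarrow> \<theta> n a \<in> carrier (P n)"
  using ring_hom_closed[OF ring_hom_cring.homh[OF theta_hom]] .

lemma theta_rho: "r \<in> carrier R \<Longrightarrow> \<theta> n (\<rho> r) = pc n (\<rho> r)"
  and theta_x: "i < d \<Longrightarrow> \<theta> n (x i) = pc n (x i) \<oplus>\<^bsub>P n\<^esub> xi n i"
  and Pproj_theta [simp]: "a \<in> carrier A \<Longrightarrow> Pproj A (\<theta> n a) = a"
  using taylor[of n] by (auto simp: taylor_hom_def)

abbreviation "tder i a \<equiv> twisted_deriv A d \<sigma> x \<theta> i a"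

lemma deriv_coef: "i < d \<Longrightarrow> a \<in> carrier A \<Longrightarrow> tder i a = coef i (\<theta> 1 a)"
  by (rule twisted_deriv_coef) simp_all

text \<open>Classicality in the form in which it is applied: the multiplier that
  \<open>coef_mult\<close> attaches to a xi_i-coefficient is the value of sigma_i.\<close>

lemma sigma_coef: "i < d \<Longrightarrow> a \<in> carrier A \<Longrightarrow> \<sigma> i a = a \<oplus> qq i \<otimes> coef i (\<theta> 1 a)"
  using classical unfolding classical_coords_def by (simp add: qq_def deriv_coef)

lemma deriv_rho: "i < d \<Longrightarrow> r \<in> carrier R \<Longrightarrow> tder i (\<rho> r) = \<zero>"
  by (simp add: deriv_coef theta_rho)

section \<open>The map from A (x) A to the truncated rings and its kernels\<close>

abbreviation "TT \<equiv> AA R A \<rho>"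
abbreviation "ta \<equiv> tens R (alg \<rho> A) (alg \<rho> A)"
abbreviation "to_P n \<equiv> AA_to_P R A \<rho> d \<sigma> x \<theta> n"
abbreviation "I2 \<equiv> tw_ideal R A \<rho> d \<sigma> x \<theta> 1"
abbreviation "I1 \<equiv> tw_ideal R A \<rho> d \<sigma> x \<theta> 0"
abbreviation "\<Omega> \<equiv> Omega R A \<rho> d \<sigma> x \<theta>"
abbreviation "E \<equiv> Omega_to_P R A \<rho> d \<sigma> x \<theta>"

text \<open>P_(n) is an A-algebra in two ways, through constants and through the Taylor morphism,
  and these agree on R.\<close>

lemma AA_pair: "alg_pair R A A (P n) \<rho> \<rho> (pc n) (\<theta> n)"
  by (simp add: alg_pair_def alg_pair_axioms_def rho.ring_hom_cring_axioms pc.ring_hom_cring_axioms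
    theta_hom theta_rho)

lemmas AA_product = alg_pair.is_tensor_product[OF AA_pair, folded AA_def]

lemma to_P_hom: "ring_hom_cring TT (P n) (to_P n)"
  using alg_pair.lift_ring_hom[OF AA_pair] unfolding AA_def AA_to_P_def .

lemma ta_closed: "a \<in> carrier A \<Longrightarrow> b \<in> carrier A \<Longrightarrow> ta a b \<in> carrier TT"
  using tensor_product.tens_closed[OF AA_product] unfolding AA_def by simp

lemma to_P_ta: "a \<in> carrier A \<Longrightarrow> b \<in> carrier A \<Longrightarrow> to_P n (ta a b) = pc n a \<otimes>\<^bsub>P n\<^esub> \<theta> n b"
  using balanced_map.lift_tens[OF alg_pair.is_balanced_map[OF AA_pair]] unfolding AA_to_P_def by simp

lemma TT_cring: "cring TT"
  using to_P_hom unfolding ring_hom_cring_def by blast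

lemma ta_left_hom: "(\<lambda>a. ta a \<one>) \<in> ring_hom A TT"
proof -
  interpret al: tensor_algebra R "alg \<rho> A" "alg \<rho> A"
    by (rule alg_pair.is_tensor_algebra[OF AA_pair])
  show ?thesis
  proof (rule ring_hom_memI)
    fix a b assume "a \<in> carrier A" "b \<in> carrier A"
    then show "ta (a \<otimes> b) \<one> = ta a \<one> \<otimes>\<^bsub>TT\<^esub> ta b \<one>" "ta (a \<oplus> b) \<one> = ta a \<one> \<oplus>\<^bsub>TT\<^esub> ta b \<one>"
      using al.tens_mult[of a \<one> b \<one>] al.tens_add_left[of a b \<one>] by (simp_all add: AA_def)
  next
    show "ta \<one> \<one> = \<one>\<^bsub>TT\<^esub>" using al.tens_one by (simp add: AA_def)
  qed (simp add: ta_closed)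
qed

text \<open>On a (x) b both sides equal the product ab, since the Taylor morphism is a section of
  the augmentation in every degree.\<close>

lemma Pproj_to_P:
  assumes "t \<in> carrier TT"
  shows "Pproj A (to_P 0 t) = Pproj A (to_P 1 t)"
proof -
  interpret t0: ring_hom_cring TT "P 0" "to_P 0" by (rule to_P_hom)
  interpret t1: ring_hom_cring TT "P 1" "to_P 1" by (rule to_P_hom)
  show ?thesis
  proof (rule tensor_product.additive_eq[OF AA_product abelian_group_axioms, folded AA_def,
        of "\<lambda>t. Pproj A (to_P 0 t)" "\<lambda>t. Pproj A (to_P 1 t)" t])
    show "Pproj A (to_P 0 (ta m n)) = Pproj A (to_P 1 (ta m n))"
      if "m \<in> carrier (alg \<rho> A)" "n \<in> carrier (alg \<rho> A)" for m n
      using that by (simp add: to_P_ta)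
  qed (use assms Pproj.hom_closed[OF t0.hom_closed] Pproj.hom_closed[OF t1.hom_closed] in
      \<open>simp_all add: Pi_iff\<close>)
qed

lemma I2_ideal: "ideal I2 TT"
  unfolding tw_ideal_def 
  by (rule ring_hom_ring.kernel_is_ideal[OF ring_hom_ring_of_cring[OF to_P_hom]])

lemma I2_iff: "t \<in> I2 \<longleftrightarrow> t \<in> carrier TT \<and> to_P 1 t = \<zero>\<^bsub>P 1\<^esub>"
  by (simp add: tw_ideal_def a_kernel_def')

text \<open>As P_(0) is A, the ideal is the kernel of multiplication. Expressing it through P_(1)
  places both ideals in the same target, where the quotient \<open>Omega\<close> becomes the kernel
  of the augmentation.\<close>

lemma I1_iff: "t \<in> I1 \<longleftrightarrow> t \<in> carrier TT \<and> Pproj A (to_P 1 t) = \<zero>"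
proof -
  interpret t0: ring_hom_cring TT "P 0" "to_P 0" by (rule to_P_hom)
  have "to_P 0 t = \<zero>\<^bsub>P 0\<^esub> \<longleftrightarrow> Pproj A (to_P 0 t) = \<zero>" if "t \<in> carrier TT" for t
  proof
    assume "Pproj A (to_P 0 t) = \<zero>"
    with P0_const[OF t0.hom_closed[OF that]] have "to_P 0 t = pc 0 \<zero>" by argo
    then show "to_P 0 t = \<zero>\<^bsub>P 0\<^esub>" by simp
  qed simp
  then show ?thesis
    unfolding tw_ideal_def a_kernel_def' using Pproj_to_P[of t] by (simp cong: conj_cong)
qed

section \<open>The quotient by the smaller ideal and its embedding into P_(1)\<close>

abbreviation "TQ \<equiv> TT Quot I2"

definition cl :: "('a \<times> 'a \<Rightarrow>\<^sub>0 int) set \<Rightarrow> ('a \<times> 'a \<Rightarrow>\<^sub>0 int) set set" where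
  "cl t = I2 +>\<^bsub>TT\<^esub> t"

lemma TQ_cring: "cring TQ"
  by (rule ideal.quotient_is_cring[OF I2_ideal TT_cring])

lemma cl_hom: "ring_hom_cring TT TQ cl"
  by (rule ring_hom_cringI'[OF TT_cring TQ_cring])
    (use ideal.rcos_ring_hom[OF I2_ideal] in \<open>simp add: cl_def[abs_def]\<close>)

lemma carrier_TQ: "carrier TQ = cl ` carrier TT"
  by (auto simp: FactRing_def A_RCOSETS_def RCOSETS_def a_r_coset_def cl_def)

lemma E_cl: "t \<in> carrier TT \<Longrightarrow> E (cl t) = to_P 1 t"
  unfolding Omega_to_P_def cl_def
  by (rule induced_coset[OF I2_ideal ring_hom_ring_of_cring[OF to_P_hom]]) (simp_all add: I2_iff)

lemma E_hom: "ring_hom_cring TQ P1 E"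
  by (rule ring_hom_cringI'[OF TQ_cring Psig_cring]) 
    (unfold Omega_to_P_def,
     rule induced_ring_hom[OF I2_ideal ring_hom_ring_of_cring[OF to_P_hom]], simp add: I2_iff)

sublocale E: ring_hom_cring TQ P1 E by (rule E_hom)

text \<open>The first isomorphism theorem: the ideal divided out is the full kernel of the map to
  P_(1).\<close>

lemma E_inj:
  assumes V: "V \<in> carrier TQ" and W: "W \<in> carrier TQ" and eq: "E V = E W"
  shows "V = W"
proof -
  interpret I2: ideal I2 TT by (rule I2_ideal)
  interpret cl: ring_hom_cring TT TQ cl by (rule cl_hom)
  obtain t where t: "t \<in> carrier TT" "V \<ominus>\<^bsub>TQ\<^esub> W = cl t"
    using E.R.minus_closed[OF V W] by (auto simp: carrier_TQ)
  have "E (V \<ominus>\<^bsub>TQ\<^esub> W) = \<zero>\<^bsub>P1\<^esub>"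
    using V W eq by (simp add: E.R.minus_eq P.r_neg)
  with t have "t \<in> I2" by (simp add: E_cl I2_iff)
  then have "cl t = \<zero>\<^bsub>TQ\<^esub>"
    by (simp add: cl_def FactRing_def I2.a_rcos_const)
  with t V W show ?thesis by simp
qed

definition incl :: "'a \<Rightarrow> ('a \<times> 'a \<Rightarrow>\<^sub>0 int) set set" where
  "incl a = cl (ta a \<one>)"

lemma incl_hom: "ring_hom_cring A TQ incl"
  by (rule ring_hom_cringI'[OF cring_axioms TQ_cring])
    (use ring_hom_trans[OF ta_left_hom ring_hom_cring.homh[OF cl_hom]] in \<open>simp add: incl_def[abs_def] o_def\<close>)

lemmas incl_closed = ring_hom_closed[OF ring_hom_cring.homh[OF incl_hom]]
lemmas cl_closed = ring_hom_closed[OF ring_hom_cring.homh[OF cl_hom]]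

lemma E_incl: "a \<in> carrier A \<Longrightarrow> E (incl a) = pc 1 a"
  using ring_hom_one[OF ring_hom_cring.homh[OF theta_hom], of 1]
  by (simp add: incl_def E_cl ta_closed to_P_ta)

lemma carrier_Omega: "carrier \<Omega> = {V \<in> carrier TQ. Pproj A (E V) = \<zero>}"
  by (auto simp: Omega_def Let_def I1_iff carrier_TQ E_cl simp flip: cl_def)

text \<open>Exhibits \<open>Omega\<close> as a subset of the quotient ring, seen as an A-algebra
  through the left factor; the module axioms then come from those of a submodule.\<close>

lemma Omega_alg: "\<Omega> = (alg incl TQ)\<lparr>carrier := {V \<in> carrier TQ. Pproj A (E V) = \<zero>}\<rparr>"
  using carrier_Omega by (simp add: Omega_def Let_def incl_def[abs_def] cl_def)

lemma Omega_simps: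
  "add \<Omega> = add TQ" "\<zero>\<^bsub>\<Omega>\<^esub> = \<zero>\<^bsub>TQ\<^esub>" "a \<odot>\<^bsub>\<Omega>\<^esub> V = incl a \<otimes>\<^bsub>TQ\<^esub> V"
  by (simp_all add: Omega_alg)

lemma Omega_module: "Module.module A \<Omega>"
proof -
  interpret incl: ring_hom_cring A TQ incl by (rule incl_hom)
  interpret al: Module.module A "alg incl TQ" by (rule alg_module[OF incl_hom])
  have minus: "\<ominus>\<^bsub>alg incl TQ\<^esub> V = \<ominus>\<^bsub>TQ\<^esub> V" for V
    by (simp add: a_inv_def m_inv_def)
  have "submodule {V \<in> carrier TQ. Pproj A (E V) = \<zero>} A (alg incl TQ)"
    by (rule al.submoduleI) (auto simp: minus E_incl)
  then show ?thesis
    unfolding Omega_alg by (rule submodule.submodule_is_module[OF _ al.module_axioms])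
qed

section \<open>The basis of the differential forms\<close>

definition dx :: "nat \<Rightarrow> ('a \<times> 'a \<Rightarrow>\<^sub>0 int) set set" where
  "dx i = cl (ta \<one> (x i)) \<ominus>\<^bsub>TQ\<^esub> incl (x i)"

lemma dx_TQ: "i < d \<Longrightarrow> dx i \<in> carrier TQ"
  using incl_closed cl_closed
  by (simp add: dx_def ta_closed x_closed)

lemma E_dx:
  assumes "i < d"
  shows "E (dx i) = xi 1 i"
proof -
  have cl: "cl (ta \<one> (x i)) \<in> carrier TQ" "incl (x i) \<in> carrier TQ"
    using assms incl_closed cl_closed
    by (simp_all add: ta_closed x_closed)
  have "E (dx i) = E (cl (ta \<one> (x i))) \<ominus>\<^bsub>P1\<^esub> E (incl (x i))"
    using cl by (simp add: dx_def E.R.minus_eq P.minus_eq)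
  also have "\<dots> = \<theta> 1 (x i) \<ominus>\<^bsub>P1\<^esub> pc 1 (x i)"
    using assms by (simp add: E_cl E_incl ta_closed to_P_ta x_closed)
  also have "\<dots> = xi 1 i"
    using assms x_closed[OF assms] by (simp add: theta_x P.minus_eq P.a_ac P.r_neg)
  finally show ?thesis .
qed

lemma dx_closed: "i < d \<Longrightarrow> dx i \<in> carrier \<Omega>"
  by (simp add: carrier_Omega dx_TQ E_dx)

text \<open>Under the injective map \<open>E\<close> the claim becomes \<open>P1_expand\<close> for
  an element whose constant term is zero.\<close>

lemma Omega_expand:
  assumes "V \<in> carrier \<Omega>"
  shows "V = (\<Oplus>\<^bsub>\<Omega>\<^esub>i\<in>{..<d}. coef i (E V) \<odot>\<^bsub>\<Omega>\<^esub> dx i)"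
proof -
  interpret Om: Module.module A \<Omega> by (rule Omega_module)
  have V: "V \<in> carrier TQ" "Pproj A (E V) = \<zero>" using assms by (simp_all add: carrier_Omega)
  have f: "(\<lambda>i. coef i (E V) \<odot>\<^bsub>\<Omega>\<^esub> dx i) \<in> {..<d} \<rightarrow> carrier \<Omega>"
    using V by (auto intro!: Om.smult_closed dx_closed)
  have "E (\<Oplus>\<^bsub>\<Omega>\<^esub>i\<in>{..<d}. coef i (E V) \<odot>\<^bsub>\<Omega>\<^esub> dx i) = (\<Oplus>\<^bsub>P1\<^esub>i\<in>{..<d}. E (coef i (E V) \<odot>\<^bsub>\<Omega>\<^esub> dx i))"
    by (rule additive_finsum[OF Om.M.abelian_group_axioms P.abelian_group_axioms _ _ f])
      (auto simp: carrier_Omega Omega_simps)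
  also have "\<dots> = (\<Oplus>\<^bsub>P1\<^esub>i\<in>{..<d}. pc 1 (coef i (E V)) \<otimes>\<^bsub>P1\<^esub> xi 1 i)"
    using V incl_closed
    by (intro P.finsum_cong') (auto simp: Omega_simps dx_TQ E_incl E_dx)
  also have "\<dots> = E V"
  proof -
    have "(\<Oplus>\<^bsub>P1\<^esub>i\<in>{..<d}. pc 1 (coef i (E V)) \<otimes>\<^bsub>P1\<^esub> xi 1 i) \<in> carrier P1"
      using V by (intro P.finsum_closed) auto
    then show ?thesis using P1_expand[OF E.hom_closed[OF V(1)]] V by simp
  qed
  finally show ?thesis
    using E_inj[OF V(1), of "\<Oplus>\<^bsub>\<Omega>\<^esub>i\<in>{..<d}. coef i (E V) \<odot>\<^bsub>\<Omega>\<^esub> dx i"] Om.M.finsum_closed[OF f]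
    by (simp add: carrier_Omega)
qed

lemma Omega_basis:
  assumes "Module.module A M"
  shows "tensor_basis A M \<Omega> {..<d} dx (\<lambda>i V. coef i (E V))"
proof -
  interpret incl: ring_hom_cring A TQ incl by (rule incl_hom)
  show ?thesis
    by (intro tensor_basis.intro tensor_basis_axioms.intro Omega_expand assms Omega_module)
      (auto simp: dx_TQ carrier_Omega Omega_simps coef_add coef_const_mult E_incl E_dx)
qed

section \<open>The basis of P_(1) as an A-module, with the unit at index 0\<close>

abbreviation "Q1 \<equiv> Pmod A d \<sigma> x 1"

lemma Q1_alg: "Q1 = alg (pc 1) P1" by (simp add: Pmod_def)

definition qb :: "nat \<Rightarrow> (nat multiset \<Rightarrow> 'a) set" where
  "qb j = (case j of 0 \<Rightarrow> \<one>\<^bsub>P1\<^esub> | Suc i \<Rightarrow> xi 1 i)"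

definition qc :: "nat \<Rightarrow> (nat multiset \<Rightarrow> 'a) set \<Rightarrow> 'a" where
  "qc j p = (case j of 0 \<Rightarrow> Pproj A p | Suc i \<Rightarrow> coef i p)"

lemma coef_one: "coef i \<one>\<^bsub>P1\<^esub> = \<zero>"
  using coef_const[of \<one> i] by simp

lemma Q1_basis:
  assumes "Module.module A M"
  shows "tensor_basis A M Q1 {..<Suc d} qb qc"
proof (intro tensor_basis.intro tensor_basis_axioms.intro assms)
  show m: "Module.module A Q1" unfolding Q1_alg by (rule alg_module[OF pc.ring_hom_cring_axioms])
  interpret Q: Module.module A Q1 by (rule m)
  show "qb i \<in> carrier Q1" if "i \<in> {..<Suc d}" for i
    using that by (auto simp: qb_def Q1_alg split: nat.split)
  fix p assume "p \<in> carrier Q1"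
  then have p: "p \<in> carrier P1" by (simp add: Q1_alg)
  have f: "(\<lambda>i. qc i p \<odot>\<^bsub>Q1\<^esub> qb i) \<in> {..<Suc d} \<rightarrow> carrier Q1"
    using p by (auto simp: qb_def qc_def Q1_alg split: nat.split)
  \<comment> \<open>The module and the ring share their addition but are different records; the
    identity map is additive between them and carries one sum to the other.\<close>
  have "(\<Oplus>\<^bsub>Q1\<^esub>i\<in>{..<Suc d}. qc i p \<odot>\<^bsub>Q1\<^esub> qb i) = (\<Oplus>\<^bsub>P1\<^esub>i\<in>{..<Suc d}. qc i p \<odot>\<^bsub>Q1\<^esub> qb i)"
    using additive_finsum[OF Q.M.abelian_group_axioms P.abelian_group_axioms _ _ f, of "\<lambda>p. p" 1]
    by (simp add: Q1_alg)
  also have "\<dots> = qc 0 p \<odot>\<^bsub>Q1\<^esub> qb 0 \<oplus>\<^bsub>P1\<^esub> (\<Oplus>\<^bsub>P1\<^esub>i\<in>Suc ` {..<d}. qc i p \<odot>\<^bsub>Q1\<^esub> qb i)"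
    using f unfolding lessThan_Suc_eq_insert_0
    by (intro P.finsum_insert) (auto simp: Q1_alg)
  also have "(\<Oplus>\<^bsub>P1\<^esub>i\<in>Suc ` {..<d}. qc i p \<odot>\<^bsub>Q1\<^esub> qb i) = (\<Oplus>\<^bsub>P1\<^esub>i\<in>{..<d}. qc (Suc i) p \<odot>\<^bsub>Q1\<^esub> qb (Suc i))"
    using f by (intro P.finsum_reindex) (auto simp: Q1_alg)
  also have "qc 0 p \<odot>\<^bsub>Q1\<^esub> qb 0 \<oplus>\<^bsub>P1\<^esub> (\<Oplus>\<^bsub>P1\<^esub>i\<in>{..<d}. qc (Suc i) p \<odot>\<^bsub>Q1\<^esub> qb (Suc i)) = p"
    using P1_expand[OF p] p by (simp add: Q1_alg qb_def qc_def)
  finally show "p = (\<Oplus>\<^bsub>Q1\<^esub>i\<in>{..<Suc d}. qc i p \<odot>\<^bsub>Q1\<^esub> qb i)" by simp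
qed (auto simp: Q1_alg qb_def qc_def coef_add coef_const_mult coef_one split: nat.split)

end

section \<open>Twisted connections in coordinates\<close>

lemma (in twisted_calculus) qc_simps: "qc 0 p = Pproj A p" "qc (Suc i) p = coef i p"
  by (simp_all add: qc_def)

locale connection_module = twisted_calculus R A \<rho> d \<sigma> x \<theta> + M: Module.module A M
  for R :: "'r topring" and A :: "'a topring" (structure) and \<rho> d \<sigma> x \<theta>
    and M :: "('a, 'm) module"
begin

sublocale Om: tensor_basis A M \<Omega> "{..<d}" dx "\<lambda>i V. coef i (E V)"
  by (rule Omega_basis[OF M.module_axioms])

sublocale Qm: tensor_basis A M Q1 "{..<Suc d}" qb qc
  by (rule Q1_basis[OF M.module_axioms])

section \<open>From M (x) Omega to M (x) P_(1)\<close>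

abbreviation "TM \<equiv> tensor_map A M \<Omega> M Q1 (\<lambda>m. m) E"

lemma E_Omega:
  assumes "V \<in> carrier \<Omega>"
  shows "E V \<in> carrier Q1" "Pproj A (E V) = \<zero>"
  using assms by (auto simp: carrier_Omega Q1_alg)

lemma TM_balanced: "balanced_map A M \<Omega> Qm.T (\<lambda>m V. Qm.tn m (E V))"
proof (rule balanced_map.intro[OF Om.tensor_product_axioms Qm.T.abelian_group_axioms], unfold_locales)
  fix m V W assume "m \<in> carrier M" "V \<in> carrier \<Omega>" "W \<in> carrier \<Omega>"
  then show "Qm.tn m (E (V \<oplus>\<^bsub>\<Omega>\<^esub> W)) = Qm.tn m (E V) \<oplus>\<^bsub>Qm.T\<^esub> Qm.tn m (E W)"
    using Qm.tens_add_right[of m "E V" "E W"] by (simp add: carrier_Omega Omega_simps Q1_alg)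
next
  fix a m V assume "a \<in> carrier A" "m \<in> carrier M" "V \<in> carrier \<Omega>"
  then show "Qm.tn (a \<odot>\<^bsub>M\<^esub> m) (E V) = Qm.tn m (E (a \<odot>\<^bsub>\<Omega>\<^esub> V))"
    using Qm.tens_smult[of a m "E V"] incl_closed[of a]
    by (simp add: carrier_Omega Omega_simps Q1_alg E_incl)
qed (simp_all add: E_Omega Qm.tens_add_left Qm.tens_closed)

lemma TM_closed: "t \<in> carrier Om.T \<Longrightarrow> TM t \<in> carrier Qm.T"
  unfolding tensor_map_def by (rule balanced_map.lift_closed[OF TM_balanced])

lemma TM_add: "t \<in> carrier Om.T \<Longrightarrow> u \<in> carrier Om.T \<Longrightarrow> TM (t \<oplus>\<^bsub>Om.T\<^esub> u) = TM t \<oplus>\<^bsub>Qm.T\<^esub> TM u"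
  unfolding tensor_map_def by (rule balanced_map.lift_add[OF TM_balanced])

lemma TM_tens: "m \<in> carrier M \<Longrightarrow> V \<in> carrier \<Omega> \<Longrightarrow> TM (Om.tn m V) = Qm.tn m (E V)"
  unfolding tensor_map_def by (rule balanced_map.lift_tens[OF TM_balanced])

text \<open>Differential forms have augmentation zero, hence no component along the unit.\<close>

lemma coord_TM_0: "t \<in> carrier Om.T \<Longrightarrow> Qm.coord 0 (TM t) = \<zero>\<^bsub>M\<^esub>"
proof (induction t rule: Om.tensor_induct)
  case (tens m V)
  then show ?case by (simp add: TM_tens Qm.coord_tens E_Omega qc_simps)
next
  case (add t u)
  then show ?case by (simp add: TM_add Qm.coord_add TM_closed)
qed

lemma coord_TM_Suc:
  assumes "i < d"
  shows "t \<in> carrier Om.T \<Longrightarrow> Qm.coord (Suc i) (TM t) = Om.coord i t"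
proof (induction t rule: Om.tensor_induct)
  case (tens m V)
  then show ?case using assms by (simp add: TM_tens Qm.coord_tens Om.coord_tens E_Omega qc_simps)
next
  case (add t u)
  then show ?case using assms by (simp add: TM_add Qm.coord_add Om.coord_add TM_closed)
qed

section \<open>The action of P_(1) on M (x) P_(1) in coordinates\<close>

abbreviation "act p \<equiv> P_act A d \<sigma> x 1 M p"

lemma act_balanced:
  assumes "p \<in> carrier P1"
  shows "balanced_map A M Q1 Qm.T (\<lambda>m q. Qm.tn m (p \<otimes>\<^bsub>Q1\<^esub> q))"
proof (rule balanced_map.intro[OF Qm.tensor_product_axioms Qm.T.abelian_group_axioms], unfold_locales)
  fix m q r assume "m \<in> carrier M" "q \<in> carrier Q1" "r \<in> carrier Q1"
  then show "Qm.tn m (p \<otimes>\<^bsub>Q1\<^esub> (q \<oplus>\<^bsub>Q1\<^esub> r)) = Qm.tn m (p \<otimes>\<^bsub>Q1\<^esub> q) \<oplus>\<^bsub>Qm.T\<^esub> Qm.tn m (p \<otimes>\<^bsub>Q1\<^esub> r)"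
    using assms Qm.tens_add_right[of m "p \<otimes>\<^bsub>Q1\<^esub> q" "p \<otimes>\<^bsub>Q1\<^esub> r"] by (simp add: Q1_alg P.r_distr)
next
  fix a m q assume "a \<in> carrier A" "m \<in> carrier M" "q \<in> carrier Q1"
  then show "Qm.tn (a \<odot>\<^bsub>M\<^esub> m) (p \<otimes>\<^bsub>Q1\<^esub> q) = Qm.tn m (p \<otimes>\<^bsub>Q1\<^esub> (a \<odot>\<^bsub>Q1\<^esub> q))"
    using assms Qm.tens_smult[of a m "p \<otimes>\<^bsub>Q1\<^esub> q"] by (simp add: Q1_alg P.m_lcomm)
next
  fix m n q assume "m \<in> carrier M" "n \<in> carrier M" "q \<in> carrier Q1"
  then show "Qm.tn (m \<oplus>\<^bsub>M\<^esub> n) (p \<otimes>\<^bsub>Q1\<^esub> q) = Qm.tn m (p \<otimes>\<^bsub>Q1\<^esub> q) \<oplus>\<^bsub>Qm.T\<^esub> Qm.tn n (p \<otimes>\<^bsub>Q1\<^esub> q)"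
    using assms Qm.tens_add_left[of m n "p \<otimes>\<^bsub>Q1\<^esub> q"] by (simp add: Q1_alg)
next
  fix m q assume "m \<in> carrier M" "q \<in> carrier Q1"
  then show "Qm.tn m (p \<otimes>\<^bsub>Q1\<^esub> q) \<in> carrier Qm.T"
    using assms Qm.tens_closed[of m "p \<otimes>\<^bsub>Q1\<^esub> q"] by (simp add: Q1_alg)
qed

lemma act_def': "act p = tensor_lift A M Q1 Qm.T (\<lambda>m q. Qm.tn m (p \<otimes>\<^bsub>Q1\<^esub> q))"
  by (simp add: P_act_def Let_def tensor_map_def)

lemma act_closed: "p \<in> carrier P1 \<Longrightarrow> t \<in> carrier Qm.T \<Longrightarrow> act p t \<in> carrier Qm.T"
  unfolding act_def' by (rule balanced_map.lift_closed[OF act_balanced])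

lemma act_add: "p \<in> carrier P1 \<Longrightarrow> t \<in> carrier Qm.T \<Longrightarrow> u \<in> carrier Qm.T \<Longrightarrow>
    act p (t \<oplus>\<^bsub>Qm.T\<^esub> u) = act p t \<oplus>\<^bsub>Qm.T\<^esub> act p u"
  unfolding act_def' by (rule balanced_map.lift_add[OF act_balanced])

lemma act_tens: "p \<in> carrier P1 \<Longrightarrow> m \<in> carrier M \<Longrightarrow> q \<in> carrier Q1 \<Longrightarrow>
    act p (Qm.tn m q) = Qm.tn m (p \<otimes>\<^bsub>P1\<^esub> q)"
  unfolding act_def' using balanced_map.lift_tens[OF act_balanced, of p m q] by (simp add: Q1_alg)

lemma coord_act_0:
  assumes p: "p \<in> carrier P1"
  shows "t \<in> carrier Qm.T \<Longrightarrow> Qm.coord 0 (act p t) = Pproj A p \<odot>\<^bsub>M\<^esub> Qm.coord 0 t"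
proof (induction t rule: Qm.tensor_induct)
  case (tens m q)
  then have q: "q \<in> carrier P1" by (simp add: Q1_alg)
  then have "p \<otimes>\<^bsub>P1\<^esub> q \<in> carrier Q1" using p by (simp add: Q1_alg)
  with tens p q show ?case
    by (simp add: act_tens Qm.coord_tens qc_simps M.smult_assoc1)
next
  case (add t u)
  then show ?case using p by (simp add: act_add Qm.coord_add act_closed Qm.coord_closed M.smult_r_distr)
qed

text \<open>This is \<open>coef_mult\<close> regrouped by the coefficients of the second factor. For
  \<open>p\<close> the Taylor expansion of f, the two multipliers are the derivative of f and, by
  \<open>sigma_coef\<close>, sigma_i(f).\<close>

lemma coord_act_Suc:
  assumes p: "p \<in> carrier P1" and i: "i < d"
  shows "t \<in> carrier Qm.T \<Longrightarrow> Qm.coord (Suc i) (act p t) =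
    coef i p \<odot>\<^bsub>M\<^esub> Qm.coord 0 t \<oplus>\<^bsub>M\<^esub> (Pproj A p \<oplus> qq i \<otimes> coef i p) \<odot>\<^bsub>M\<^esub> Qm.coord (Suc i) t"
proof (induction t rule: Qm.tensor_induct)
  case (tens m q)
  then have q: "q \<in> carrier P1" by (simp add: Q1_alg)
  then have "p \<otimes>\<^bsub>P1\<^esub> q \<in> carrier Q1" using p by (simp add: Q1_alg)
  then have "Qm.coord (Suc i) (act p (Qm.tn m q)) = coef i (p \<otimes>\<^bsub>P1\<^esub> q) \<odot>\<^bsub>M\<^esub> m"
    using tens p i by (simp add: act_tens Qm.coord_tens qc_simps)
  also have "coef i (p \<otimes>\<^bsub>P1\<^esub> q) = coef i p \<otimes> Pproj A q \<oplus> (Pproj A p \<oplus> qq i \<otimes> coef i p) \<otimes> coef i q"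
    using p q by (simp add: coef_mult l_distr r_distr m_ac a_ac)
  finally show ?case
    using tens p q i by (simp add: Qm.coord_tens qc_simps M.smult_assoc1 M.smult_l_distr)
next
  case (add t u)
  then have c: "Qm.coord 0 t \<in> carrier M" "Qm.coord 0 u \<in> carrier M"
    "Qm.coord (Suc i) t \<in> carrier M" "Qm.coord (Suc i) u \<in> carrier M"
    using i by (simp_all add: Qm.coord_closed)
  have "Qm.coord (Suc i) (act p (t \<oplus>\<^bsub>Qm.T\<^esub> u)) =
      Qm.coord (Suc i) (act p t) \<oplus>\<^bsub>M\<^esub> Qm.coord (Suc i) (act p u)"
    using add p i by (simp add: act_add Qm.coord_add act_closed)
  then show ?case
    using add(1-4) c p i by (simp add: Qm.coord_add M.smult_r_distr M.M.a_ac)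
qed

section \<open>Twisted connections as coordinate conditions\<close>

abbreviation "\<Theta>M \<nu> \<equiv> Theta_M R A \<rho> d \<sigma> x \<theta> M \<nu>"

lemma Theta_M_closed:
  assumes "\<nu> \<in> carrier M \<rightarrow> carrier Om.T" "s \<in> carrier M"
  shows "\<Theta>M \<nu> s \<in> carrier Qm.T"
proof -
  have "\<one>\<^bsub>Q1\<^esub> \<in> carrier Q1" "\<nu> s \<in> carrier Om.T" using assms by (auto simp: Q1_alg)
  then show ?thesis using assms(2) by (simp add: Theta_M_def Let_def TM_closed Qm.tens_closed)
qed

text \<open>The summand s (x) 1 accounts for the unit coordinate alone and the connection for all
  the others, because 1 has no xi-part and forms have no constant part.\<close>

lemma coord_Theta_M:
  assumes "\<nu> \<in> carrier M \<rightarrow> carrier Om.T" "s \<in> carrier M"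
  shows "Qm.coord 0 (\<Theta>M \<nu> s) = s" "i < d \<Longrightarrow> Qm.coord (Suc i) (\<Theta>M \<nu> s) = Om.coord i (\<nu> s)"
proof -
  have *: "\<one>\<^bsub>Q1\<^esub> \<in> carrier Q1" "\<nu> s \<in> carrier Om.T" "Pproj A \<one>\<^bsub>Q1\<^esub> = \<one>" "coef j \<one>\<^bsub>Q1\<^esub> = \<zero>" for j
    using assms Pproj.hom_one[of 1] by (auto simp: Q1_alg coef_one)
  show "Qm.coord 0 (\<Theta>M \<nu> s) = s"
    using * assms(2)
    by (simp add: Theta_M_def Let_def Qm.coord_add TM_closed Qm.tens_closed Qm.coord_tens coord_TM_0 qc_simps)
  show "Qm.coord (Suc i) (\<Theta>M \<nu> s) = Om.coord i (\<nu> s)" if "i < d"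
    using * assms(2) that
    by (simp add: Theta_M_def Let_def Qm.coord_add TM_closed Qm.tens_closed Qm.coord_tens
        coord_TM_Suc Om.coord_closed qc_simps)
qed

lemma Qm_eq_iff:
  assumes "t \<in> carrier Qm.T" "u \<in> carrier Qm.T"
  shows "t = u \<longleftrightarrow> Qm.coord 0 t = Qm.coord 0 u \<and> (\<forall>i<d. Qm.coord (Suc i) t = Qm.coord (Suc i) u)"
proof
  assume *: "Qm.coord 0 t = Qm.coord 0 u \<and> (\<forall>i<d. Qm.coord (Suc i) t = Qm.coord (Suc i) u)"
  show "t = u"
  proof (rule Qm.tensor_eqI[OF assms])
    fix j assume "j \<in> {..<Suc d}"
    then show "Qm.coord j t = Qm.coord j u" using * by (cases j) auto
  qed
qed simp

text \<open>Equality in M (x) P_(1) is tested on coordinates. At index 0 both conditions hold by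
  themselves, by the section property of the Taylor morphism; at \<open>Suc i\<close> they become
  additivity and the twisted Leibniz rule.\<close>

lemma twisted_connection_iff:
  "twisted_connection R A \<rho> d \<sigma> x \<theta> M \<nu> \<longleftrightarrow> \<nu> \<in> carrier M \<rightarrow>\<^sub>E carrier Om.T \<and>
    (\<forall>i<d. (\<forall>s\<in>carrier M. \<forall>t\<in>carrier M.
        Om.coord i (\<nu> (s \<oplus>\<^bsub>M\<^esub> t)) = Om.coord i (\<nu> s) \<oplus>\<^bsub>M\<^esub> Om.coord i (\<nu> t)) \<and>
      (\<forall>f\<in>carrier A. \<forall>s\<in>carrier M. Om.coord i (\<nu> (f \<odot>\<^bsub>M\<^esub> s)) =
        tder i f \<odot>\<^bsub>M\<^esub> s \<oplus>\<^bsub>M\<^esub> \<sigma> i f \<odot>\<^bsub>M\<^esub> Om.coord i (\<nu> s)))"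
proof (cases "\<nu> \<in> carrier M \<rightarrow>\<^sub>E carrier Om.T")
  case True
  then have nu: "\<nu> \<in> carrier M \<rightarrow> carrier Om.T" by auto
  have add: "\<Theta>M \<nu> (s \<oplus>\<^bsub>M\<^esub> t) = \<Theta>M \<nu> s \<oplus>\<^bsub>Qm.T\<^esub> \<Theta>M \<nu> t \<longleftrightarrow>
      (\<forall>i<d. Om.coord i (\<nu> (s \<oplus>\<^bsub>M\<^esub> t)) = Om.coord i (\<nu> s) \<oplus>\<^bsub>M\<^esub> Om.coord i (\<nu> t))"
    if "s \<in> carrier M" "t \<in> carrier M" for s t
    using that by (subst Qm_eq_iff) (simp_all add: Theta_M_closed[OF nu] coord_Theta_M[OF nu] Qm.coord_add)
  have mult: "\<Theta>M \<nu> (f \<odot>\<^bsub>M\<^esub> s) = act (\<theta> 1 f) (\<Theta>M \<nu> s) \<longleftrightarrow>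
      (\<forall>i<d. Om.coord i (\<nu> (f \<odot>\<^bsub>M\<^esub> s)) =
        tder i f \<odot>\<^bsub>M\<^esub> s \<oplus>\<^bsub>M\<^esub> \<sigma> i f \<odot>\<^bsub>M\<^esub> Om.coord i (\<nu> s))"
    if "f \<in> carrier A" "s \<in> carrier M" for f s
    using that by (subst Qm_eq_iff)
      (simp_all add: Theta_M_closed[OF nu] coord_Theta_M[OF nu] act_closed coord_act_0 coord_act_Suc
        deriv_coef sigma_coef cong: imp_cong)
  show ?thesis
    unfolding twisted_connection_def using True by (simp add: add mult) blast
qed (simp add: twisted_connection_def)

end

text \<open>With M (x) Omega identified with d copies of M, the map induced by \<open>u\<close> is
  \<open>u\<close> in each coordinate. This turns compatibility with connections into commutation
  with operators.\<close>

lemma (in twisted_calculus) tensor_map_linear: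
  assumes M: "Module.module A M" and N: "Module.module A N" and u: "u \<in> linear_maps A M N"
    and t: "t \<in> carrier (tensor A M \<Omega>)"
  shows tensor_map_closed: "tensor_map A M \<Omega> N \<Omega> u (\<lambda>\<omega>. \<omega>) t \<in> carrier (tensor A N \<Omega>)"
    and coord_tensor_map: "\<And>i. i < d \<Longrightarrow>
      tensor_basis.coord A N \<Omega> (\<lambda>i V. coef i (E V)) i (tensor_map A M \<Omega> N \<Omega> u (\<lambda>\<omega>. \<omega>) t) =
      u (tensor_basis.coord A M \<Omega> (\<lambda>i V. coef i (E V)) i t)"
proof -
  interpret OM: tensor_basis A M \<Omega> "{..<d}" dx "\<lambda>i V. coef i (E V)" by (rule Omega_basis[OF M])
  interpret ON: tensor_basis A N \<Omega> "{..<d}" dx "\<lambda>i V. coef i (E V)" by (rule Omega_basis[OF N])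
  have u_closed: "u m \<in> carrier N" if "m \<in> carrier M" for m
    using u that by (auto simp: linear_maps_def)
  have u_add: "u (m \<oplus>\<^bsub>M\<^esub> m') = u m \<oplus>\<^bsub>N\<^esub> u m'" if "m \<in> carrier M" "m' \<in> carrier M" for m m'
    using u that by (auto simp: linear_maps_def)
  have u_smult: "u (a \<odot>\<^bsub>M\<^esub> m) = a \<odot>\<^bsub>N\<^esub> u m" if "a \<in> carrier A" "m \<in> carrier M" for a m
    using u that by (auto simp: linear_maps_def)
  have bal: "balanced_map A M \<Omega> ON.T (\<lambda>m V. ON.tn (u m) V)"
    by (rule balanced_map.intro[OF OM.tensor_product_axioms ON.T.abelian_group_axioms], unfold_locales)
      (simp_all add: u_closed u_add u_smult ON.tens_add_left ON.tens_add_right ON.tens_smult ON.tens_closed)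
  note closed = balanced_map.lift_closed[OF bal]
  show "tensor_map A M \<Omega> N \<Omega> u (\<lambda>\<omega>. \<omega>) t \<in> carrier ON.T"
    unfolding tensor_map_def by (rule closed[OF t])
  show "ON.coord i (tensor_map A M \<Omega> N \<Omega> u (\<lambda>\<omega>. \<omega>) t) = u (OM.coord i t)" if i: "i < d" for i
    unfolding tensor_map_def using t
  proof (induction t rule: OM.tensor_induct)
    case (tens m V)
    then show ?case
      using i by (simp add: balanced_map.lift_tens[OF bal] ON.coord_tens OM.coord_tens u_closed u_smult
          OM.c_closed)
  next
    case (add t v)
    then show ?case
      using i by (simp add: balanced_map.lift_add[OF bal] closed ON.coord_add OM.coord_add u_add OM.coord_closed)
  qed
qed

section \<open>The equivalence\<close>

text \<open>For mutually inverse maps on objects that leave morphisms and composition unchanged,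
  both functors act as the identity on morphisms, and identities serve as unit and counit. The
  category axioms for \<open>C\<close> are transported from \<open>D\<close>.\<close>

lemma isomorphic_equivalent_categories:
  assumes D: "is_category D"
    and F: "\<And>U. U \<in> Obj C \<Longrightarrow> F U \<in> Obj D" and G: "\<And>V. V \<in> Obj D \<Longrightarrow> G V \<in> Obj C"
    and GF: "\<And>U. U \<in> Obj C \<Longrightarrow> G (F U) = U" and FG: "\<And>V. V \<in> Obj D \<Longrightarrow> F (G V) = V"
    and Hom: "\<And>U V. U \<in> Obj C \<Longrightarrow> V \<in> Obj C \<Longrightarrow> Hom C U V = Hom D (F U) (F V)"
    and Ident: "\<And>U. U \<in> Obj C \<Longrightarrow> Ident C U = Ident D (F U)"
    and Cmp: "\<And>U V W. U \<in> Obj C \<Longrightarrow> V \<in> Obj C \<Longrightarrow> W \<in> Obj C \<Longrightarrow> Cmp C U V W = Cmp D (F U) (F V) (F W)"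
  shows "equivalent_categories C D"
proof -
  have C: "is_category C"
    using D F unfolding is_category_def by (simp add: Hom Ident Cmp)
  have iso: "is_iso K U U (Ident K U)" if "is_category K" "U \<in> Obj K" for K :: "('x, 'y) category" and U
    using that unfolding is_category_def is_iso_def by blast
  have nat: "Cmp K U V V (Ident K V) f = Cmp K U U V f (Ident K U)"
    if "is_category K" "U \<in> Obj K" "V \<in> Obj K" "f \<in> Hom K U V" for K :: "('x, 'y) category" and U V f
    using that unfolding is_category_def by metis
  have "is_functor C D F (\<lambda>_ _ f. f)"
    unfolding is_functor_def by (simp add: F Hom Ident Cmp)
  moreover have "is_functor D C G (\<lambda>_ _ f. f)"
    unfolding is_functor_def by (simp add: G Hom Ident Cmp FG)
  moreover have "is_nat_iso C C (\<lambda>U. U) (\<lambda>U V f. f) (\<lambda>U. G (F U)) (\<lambda>U V f. f) (Ident C)"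
    unfolding is_nat_iso_def using iso[OF C] nat[OF C] by (simp add: GF)
  moreover have "is_nat_iso D D (\<lambda>U. F (G U)) (\<lambda>U V f. f) (\<lambda>U. U) (\<lambda>U V f. f) (Ident D)"
    unfolding is_nat_iso_def using iso[OF D] nat[OF D] by (simp add: FG)
  ultimately show ?thesis
    unfolding equivalent_categories_def using C D by blast
qed

section \<open>The category axioms\<close>

lemma linear_maps_id: "Module.module A M \<Longrightarrow> restrict (\<lambda>s. s) (carrier M) \<in> linear_maps A M M"
  using abelian_monoid.a_closed[of M] module.smult_closed[of A M]
  by (auto simp: linear_maps_def module_def abelian_group_def)

lemma linear_maps_compose:
  assumes "Module.module A M" "u \<in> linear_maps A M N" "v \<in> linear_maps A N L"
  shows "compose (carrier M) v u \<in> linear_maps A M L"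
proof -
  interpret M: Module.module A M by fact
  show ?thesis
    using assms(2,3) by (auto simp: linear_maps_def compose_def PiE_def Pi_iff)
qed

lemma T_Mod_category: "is_category (T_Mod R A \<rho> d \<sigma> x \<theta>)"
proof -
  \<comment> \<open>Composition is undefined outside the source carrier, so associativity relies on
    \<open>f\<close> taking its values in the carrier of the next object.\<close>
  have assoc: "compose S (compose U h g) f = compose S h (compose S g f)" if "f \<in> S \<rightarrow>\<^sub>E U" for S U f g h
    using that by (auto simp: compose_def fun_eq_iff)
  show ?thesis
    unfolding is_category_def
  proof (intro conjI ballI)
    fix U assume "U \<in> Obj (T_Mod R A \<rho> d \<sigma> x \<theta>)"
    then show "Ident (T_Mod R A \<rho> d \<sigma> x \<theta>) U \<in> Hom (T_Mod R A \<rho> d \<sigma> x \<theta>) U U"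
      by (auto simp: T_Mod_def linear_maps_id PiE_iff)
  next
    fix U V W f g
    assume "U \<in> Obj (T_Mod R A \<rho> d \<sigma> x \<theta>)" "V \<in> Obj (T_Mod R A \<rho> d \<sigma> x \<theta>)"
      "W \<in> Obj (T_Mod R A \<rho> d \<sigma> x \<theta>)" "f \<in> Hom (T_Mod R A \<rho> d \<sigma> x \<theta>) U V"
      "g \<in> Hom (T_Mod R A \<rho> d \<sigma> x \<theta>) V W"
    moreover obtain M D N D' L D'' where "U = (M, D)" "V = (N, D')" "W = (L, D'')" by fastforce
    ultimately show "Cmp (T_Mod R A \<rho> d \<sigma> x \<theta>) U V W g f \<in> Hom (T_Mod R A \<rho> d \<sigma> x \<theta>) U W"
      using linear_maps_compose[of A M f N g L]
      by (auto simp: T_Mod_def compose_def PiE_iff linear_maps_def)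
  next
    fix U V f
    assume "f \<in> Hom (T_Mod R A \<rho> d \<sigma> x \<theta>) U V"
    moreover obtain M D N D' where "U = (M, D)" "V = (N, D')" by fastforce
    ultimately have U: "U = (M, D)" "V = (N, D')" and f: "f \<in> carrier M \<rightarrow>\<^sub>E carrier N"
      by (auto simp: T_Mod_def linear_maps_def)
    show "Cmp (T_Mod R A \<rho> d \<sigma> x \<theta>) U U V f (Ident (T_Mod R A \<rho> d \<sigma> x \<theta>) U) = f"
      "Cmp (T_Mod R A \<rho> d \<sigma> x \<theta>) U V V (Ident (T_Mod R A \<rho> d \<sigma> x \<theta>) V) f = f"
      using f by (auto simp: U T_Mod_def compose_def fun_eq_iff PiE_iff extensional_def)
  next
    fix S U V W f g h
    assume "f \<in> Hom (T_Mod R A \<rho> d \<sigma> x \<theta>) S U"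
    moreover obtain M D N D' where "S = (M, D)" "U = (N, D')" by fastforce
    ultimately have S: "S = (M, D)" "U = (N, D')" and f: "f \<in> carrier M \<rightarrow>\<^sub>E carrier N"
      by (auto simp: T_Mod_def linear_maps_def)
    show "Cmp (T_Mod R A \<rho> d \<sigma> x \<theta>) S U W (Cmp (T_Mod R A \<rho> d \<sigma> x \<theta>) U V W h g) f =
      Cmp (T_Mod R A \<rho> d \<sigma> x \<theta>) S V W h (Cmp (T_Mod R A \<rho> d \<sigma> x \<theta>) S U V g f)"
      using assoc[OF f] by (simp add: S T_Mod_def case_prod_beta)
  qed
qed

context twisted_calculus
begin

section \<open>The bijection on objects and the equality of morphism sets\<close>

abbreviation "CN \<equiv> nabla_Mod R A \<rho> d \<sigma> x \<theta> ::
  (('a, 'm) module \<times> ('m \<Rightarrow> ('a, 'm) m_omega), 'm \<Rightarrow> 'm) category"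
abbreviation "CT \<equiv> T_Mod R A \<rho> d \<sigma> x \<theta> ::
  (('a, 'm) module \<times> (nat \<Rightarrow> 'm \<Rightarrow> 'm), 'm \<Rightarrow> 'm) category"
abbreviation "crd M \<equiv> tensor_basis.coord A M \<Omega> (\<lambda>i V. coef i (E V))"

text \<open>The restrictions match the extensional function spaces in \<open>T_Mod\<close>; they
  make the passage invertible on the nose.\<close>

definition to_derivs :: "('a, 'm) module \<times> ('m \<Rightarrow> ('a, 'm) m_omega) \<Rightarrow>
    ('a, 'm) module \<times> (nat \<Rightarrow> 'm \<Rightarrow> 'm)" where
  "to_derivs = (\<lambda>(M, \<nu>). (M, \<lambda>i\<in>{..<d}. \<lambda>s\<in>carrier M. crd M i (\<nu> s)))"

definition to_connection :: "('a, 'm) module \<times> (nat \<Rightarrow> 'm \<Rightarrow> 'm) \<Rightarrow>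
    ('a, 'm) module \<times> ('m \<Rightarrow> ('a, 'm) m_omega)" where
  "to_connection = (\<lambda>(M, D). (M, \<lambda>s\<in>carrier M.
     \<Oplus>\<^bsub>tensor A M \<Omega>\<^esub>i\<in>{..<d}. tens A M \<Omega> (D i s) (dx i)))"

lemma connection_moduleI: "Module.module A M \<Longrightarrow> connection_module R A \<rho> d \<sigma> x \<theta> M"
  by (simp add: connection_module_def twisted_calculus_axioms)

lemma to_derivs_Obj:
  assumes "U \<in> Obj CN"
  shows "to_derivs U \<in> Obj CT" "to_connection (to_derivs U) = U"
proof -
  obtain M \<nu> where U: "U = (M, \<nu>)" and M: "Module.module A M"
    and conn: "twisted_connection R A \<rho> d \<sigma> x \<theta> M \<nu>"
    using assms by (auto simp: nabla_Mod_def)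
  interpret connection_module R A \<rho> d \<sigma> x \<theta> M by (rule connection_moduleI[OF M])
  have nu: "\<nu> \<in> carrier M \<rightarrow>\<^sub>E carrier Om.T"
    and add: "\<And>i s t. i < d \<Longrightarrow> s \<in> carrier M \<Longrightarrow> t \<in> carrier M \<Longrightarrow>
      Om.coord i (\<nu> (s \<oplus>\<^bsub>M\<^esub> t)) = Om.coord i (\<nu> s) \<oplus>\<^bsub>M\<^esub> Om.coord i (\<nu> t)"
    and mult: "\<And>i f s. i < d \<Longrightarrow> f \<in> carrier A \<Longrightarrow> s \<in> carrier M \<Longrightarrow> Om.coord i (\<nu> (f \<odot>\<^bsub>M\<^esub> s)) =
        tder i f \<odot>\<^bsub>M\<^esub> s \<oplus>\<^bsub>M\<^esub> \<sigma> i f \<odot>\<^bsub>M\<^esub> Om.coord i (\<nu> s)"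
    using conn unfolding twisted_connection_iff by blast+
  have nu_closed: "\<nu> s \<in> carrier Om.T" if "s \<in> carrier M" for s using nu that by blast
  have c: "Om.coord i (\<nu> s) \<in> carrier M" if "i < d" "s \<in> carrier M" for i s
    using that by (simp add: Om.coord_closed nu_closed)
  show "to_derivs U \<in> Obj CT"
    unfolding U to_derivs_def T_Mod_def using M c
    by (simp add: add mult deriv_rho sigma_rho)
  have "(\<Oplus>\<^bsub>Om.T\<^esub>i\<in>{..<d}. Om.tn ((\<lambda>i\<in>{..<d}. \<lambda>s\<in>carrier M. Om.coord i (\<nu> s)) i s) (dx i)) = \<nu> s"
    if s: "s \<in> carrier M" for s
  proof -
    have "(\<Oplus>\<^bsub>Om.T\<^esub>i\<in>{..<d}. Om.tn ((\<lambda>i\<in>{..<d}. \<lambda>s\<in>carrier M. Om.coord i (\<nu> s)) i s) (dx i)) =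
        (\<Oplus>\<^bsub>Om.T\<^esub>i\<in>{..<d}. Om.tn (Om.coord i (\<nu> s)) (dx i))"
      using s c by (intro Om.T.finsum_cong') (auto simp: dx_closed)
    also have "\<dots> = \<nu> s" using Om.tensor_expand[OF nu_closed[OF s]] by simp
    finally show ?thesis .
  qed
  then show "to_connection (to_derivs U) = U"
    unfolding U to_derivs_def to_connection_def using nu
    by (auto simp: fun_eq_iff PiE_iff extensional_def)
qed

text \<open>By \<open>coord_expand\<close> the coordinates of the sum are the given operators again.
  The criterion \<open>twisted_connection_iff\<close> is thus the Leibniz rule for them, and reading
  off coordinates restores the original object.\<close>

lemma to_connection_Obj:
  assumes "V \<in> Obj CT"
  shows "to_connection V \<in> Obj CN" "to_derivs (to_connection V) = V"
proof -
  obtain M D where V: "V = (M, D)" and M: "Module.module A M"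
    and D: "D \<in> {..<d} \<rightarrow>\<^sub>E (carrier M \<rightarrow>\<^sub>E carrier M)"
    and add: "\<And>i s t. i < d \<Longrightarrow> s \<in> carrier M \<Longrightarrow> t \<in> carrier M \<Longrightarrow> D i (s \<oplus>\<^bsub>M\<^esub> t) = D i s \<oplus>\<^bsub>M\<^esub> D i t"
    and mult: "\<And>i f s. i < d \<Longrightarrow> f \<in> carrier A \<Longrightarrow> s \<in> carrier M \<Longrightarrow> D i (f \<odot>\<^bsub>M\<^esub> s) =
        tder i f \<odot>\<^bsub>M\<^esub> s \<oplus>\<^bsub>M\<^esub> \<sigma> i f \<odot>\<^bsub>M\<^esub> D i s"
    using assms by (auto simp: T_Mod_def)
  interpret connection_module R A \<rho> d \<sigma> x \<theta> M by (rule connection_moduleI[OF M])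
  have D_closed: "D i s \<in> carrier M" if "i < d" "s \<in> carrier M" for i s
    using D that by (auto simp: PiE_iff)
  let ?\<nu> = "\<lambda>s\<in>carrier M. \<Oplus>\<^bsub>Om.T\<^esub>i\<in>{..<d}. Om.tn (D i s) (dx i)"
  have nu: "?\<nu> \<in> carrier M \<rightarrow>\<^sub>E carrier Om.T"
    by (auto intro!: Om.T.finsum_closed simp: D_closed dx_closed)
  have coord: "Om.coord i (?\<nu> s) = D i s" if "i < d" "s \<in> carrier M" for i s
    using that Om.coord_expand[of i "\<lambda>i. D i s"] by (simp add: D_closed)
  have "twisted_connection R A \<rho> d \<sigma> x \<theta> M ?\<nu>"
    unfolding twisted_connection_iff
    using nu by (auto simp: coord add mult M.a_closed simp del: restrict_apply restrict_apply')
  then show "to_connection V \<in> Obj CN"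
    using M by (simp add: V to_connection_def nabla_Mod_def)
  show "to_derivs (to_connection V) = V"
    unfolding V to_connection_def to_derivs_def using coord D
    by (auto simp: fun_eq_iff PiE_iff extensional_def restrict_def)
qed

text \<open>Coordinates detect equality in the target tensor product, and the map induced by
  \<open>u\<close> acts on them through \<open>u\<close>. The two conditions on a linear map
  therefore coincide.\<close>

lemma Hom_to_derivs:
  assumes "U \<in> Obj CN" "V \<in> Obj CN"
  shows "Hom CN U V = Hom CT (to_derivs U) (to_derivs V)"
proof -
  obtain M \<nu> N \<nu>' where U: "U = (M, \<nu>)" "V = (N, \<nu>')" and M: "Module.module A M" and N: "Module.module A N"
    and conn: "twisted_connection R A \<rho> d \<sigma> x \<theta> M \<nu>" "twisted_connection R A \<rho> d \<sigma> x \<theta> N \<nu>'"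
    using assms by (auto simp: nabla_Mod_def)
  interpret ON: tensor_basis A N \<Omega> "{..<d}" dx "\<lambda>i V. coef i (E V)" by (rule Omega_basis[OF N])
  have "\<nu>' (u s) = tensor_map A M \<Omega> N \<Omega> u (\<lambda>\<omega>. \<omega>) (\<nu> s) \<longleftrightarrow>
      (\<forall>i<d. crd N i (\<nu>' (u s)) = u (crd M i (\<nu> s)))"
    if u: "u \<in> linear_maps A M N" and s: "s \<in> carrier M" for u s
  proof -
    have nu: "\<nu> s \<in> carrier (tensor A M \<Omega>)"
      using conn(1) s by (auto simp: twisted_connection_def)
    have "u s \<in> carrier N" using u s by (auto simp: linear_maps_def)
    then have nu': "\<nu>' (u s) \<in> carrier (tensor A N \<Omega>)"
      using conn(2) by (auto simp: twisted_connection_def)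
    show ?thesis
    proof
      assume "\<nu>' (u s) = tensor_map A M \<Omega> N \<Omega> u (\<lambda>\<omega>. \<omega>) (\<nu> s)"
      then show "\<forall>i<d. crd N i (\<nu>' (u s)) = u (crd M i (\<nu> s))"
        by (simp add: coord_tensor_map[OF M N u nu])
    next
      assume *: "\<forall>i<d. crd N i (\<nu>' (u s)) = u (crd M i (\<nu> s))"
      show "\<nu>' (u s) = tensor_map A M \<Omega> N \<Omega> u (\<lambda>\<omega>. \<omega>) (\<nu> s)"
        by (rule ON.tensor_eqI[OF nu' tensor_map_closed[OF M N u nu]])
          (use * in \<open>simp add: coord_tensor_map[OF M N u nu]\<close>)
    qed
  qed
  then have "Hom CN U V = {u \<in> linear_maps A M N. \<forall>i<d. \<forall>s\<in>carrier M. crd N i (\<nu>' (u s)) = u (crd M i (\<nu> s))}"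
    by (auto simp: U nabla_Mod_def)
  also have "\<dots> = Hom CT (to_derivs U) (to_derivs V)"
    by (auto simp: U to_derivs_def T_Mod_def linear_maps_def PiE_iff)
  finally show ?thesis .
qed

lemma equivalence:
  "equivalent_categories
    (nabla_Mod R A \<rho> d \<sigma> x \<theta>
      :: (('a, 'm) module \<times> ('m \<Rightarrow> ('a, 'm) m_omega), 'm \<Rightarrow> 'm) category)
    (T_Mod R A \<rho> d \<sigma> x \<theta>
      :: (('a, 'm) module \<times> (nat \<Rightarrow> 'm \<Rightarrow> 'm), 'm \<Rightarrow> 'm) category)"
  by (rule isomorphic_equivalent_categories[where F = to_derivs and G = to_connection])
    (simp_all add: T_Mod_category to_derivs_Obj to_connection_Obj Hom_to_derivs,
     auto simp: nabla_Mod_def T_Mod_def to_derivs_def)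

end

theorem theorem5p25:
  fixes R :: "'r topring" and A :: "'a topring" and \<rho> :: "'r \<Rightarrow> 'a"
    and d :: nat and \<sigma> :: "nat \<Rightarrow> 'a \<Rightarrow> 'a" and x :: "nat \<Rightarrow> 'a"
    and \<theta> :: "nat \<Rightarrow> 'a \<Rightarrow> (nat multiset \<Rightarrow> 'a) set"
  assumes "huber_ring R"
    and "twisted_adic_algebra R A \<rho> d \<sigma>"
    and "\<forall>i<d. x i \<in> carrier A"
    and "sigma_coords R A \<rho> d \<sigma> x \<and> \<theta> = Theta R A \<rho> d \<sigma> x \<or>
         (\<exists>R0 A0. good_sigma_coords R A \<rho> d \<sigma> x R0 A0 \<and> \<theta> = good_Theta R A \<rho> d \<sigma> x R0 A0)"
    and "classical_coords A d \<sigma> x \<theta>"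
  shows "equivalent_categories
    (nabla_Mod R A \<rho> d \<sigma> x \<theta>
      :: (('a, 'm) module \<times> ('m \<Rightarrow> ('a, 'm) m_omega), 'm \<Rightarrow> 'm) category)
    (T_Mod R A \<rho> d \<sigma> x \<theta>
      :: (('a, 'm) module \<times> (nat \<Rightarrow> 'm \<Rightarrow> 'm), 'm \<Rightarrow> 'm) category)"
proof -
  \<comment> \<open>The distinction between the two kinds of coordinates disappears here:
    \<open>coords_taylor_hom\<close> supplies the same algebraic data in either case.\<close>
  interpret twisted_calculus R A \<rho> d \<sigma> x \<theta>
    using twisted_ringI[OF assms(2,3)] twisted_adic_algebraD[OF assms(2)] coords_taylor_hom[OF assms(4)] assms(5)
    by (simp add: twisted_calculus_def twisted_calculus_axioms_def twisted_ring_1_def)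
  show ?thesis by (rule equivalence)
qed

end
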